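(* Let $F_1, F_2$ be convex isometric cones in $E^3$. Then there exists an isometry of $E^3$ that maps those cones (by moving one of them relative to the other) to cones whose isometric combination is a strictly convex cone.
   Context: $E^3$ is the Euclidean $3$-space. A convex cone here means the boundary surface of a convex solid cone with non-empty interior in $E^3$; it is strictly convex if it has a supporting plane that meets it only at its vertex. Two cones are isometric if there is a bijection between them, sending vertex to vertex, that preserves the induced intrinsic (length) metrics. Given isometric cones $K_1, K_2$ placed with their vertices at the origin, write them as $R_1 = t\, r_1(s)$ and $R_2 = t\, r_2(s)$, $t \ge 0$, where $|r_1(s)| = |r_2(s)| = 1$, $s$ is the arc-length parameter on the curves in which the cones meet the unit sphere, and the points with equal parameters $(t,s)$ correspond to each other under the isometry. The isometric combination of $K_1$ and $K_2$ is the cone with position vector $R = t\,(r_1(s) + r_2(s))$.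
   Formalization: Added assumption: the isometry between the cones maps no straight line through the vertex of F1 onto a straight line; otherwise (e.g. two planes, or dihedral angles with corresponding edges) the isometric combination is never strictly convex and the claim fails. *)

theory Defs
  imports "HOL-Analysis.Analysis"
begin

definition curve_length :: "(real \<Rightarrow> 'a::metric_space) \<Rightarrow> real \<Rightarrow> real \<Rightarrow> ennreal" where
  "curve_length g a b =
     (SUP ts \<in> {ts. sorted ts \<and> set ts \<subseteq> {a..b}}.
        ennreal (\<Sum>i<length ts - 1. dist (g (ts ! i)) (g (ts ! Suc i))))"

definition intrinsic_dist :: "'a::metric_space set \<Rightarrow> 'a \<Rightarrow> 'a \<Rightarrow> ennreal" where
  "intrinsic_dist F x y =
     (INF g \<in> {g. continuous_on {0..1} g \<and> g ` {0..1} \<subseteq> F \<and> g 0 = x \<and> g 1 = y}.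
        curve_length g 0 1)"

text \<open>The predicate \<open>convex_cone\<close> of the library describes solid cones with apex at the origin.
  The condition \<open>S \<noteq> UNIV\<close> ensures that the boundary is not empty. Boundaries of half-spaces
  and of dihedral angles are included, and for these the vertex \<open>v\<close> is not determined by \<open>F\<close>.\<close>

definition convex_cone_surface :: "real^3 \<Rightarrow> (real^3) set \<Rightarrow> bool" where
  "convex_cone_surface v F \<longleftrightarrow>
     (\<exists>S. convex_cone S \<and> interior S \<noteq> {} \<and> S \<noteq> UNIV \<and> F = (\<lambda>x. v + x) ` frontier S)"

definition strictly_convex_cone_surface :: "real^3 \<Rightarrow> (real^3) set \<Rightarrow> bool" where
  "strictly_convex_cone_surface v F \<longleftrightarrow>
     convex_cone_surface v F \<and>
     (\<exists>n c. n \<noteq> 0 \<and> (\<forall>x\<in>F. c \<le> n \<bullet> x) \<and> F \<inter> {x. n \<bullet> x = c} = {v})"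

definition cone_isometry ::
  "real^3 \<Rightarrow> (real^3) set \<Rightarrow> real^3 \<Rightarrow> (real^3) set \<Rightarrow> (real^3 \<Rightarrow> real^3) \<Rightarrow> bool" where
  "cone_isometry v1 F1 v2 F2 f \<longleftrightarrow>
     bij_betw f F1 F2 \<and> f v1 = v2 \<and>
     (\<forall>x\<in>F1. \<forall>y\<in>F1. intrinsic_dist F2 (f x) (f y) = intrinsic_dist F1 x y)"

text \<open>A convex cone contains a straight line through its vertex only if it is a plane or a dihedral
  angle. Isometries of such cones taking a line to a line have to be excluded: corresponding opposite
  rays yield opposite rays of the isometric combination, which then cannot be strictly convex.\<close>

definition maps_line_to_line :: "real^3 \<Rightarrow> (real^3) set \<Rightarrow> (real^3 \<Rightarrow> real^3) \<Rightarrow> bool" where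
  "maps_line_to_line v F f \<longleftrightarrow>
     (\<exists>u w. u \<noteq> 0 \<and> w \<noteq> 0 \<and> range (\<lambda>t. v + t *\<^sub>R u) \<subseteq> F \<and>
        f ` range (\<lambda>t. v + t *\<^sub>R u) = range (\<lambda>t. f v + t *\<^sub>R w))"

text \<open>Arc-length parametrization, by \<open>[0, L]\<close>, of the closed curve in which a cone \<open>K\<close>
  with vertex at the origin meets the unit sphere; continuity follows from the length condition.\<close>

definition arc_length_param :: "(real^3) set \<Rightarrow> real \<Rightarrow> (real \<Rightarrow> real^3) \<Rightarrow> bool" where
  "arc_length_param K L r \<longleftrightarrow>
     0 < L \<and> r ` {0..L} = K \<inter> sphere 0 1 \<and> r 0 = r L \<and> inj_on r {0..<L} \<and>
     (\<forall>s\<in>{0..L}. curve_length r 0 s = ennreal s)"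

text \<open>\<open>C\<close> is the isometric combination, with respect to the isometry \<open>f\<close>, of the cones
  \<open>K1\<close> and \<open>K2\<close> with vertices at the origin.\<close>

definition isometric_combination ::
  "(real^3) set \<Rightarrow> (real^3) set \<Rightarrow> (real^3 \<Rightarrow> real^3) \<Rightarrow> (real^3) set \<Rightarrow> bool" where
  "isometric_combination K1 K2 f C \<longleftrightarrow>
     (\<exists>L r1 r2. arc_length_param K1 L r1 \<and> arc_length_param K2 L r2 \<and>
        (\<forall>t\<ge>0. \<forall>s\<in>{0..L}. f (t *\<^sub>R r1 s) = t *\<^sub>R r2 s) \<and>
        C = {t *\<^sub>R (r1 s + r2 s) |t s. 0 \<le> t \<and> s \<in> {0..L}})"

end

theory Submission
  imports Defs
begin

text \<open>
Put both vertices at the origin. Every solid cone has a unit vector \<open>e\<close> in its interior such that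
\<open>e \<bullet> x \<ge> 0\<close> on the cone, with equality only at points \<open>x\<close> whose whole line lies in the cone
(\<open>exists_central_axis\<close>). Take coordinates in \<open>complex \<times> real\<close> whose vertical axis is this \<open>e\<close>,
for both cones. A rotation of the second cone about the vertical axis, possibly after a reflection, is enough.

\<^bold>\<open>Unit sections.\<close> Let \<open>r\<close> be the unit section of one cone in arc length, with azimuth \<open>\<phi>\<close> and
angle \<open>\<theta>\<close> to the axis. Put \<open>g = tan (\<theta> / 2)\<close>, so \<open>0 < g \<le> 1\<close>, and let \<open>\<psi>\<close> be the angle from the
circle of latitude up to the right tangent of \<open>r\<close>. Then \<open>\<phi>' = cos \<psi> / sin \<theta>\<close> and \<open>\<theta>' = - sin \<psi>\<close>,
and convexity of the cone yields \<open>\<psi>' \<ge> - cos \<psi> cot \<theta>\<close>, with equality where the cone is flat. A cone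
may have edges, so \<open>\<psi>\<close> jumps (upwards) and only one-sided rates make sense; the basic tool is
the monotonicity criterion \<open>nondecreasing_if_rates_nonneg\<close>. The locale \<open>convex_arc\<close> records these
facts, and \<open>arc_length_azimuth.convex_arc\<close> derives them from convexity.

\<^bold>\<open>Twist.\<close> The point, the right tangent and the normal form an orthonormal frame along each section.
Write the rotation that carries the frame of \<open>r\<^sub>1\<close> at \<open>u\<close> to the frame of \<open>r\<^sub>2\<close> at \<open>s\<close> as a rotation
about the axis followed by one about a horizontal line; \<open>twist u s\<close> is half the angle of the former.
It increases in \<open>s\<close>, decreases in \<open>u\<close>, and changes by \<open>pi\<close> when one of the sections is run through
once. To compare \<open>twist s s\<close> with \<open>twist u u\<close>, change the two arguments one after the other:
monotonicity gives an oscillation of the diagonal values below \<open>pi\<close>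
(\<open>diagonal_twist_oscillation\<close>). A rotation about the axis adds a constant to the twist, so it can
be chosen with \<open>\<bar>twist s s\<bar> < pi / 2\<close> for all \<open>s\<close>. This two-variable argument is the heart of the proof.

\<^bold>\<open>The combination.\<close> Project \<open>r\<^sub>1 s + r\<^sub>2 s\<close> centrally to the plane at height 1. The
right derivative of the projection is \<open>k *\<^sub>R (\<i> * cis \<Psi>)\<close>, where \<open>k\<close> has the sign of
\<open>cos (twist s s)\<close> (\<open>chart_deriv\<close>) and \<open>\<Psi>\<close> is an explicit angle. In the flat case the rates of
\<open>\<phi>\<^sub>1, \<phi>\<^sub>2, \<psi>\<^sub>1, \<psi>\<^sub>2\<close> cancel in \<open>\<Psi>\<close>, so \<open>\<Psi>\<close> is nondecreasing in general, and it grows by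
\<open>2 * pi\<close> in total (\<open>tangent_angle_mono\<close>, \<open>tangent_angle_closing\<close>). Hence the projection is a
closed convex curve, and the cone over it is the boundary of a convex cone (\<open>frontier_body\<close>)
which meets the horizontal plane at its vertex only.

\<^bold>\<open>The isometry.\<close> An isometry of cones preserves the distance to the vertex, hence it is homogeneous on
rays, and it preserves lengths of curves. So \<open>r\<^sub>2 = f \<circ> r\<^sub>1\<close> is again in arc length, and its azimuth is
monotone because \<open>r\<^sub>2\<close> is injective on the half-open period; a reflection makes it increasing. The
projection requires that \<open>r\<^sub>1 s\<close> and \<open>r\<^sub>2 s\<close> are never both horizontal. If they were, both
cones would contain the lines through these points, and \<open>f\<close> would map one line to the other
(\<open>opposite_rays_line\<close>), which is excluded by hypothesis.
\<close>

section \<open>One-sided growth\<close>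

text \<open>A lower bound for the right Dini derivative, witnessed by a minorant that is differentiable from the right. Convexity
provides such minorants for the slope angle, and they pass through monotone operations.\<close>
definition lower_right_rate :: "(real \<Rightarrow> real) \<Rightarrow> real \<Rightarrow> real \<Rightarrow> bool" where
  "lower_right_rate E s c \<longleftrightarrow>
     (\<exists>F. F s = E s \<and> (F has_real_derivative c) (at_right s) \<and> (\<forall>\<^sub>F x in at_right s. F x \<le> E x))"

definition no_downward_jump :: "(real \<Rightarrow> real) \<Rightarrow> real \<Rightarrow> bool" where
  "no_downward_jump E s \<longleftrightarrow> (\<forall>e>0. \<forall>\<^sub>F x in at_left s. E x < E s + e)"

lemma lower_right_rateI:
  assumes "(E has_real_derivative c) (at_right s)"
  shows "lower_right_rate E s c"
  unfolding lower_right_rate_def using assms by (intro exI[of _ E]) auto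

lemma lower_right_rate_add:
  assumes "lower_right_rate E s c" "(A has_real_derivative d) (at_right s)"
  shows "lower_right_rate (\<lambda>x. A x + E x) s (d + c)"
proof -
  obtain F where F: "F s = E s" "(F has_real_derivative c) (at_right s)" "\<forall>\<^sub>F x in at_right s. F x \<le> E x"
    using assms(1) unfolding lower_right_rate_def by blast
  show ?thesis unfolding lower_right_rate_def
  proof (intro exI[of _ "\<lambda>x. A x + F x"] conjI)
    show "((\<lambda>x. A x + F x) has_real_derivative d + c) (at_right s)"
      using assms(2) F(2) by (rule DERIV_add)
    show "\<forall>\<^sub>F x in at_right s. A x + F x \<le> A x + E x"
      using F(3) by eventually_elim simp
  qed (use F in simp)
qed

lemma no_downward_jump_add:
  assumes "no_downward_jump E s" "no_downward_jump A s"
  shows "no_downward_jump (\<lambda>x. A x + E x) s"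
  unfolding no_downward_jump_def
proof (intro allI impI)
  fix e :: real assume "e > 0"
  then have "\<forall>\<^sub>F x in at_left s. E x < E s + e/2" "\<forall>\<^sub>F x in at_left s. A x < A s + e/2"
    using assms unfolding no_downward_jump_def by auto
  then show "\<forall>\<^sub>F x in at_left s. A x + E x < A s + E s + e"
    by eventually_elim simp
qed

lemma no_downward_jump_continuous:
  assumes "(E \<longlongrightarrow> E s) (at_left s)"
  shows "no_downward_jump E s"
  unfolding no_downward_jump_def using order_tendstoD(2)[OF assms] by simp

lemma lower_right_rate_affine:
  assumes "lower_right_rate E s c" "k \<ge> 0"
  shows "lower_right_rate (\<lambda>x. k * E x + b) s (k * c)"
proof -
  obtain F where F: "F s = E s" "(F has_real_derivative c) (at_right s)" "\<forall>\<^sub>F x in at_right s. F x \<le> E x"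
    using assms(1) unfolding lower_right_rate_def by blast
  show ?thesis unfolding lower_right_rate_def
    using F assms(2)
    by (intro exI[of _ "\<lambda>x. k * F x + b"])
       (auto intro!: derivative_eq_intros mult_left_mono elim!: eventually_mono)
qed

lemma no_downward_jump_affine:
  assumes "no_downward_jump E s" "k > 0"
  shows "no_downward_jump (\<lambda>x. k * E x + b) s"
  unfolding no_downward_jump_def
proof (intro allI impI)
  fix e :: real assume "e > 0"
  then have "\<forall>\<^sub>F x in at_left s. E x < E s + e/k"
    using assms unfolding no_downward_jump_def by auto
  then show "\<forall>\<^sub>F x in at_left s. k * E x + b < k * E s + b + e"
    by eventually_elim (use assms(2) in \<open>simp add: field_simps\<close>)
qed

text \<open>A Dini-type criterion. Up to a slack \<open>e * (y - a)\<close> the set of points reached without losing height is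
an initial interval. It is closed because there are no downward jumps from the left, and it can be
prolonged to the right because of the rates.\<close>
lemma nondecreasing_if_rates_nonneg:
  fixes E :: "real \<Rightarrow> real"
  assumes ab: "a \<le> b"
    and right: "\<And>s. a \<le> s \<Longrightarrow> s < b \<Longrightarrow> \<exists>c\<ge>0. lower_right_rate E s c"
    and left: "\<And>s. a < s \<Longrightarrow> s \<le> b \<Longrightarrow> no_downward_jump E s"
  shows "E a \<le> E b"
proof (rule field_le_epsilon)
  fix e0 :: real assume e0: "e0 > 0"
(* distribute the admissible loss e0 linearly; the + 1 covers the case a = b *)
  define e where "e = e0 / (b - a + 1)"
  have e: "e > 0" using e0 ab by (simp add: e_def)
  define X where "X = {x \<in> {a..b}. \<forall>y\<in>{a..x}. E a - e * (y - a) \<le> E y}"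
  have aX: "a \<in> X" using ab by (auto simp: X_def)
  have bdd: "bdd_above X" by (rule bdd_aboveI[of _ b]) (auto simp: X_def)
  define m where "m = Sup X"
  have am: "a \<le> m" unfolding m_def using aX bdd by (rule cSup_upper)
  have mb: "m \<le> b" unfolding m_def using aX by (intro cSup_least) (auto simp: X_def)
  have below: "E a - e * (y - a) \<le> E y" if "a \<le> y" "y < m" for y
  proof -
    obtain x where "x \<in> X" "y < x"
      using \<open>y < m\<close> aX less_cSupD[of X y] unfolding m_def by blast
    then show ?thesis using that by (auto simp: X_def)
  qed
  have atm: "E a - e * (m - a) \<le> E m"
  proof (cases "a = m")
    case False
    then have "a < m" using am by simp
    show ?thesis
    proof (rule field_le_epsilon)
      fix e1 :: real assume "e1 > 0"
      then have "\<forall>\<^sub>F x in at_left m. E x < E m + e1"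
        using left[OF \<open>a < m\<close> mb] by (simp add: no_downward_jump_def)
      moreover have "\<forall>\<^sub>F x in at_left m. a < x \<and> x < m"
        using \<open>a < m\<close> eventually_at_left_field by (auto intro!: exI[of _ a])
      ultimately have "\<forall>\<^sub>F x in at_left m. E a - e * (m - a) < E m + e1"
      proof eventually_elim
        case (elim x)
        then have "E a - e * (x - a) \<le> E x" using below[of x] by simp
        moreover have "e * (x - a) \<le> e * (m - a)" using elim e by simp
        ultimately show ?case using elim by linarith
      qed
      then obtain x where "E a - e * (m - a) < E m + e1"
        using eventually_happens'[OF trivial_limit_at_left_real] by blast
      then show "E a - e * (m - a) \<le> E m + e1" by simp
    qed
  qed simp
  have "m = b"
  proof (rule ccontr)
    assume "m \<noteq> b"
    then have "m < b" using mb by simp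
    obtain c F where c: "c \<ge> 0" and F: "F m = E m" "(F has_real_derivative c) (at_right m)"
      "\<forall>\<^sub>F x in at_right m. F x \<le> E x"
      using right[OF am \<open>m < b\<close>] unfolding lower_right_rate_def by blast
    have "((\<lambda>x. (F x - F m) / (x - m)) \<longlongrightarrow> c) (at_right m)"
      using F(2) by (simp add: has_field_derivative_iff)
    then have "\<forall>\<^sub>F x in at_right m. - e < (F x - F m) / (x - m)"
      using e c by (intro order_tendstoD(1)) auto
    moreover have "\<forall>\<^sub>F x in at_right m. m < x \<and> x < b"
      using \<open>m < b\<close> eventually_at_right_field by (auto intro!: exI[of _ b])
    ultimately have "\<forall>\<^sub>F x in at_right m. E a - e * (x - a) \<le> E x \<and> x < b"
      using F(3)
    proof eventually_elim
      case (elim x)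
      then have "- e * (x - m) < F x - F m"
        by (simp add: pos_less_divide_eq)
      then show ?case using elim F(1) atm by (simp add: algebra_simps)
    qed
    then obtain d where d: "d > m" "\<And>x. m < x \<Longrightarrow> x < d \<Longrightarrow> E a - e * (x - a) \<le> E x \<and> x < b"
      unfolding eventually_at_right_field by auto
    define x where "x = (m + d) / 2"
    have x: "m < x" "x < d" using d(1) by (auto simp: x_def)
    have "x \<in> X"
      unfolding X_def
    proof (intro CollectI conjI ballI)
      show "x \<in> {a..b}" using d(2)[OF x] x am by auto
      fix y assume "y \<in> {a..x}"
      then show "E a - e * (y - a) \<le> E y"
        using below[of y] atm d(2)[of y] x by (cases y m rule: linorder_cases) auto
    qed
    then have "x \<le> m" unfolding m_def using bdd by (rule cSup_upper)
    then show False using x by simp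
  qed
  then have "E a - e * (b - a) \<le> E b" using atm by simp
  moreover have "e * (b - a) \<le> e0" using e0 ab by (simp add: e_def field_simps)
  ultimately show "E a \<le> E b + e0" by linarith
qed

lemma growth_if_rates_ge:
  fixes E :: "real \<Rightarrow> real"
  assumes ab: "a \<le> b"
    and right: "\<And>s. a \<le> s \<Longrightarrow> s < b \<Longrightarrow> \<exists>c\<ge>k. lower_right_rate E s c"
    and left: "\<And>s. a < s \<Longrightarrow> s \<le> b \<Longrightarrow> no_downward_jump E s"
  shows "E a + k * (b - a) \<le> E b"
proof -
  have "- k * a + E a \<le> - k * b + E b"
  proof (rule nondecreasing_if_rates_nonneg[OF ab, where E = "\<lambda>x. - k * x + E x"])
    fix s assume "a \<le> s" "s < b"
    then obtain c where "c \<ge> k" "lower_right_rate E s c" using right by blast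
    moreover have "((\<lambda>x. - k * x) has_real_derivative - k) (at_right s)"
      by (auto intro!: derivative_eq_intros)
    ultimately show "\<exists>c\<ge>0. lower_right_rate (\<lambda>x. - k * x + E x) s c"
      using lower_right_rate_add[of E s c "\<lambda>x. - k * x" "- k"] by (intro exI[of _ "- k + c"]) auto
  next
    fix s assume "a < s" "s \<le> b"
    then show "no_downward_jump (\<lambda>x. - k * x + E x) s"
      by (intro no_downward_jump_add left no_downward_jump_continuous tendsto_intros)
  qed
  then show ?thesis by (simp add: algebra_simps)
qed

lemma nondecreasing_if_right_derivative_nonneg:
  fixes f :: "real \<Rightarrow> real"
  assumes "a \<le> b" "continuous_on {a..b} f"
    and "\<And>s. a \<le> s \<Longrightarrow> s < b \<Longrightarrow> \<exists>c\<ge>0. (f has_real_derivative c) (at_right s)"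
  shows "f a \<le> f b"
proof (rule nondecreasing_if_rates_nonneg[OF assms(1)])
  show "\<exists>c\<ge>0. lower_right_rate f s c" if "a \<le> s" "s < b" for s
    using assms(3)[OF that] lower_right_rateI by blast
  show "no_downward_jump f s" if "a < s" "s \<le> b" for s
    using that by (intro no_downward_jump_continuous continuous_on_Icc_at_leftD[of a s f]
        continuous_on_subset[OF assms(2)]) auto
qed

text \<open>Mean value inequality for a one-sided derivative: test the curve against the direction of its chord.\<close>
lemma right_derivative_bound:
  fixes f :: "real \<Rightarrow> 'a::real_inner"
  assumes ab: "a \<le> b" and cont: "continuous_on {a..b} f"
    and der: "\<And>s. a \<le> s \<Longrightarrow> s < b \<Longrightarrow> \<exists>D. (f has_vector_derivative D) (at_right s) \<and> norm D \<le> M"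
  shows "dist (f a) (f b) \<le> M * (b - a)"
proof (cases "f a = f b")
  case True
  show ?thesis
  proof (cases "a = b")
    case False
    then obtain D where "norm (D::'a) \<le> M" using der[of a] ab by auto
    then have "0 \<le> M" using norm_ge_zero order_trans by blast
    then show ?thesis using True ab by simp
  qed (use True in simp)
next
  case False
  define u where "u = f b - f a"
  define w where "w = (\<lambda>x. M * norm u * x - u \<bullet> f x)"
  have "w a \<le> w b"
  proof (rule nondecreasing_if_right_derivative_nonneg[OF ab])
    show "continuous_on {a..b} w" unfolding w_def by (intro continuous_intros cont)
    fix s assume s: "a \<le> s" "s < b"
    obtain D where D: "(f has_vector_derivative D) (at_right s)" "norm D \<le> M" using der[OF s] by blast
    have "((\<lambda>x. u \<bullet> f x) has_vector_derivative u \<bullet> D) (at_right s)"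
      by (rule bounded_linear.has_vector_derivative[OF bounded_linear_inner_right D(1)])
    then have "(w has_real_derivative M * norm u - u \<bullet> D) (at_right s)"
      unfolding w_def has_real_derivative_iff_has_vector_derivative[symmetric]
      by (auto intro!: derivative_eq_intros)
    moreover have "u \<bullet> D \<le> norm u * norm D" by (rule norm_cauchy_schwarz)
    moreover have "norm u * norm D \<le> M * norm u" using mult_right_mono[OF D(2), of "norm u"] by (simp add: mult.commute)
    ultimately show "\<exists>c\<ge>0. (w has_real_derivative c) (at_right s)" by (intro exI[of _ "M * norm u - u \<bullet> D"]) auto
  qed
  then have "u \<bullet> u \<le> M * norm u * (b - a)"
    by (simp add: w_def u_def inner_diff_right algebra_simps)
  then have "norm u * norm u \<le> norm u * (M * (b - a))"
    by (simp add: dot_square_norm power2_eq_square mult_ac)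
  moreover have "norm u > 0" using False by (simp add: u_def)
  ultimately show ?thesis by (simp add: u_def dist_norm norm_minus_commute)
qed

lemma at_right_eq_Ioo:
  fixes s :: real assumes "s < b" shows "at_right s = at s within {s<..<b}"
  by (rule at_within_nhd[of s "{..<b}"]) (use assms in auto)

lemma vector_right_derivative_quotient:
  assumes "(f has_vector_derivative D) (at_right (x::real))"
  shows "((\<lambda>y. (f y - f x) /\<^sub>R (y - x)) \<longlongrightarrow> D) (at_right x)"
proof -
  have "((\<lambda>y. (1 / norm (y - x)) *\<^sub>R (f y - (f x + (y - x) *\<^sub>R D))) \<longlongrightarrow> 0) (at_right x)"
    using assms by (simp add: has_vector_derivative_def has_derivative_within)
  then have lim: "((\<lambda>y. (1 / norm (y - x)) *\<^sub>R (f y - (f x + (y - x) *\<^sub>R D)) + D) \<longlongrightarrow> 0 + D) (at_right x)"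
    by (intro tendsto_intros)
  have "\<forall>\<^sub>F y in at_right x. x < y" by (rule eventually_at_rightI[of _ "x + 1"]) auto
  then have "\<forall>\<^sub>F y in at_right x. (1 / norm (y - x)) *\<^sub>R (f y - (f x + (y - x) *\<^sub>R D)) + D = (f y - f x) /\<^sub>R (y - x)"
    by eventually_elim (simp add: algebra_simps inverse_eq_divide diff_divide_distrib flip: scaleR_diff_left scaleR_add_left)
  then show ?thesis using Lim_transform_eventually[OF lim] by simp
qed

lemma right_derivative_chain:
  fixes f a :: "real \<Rightarrow> real"
  assumes f: "(f has_real_derivative d) (at_right (a s))" and a: "(a has_real_derivative e) (at_right s)"
    and gt: "\<And>x. s < x \<Longrightarrow> x < b \<Longrightarrow> a s < a x" and b: "s < b"
  shows "((\<lambda>x. f (a x)) has_real_derivative d * e) (at_right s)"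
proof -
  have eq: "at_right s = at s within {s<..<b}" using b by (rule at_right_eq_Ioo)
  have "(f has_real_derivative d) (at (a s) within a ` {s<..<b})"
    by (rule has_field_derivative_subset[OF f]) (auto intro: gt)
  from DERIV_image_chain[OF this a[unfolded eq]] show ?thesis unfolding eq by (simp add: o_def)
qed

section \<open>Twist of a pair of arcs on the sphere\<close>

text \<open>The argument of \<open>cis d + G * cis (- d)\<close>, see \<open>skew_angle_polar\<close>.\<close>
definition skew_angle :: "real \<Rightarrow> real \<Rightarrow> real" where
  "skew_angle G d = arctan ((1 - G) / (1 + G) * tan d)"

lemma skew_angle_minus: "skew_angle G (- d) = - skew_angle G d"
  by (simp add: skew_angle_def arctan_minus)

lemma skew_angle_mono:
  assumes "-1 < G" "G \<le> 1" "- (pi/2) < d" "d \<le> d'" "d' < pi/2"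
  shows "skew_angle G d \<le> skew_angle G d'"
proof -
  have "tan d \<le> tan d'" using assms by (intro tan_mono_le) auto
  then show ?thesis unfolding skew_angle_def using assms
    by (intro arctan_monotone' mult_left_mono) auto
qed

lemma skew_angle_deriv:
  assumes G: "(G has_real_derivative G') (at s within S)" and D: "(D has_real_derivative D') (at s within S)"
    and c: "cos (D s) > 0" and G1: "-1 < G s"
  shows "((\<lambda>x. skew_angle (G x) (D x)) has_real_derivative
     ((1 - (G s)\<^sup>2) * D' - G' * sin (2 * D s)) / (1 + (G s)\<^sup>2 + 2 * G s * cos (2 * D s))) (at s within S)"
proof -
  let ?C = "cos (D s)" and ?S = "sin (D s)" and ?G = "G s"
  have den: "1 + ?G\<^sup>2 + 2 * ?G * cos (2 * D s) = (1 + ?G)\<^sup>2 * ?C\<^sup>2 + (1 - ?G)\<^sup>2 * ?S\<^sup>2"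
    unfolding cos_double using sin_cos_squared_add[of "D s"] by algebra
  have pos: "(1 + ?G)\<^sup>2 * ?C\<^sup>2 + (1 - ?G)\<^sup>2 * ?S\<^sup>2 > 0"
    using c G1 by (intro add_pos_nonneg mult_pos_pos) auto
  have ne: "1 + ?G \<noteq> 0" "?C \<noteq> 0" using c G1 by auto
  have T: "((\<lambda>x. (1 - G x) / (1 + G x)) has_real_derivative (- 2 * G' / (1 + ?G)\<^sup>2)) (at s within S)"
    by (rule derivative_eq_intros G ne refl)+ (use ne in \<open>simp add: field_simps power2_eq_square\<close>)
  have V: "((\<lambda>x. tan (D x)) has_real_derivative (D' / ?C\<^sup>2)) (at s within S)"
    by (rule derivative_eq_intros D ne refl)+ (simp add: field_simps)
  have alg: "(- 2 * G' / A\<^sup>2 * (y / x) + D' / x\<^sup>2 * (B / A)) / (1 + (B / A * (y / x))\<^sup>2) =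
      (A * B * D' - G' * (2 * y * x)) / (A\<^sup>2 * x\<^sup>2 + B\<^sup>2 * y\<^sup>2)"
    if "A \<noteq> 0" "x \<noteq> 0" "A\<^sup>2 * x\<^sup>2 + B\<^sup>2 * y\<^sup>2 > 0" for A B x y :: real
  proof -
    have "1 + (B / A * (y / x))\<^sup>2 = (A\<^sup>2 * x\<^sup>2 + B\<^sup>2 * y\<^sup>2) / (A\<^sup>2 * x\<^sup>2)"
      using that by (simp add: add_divide_distrib power_mult_distrib power_divide)
    moreover have "- 2 * G' / A\<^sup>2 * (y / x) + D' / x\<^sup>2 * (B / A) = (A * B * D' - G' * (2 * y * x)) / (A\<^sup>2 * x\<^sup>2)"
      using that by (simp add: field_simps power2_eq_square)
    ultimately show ?thesis using that by simp
  qed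
  have "((\<lambda>x. arctan ((1 - G x) / (1 + G x) * tan (D x))) has_real_derivative
      inverse (1 + ((1 - ?G) / (1 + ?G) * (?S / ?C))\<^sup>2) *
      (- 2 * G' / (1 + ?G)\<^sup>2 * (?S / ?C) + D' / ?C\<^sup>2 * ((1 - ?G) / (1 + ?G)))) (at s within S)"
    using DERIV_chain2[OF DERIV_arctan DERIV_mult[OF T V]] by (simp add: tan_def)
  also have "inverse (1 + ((1 - ?G) / (1 + ?G) * (?S / ?C))\<^sup>2) *
      (- 2 * G' / (1 + ?G)\<^sup>2 * (?S / ?C) + D' / ?C\<^sup>2 * ((1 - ?G) / (1 + ?G))) =
      ((1 + ?G) * (1 - ?G) * D' - G' * (2 * ?S * ?C)) / ((1 + ?G)\<^sup>2 * ?C\<^sup>2 + (1 - ?G)\<^sup>2 * ?S\<^sup>2)"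
    using alg[OF ne pos] by (simp only: divide_inverse mult.commute)
  also have "\<dots> = ((1 - ?G\<^sup>2) * D' - G' * sin (2 * D s)) / (1 + ?G\<^sup>2 + 2 * ?G * cos (2 * D s))"
    unfolding den sin_double by (simp add: algebra_simps power2_eq_square)
  finally show ?thesis unfolding skew_angle_def .
qed

text \<open>By monotonicity of \<open>skew_angle\<close> in its second argument, a differentiable minorant of \<open>D\<close> yields one of
the composition.\<close>
lemma lower_right_rate_skew_angle:
  assumes G: "(G has_real_derivative G') (at_right s)"
    and D: "lower_right_rate D s D'"
    and G_range: "-1 < G s" "\<forall>\<^sub>F x in at_right s. -1 < G x \<and> G x \<le> 1"
    and D_range: "- (pi/2) < D s" "D s < pi/2" "\<forall>\<^sub>F x in at_right s. D x < pi/2"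
  shows "lower_right_rate (\<lambda>x. skew_angle (G x) (D x)) s
     (((1 - (G s)\<^sup>2) * D' - G' * sin (2 * D s)) / (1 + (G s)\<^sup>2 + 2 * G s * cos (2 * D s)))"
proof -
  obtain F where F: "F s = D s" "(F has_real_derivative D') (at_right s)" "\<forall>\<^sub>F x in at_right s. F x \<le> D x"
    using D unfolding lower_right_rate_def by blast
  have "(F \<longlongrightarrow> F s) (at_right s)"
    using F(2) has_field_derivative_imp_has_derivative has_derivative_continuous
    by (metis continuous_within)
  then have "\<forall>\<^sub>F x in at_right s. - (pi/2) < F x"
    using D_range(1) F(1) by (intro order_tendstoD(1)) auto
  then have "\<forall>\<^sub>F x in at_right s. skew_angle (G x) (F x) \<le> skew_angle (G x) (D x)"
    using F(3) G_range(2) D_range(3) by eventually_elim (auto intro: skew_angle_mono)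
  moreover have "cos (F s) > 0" using D_range F(1) by (auto intro: cos_gt_zero_pi)
  ultimately show ?thesis
    unfolding lower_right_rate_def
    using skew_angle_deriv[OF G F(2) _ G_range(1)] F(1)
    by (intro exI[of _ "\<lambda>x. skew_angle (G x) (F x)"]) auto
qed

lemma no_downward_jump_skew_angle:
  assumes G: "(G \<longlongrightarrow> G s) (at_left s)"
    and D: "no_downward_jump D s"
    and G_range: "-1 < G s" "G s \<le> 1" "\<forall>\<^sub>F x in at_left s. -1 < G x \<and> G x \<le> 1"
    and D_range: "- (pi/2) < D s" "D s < pi/2" "\<forall>\<^sub>F x in at_left s. - (pi/2) < D x"
  shows "no_downward_jump (\<lambda>x. skew_angle (G x) (D x)) s"
  unfolding no_downward_jump_def
proof (intro allI impI)
  fix e :: real assume e: "e > 0"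
  have cont: "continuous (at (D s)) (skew_angle (G s))"
    unfolding skew_angle_def using cos_gt_zero_pi[of "D s"] D_range by (intro continuous_intros) auto
  then have "\<forall>\<^sub>F y in at_right (D s). skew_angle (G s) y < skew_angle (G s) (D s) + e"
    using e order_tendstoD(2) by (force simp: continuous_at_imp_continuous_at_within continuous_within
       intro: order_tendstoD(2)[of _ "skew_angle (G s) (D s)"] tendsto_within_subset)
  moreover have "\<forall>\<^sub>F y in at_right (D s). D s < y \<and> y < pi/2"
    using D_range(2) by (intro eventually_at_rightI[of _ "pi/2"]) auto
  ultimately have "\<forall>\<^sub>F y in at_right (D s). skew_angle (G s) y < skew_angle (G s) (D s) + e \<and> D s < y \<and> y < pi/2"
    by eventually_elim simp
  then obtain y where y: "skew_angle (G s) y < skew_angle (G s) (D s) + e" "D s < y" "y < pi/2"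
    using eventually_happens'[OF trivial_limit_at_right_real] by blast
  have "((\<lambda>x. skew_angle (G x) y) \<longlongrightarrow> skew_angle (G s) y) (at_left s)"
    unfolding skew_angle_def using G G_range by (intro tendsto_intros) auto
  then have "\<forall>\<^sub>F x in at_left s. skew_angle (G x) y < skew_angle (G s) (D s) + e"
    using y(1) by (rule order_tendstoD)
  moreover have "\<forall>\<^sub>F x in at_left s. D x < D s + (y - D s)"
    using D y(2) unfolding no_downward_jump_def by (meson diff_gt_0_iff_gt)
  ultimately show "\<forall>\<^sub>F x in at_left s. skew_angle (G x) (D x) < skew_angle (G s) (D s) + e"
    using G_range(3) D_range(3)
  proof eventually_elim
    case (elim x)
    then have "skew_angle (G x) (D x) \<le> skew_angle (G x) y"
      using y(3) by (intro skew_angle_mono) auto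
    then show ?case using elim by simp
  qed
qed

lemma cis_arctan: "cis (arctan x) = complex_of_real (1 / sqrt (1 + x\<^sup>2)) * Complex 1 x"
  by (auto simp: complex_eq_iff cos_arctan sin_arctan)

lemma skew_angle_polar:
  assumes "cos d > 0" "-1 < G"
  shows "\<exists>R>0. cis d + complex_of_real G * cis (- d) = complex_of_real R * cis (skew_angle G d)"
proof -
  define x where "x = (1 - G) / (1 + G) * tan d"
  define R where "R = (1 + G) * cos d * sqrt (1 + x\<^sup>2)"
  have "(1 + G) * cos d * x = (1 - G) * sin d"
    using assms by (simp add: tan_def x_def)
  then have x: "cos d * x + G * (cos d * x) = sin d - G * sin d"
    by (simp add: algebra_simps)
  have sq: "sqrt (1 + x\<^sup>2) > 0" by (simp add: add_pos_nonneg)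
  have "complex_of_real R * cis (skew_angle G d) = complex_of_real ((1 + G) * cos d) * Complex 1 x"
    unfolding skew_angle_def x_def[symmetric] cis_arctan R_def using sq by (simp add: complex_eq_iff)
  also have "\<dots> = cis d + complex_of_real G * cis (- d)"
    using x by (simp add: complex_eq_iff algebra_simps)
  finally show ?thesis using assms sq by (intro exI[of _ R]) (auto simp: R_def)
qed

text \<open>One turn of the unit section of a convex cone around the vertical axis: \<open>az\<close> is the azimuth, \<open>g\<close> the
tangent of half the angle to the axis, and \<open>\<psi>\<close> the slope angle of the right tangent over the circle of
latitude. The two derivatives say that the parameter is arc length. The bound on the rate of \<open>\<psi>\<close> is the
rate along a great circle, so that an arc turns at least as much as a great circle does.\<close>
locale convex_arc =
  fixes L :: real and az g \<psi> :: "real \<Rightarrow> real"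
  assumes L_pos: "0 < L"
    and az_cont: "continuous_on {0..L} az"
    and g_cont: "continuous_on {0..L} g"
    and g_pos: "s \<in> {0..L} \<Longrightarrow> 0 < g s"
    and g_le_1: "s \<in> {0..L} \<Longrightarrow> g s \<le> 1"
    and psi_gt: "s \<in> {0..L} \<Longrightarrow> - (pi/2) < \<psi> s"
    and psi_lt: "s \<in> {0..L} \<Longrightarrow> \<psi> s < pi/2"
    and cos_psi_bound: "\<exists>c>0. \<forall>s\<in>{0..L}. c \<le> cos (\<psi> s)"
    and az_deriv: "0 \<le> s \<Longrightarrow> s < L \<Longrightarrow>
      (az has_real_derivative cos (\<psi> s) * (1 + (g s)\<^sup>2) / (2 * g s)) (at_right s)"
    and g_deriv: "0 \<le> s \<Longrightarrow> s < L \<Longrightarrow>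
      (g has_real_derivative - sin (\<psi> s) * (1 + (g s)\<^sup>2) / 2) (at_right s)"
    and psi_rate: "0 \<le> s \<Longrightarrow> s < L \<Longrightarrow>
      lower_right_rate \<psi> s (- cos (\<psi> s) * (1 - (g s)\<^sup>2) / (2 * g s))"
    and psi_jump: "0 < s \<Longrightarrow> s \<le> L \<Longrightarrow> no_downward_jump \<psi> s"
    and az_closing: "az L = az 0 + 2 * pi"
    and g_closing: "g L = g 0"
    and psi_closing: "\<psi> L = \<psi> 0"
begin

lemma az_left: "0 < s \<Longrightarrow> s \<le> L \<Longrightarrow> (az \<longlongrightarrow> az s) (at_left s)"
  by (rule continuous_on_Icc_at_leftD[of 0]) (auto intro: continuous_on_subset[OF az_cont])

lemma g_left: "0 < s \<Longrightarrow> s \<le> L \<Longrightarrow> (g \<longlongrightarrow> g s) (at_left s)"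
  by (rule continuous_on_Icc_at_leftD[of 0]) (auto intro: continuous_on_subset[OF g_cont])

lemma eventually_right: "0 \<le> s \<Longrightarrow> s < L \<Longrightarrow> \<forall>\<^sub>F x in at_right s. x \<in> {0..L}"
  by (rule eventually_at_rightI[of _ L]) auto

lemma eventually_left: "0 < s \<Longrightarrow> s \<le> L \<Longrightarrow> \<forall>\<^sub>F x in at_left s. x \<in> {0..L}"
  by (rule eventually_at_leftI[of 0]) auto

lemma cos_psi_pos: "s \<in> {0..L} \<Longrightarrow> 0 < cos (\<psi> s)"
  using psi_gt psi_lt by (auto intro: cos_gt_zero_pi)

lemma rate_bound:
  "\<exists>m>0. \<forall>s\<in>{0..L}. m \<le> g s * cos (\<psi> s) / 8"
proof -
  obtain c where c: "c > 0" "\<And>s. s \<in> {0..L} \<Longrightarrow> c \<le> cos (\<psi> s)" using cos_psi_bound by blast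
  obtain s0 where s0: "s0 \<in> {0..L}" "\<And>s. s \<in> {0..L} \<Longrightarrow> g s0 \<le> g s"
    using continuous_attains_inf[OF compact_Icc _ g_cont] L_pos by auto
  have "g s0 * c / 8 \<le> g s * cos (\<psi> s) / 8" if "s \<in> {0..L}" for s
    using c s0 g_pos that by (intro divide_right_mono mult_mono) (auto intro: less_imp_le)
  then show ?thesis using c s0 g_pos by (intro exI[of _ "g s0 * c / 8"]) auto
qed

lemma shift_azimuth: "convex_arc L (\<lambda>s. az s + d) g \<psi>"
proof
  show "((\<lambda>s. az s + d) has_real_derivative cos (\<psi> s) * (1 + (g s)\<^sup>2) / (2 * g s)) (at_right s)"
    if "0 \<le> s" "s < L" for s
    using DERIV_add[OF az_deriv[OF that] DERIV_const[of d]] by simp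
qed (use L_pos az_cont g_cont g_pos g_le_1 psi_gt psi_lt cos_psi_bound g_deriv psi_rate psi_jump
       az_closing g_closing psi_closing in \<open>auto intro!: continuous_intros\<close>)

end

text \<open>Frames are given by Euler angles \<open>\<phi>, \<theta>, \<psi>\<close> about the vertical, a horizontal and the vertical axis. With
\<open>G = tan (\<theta>\<^sub>1 / 2) * tan (\<theta>\<^sub>2 / 2)\<close> the unit quaternion of the rotation between two such frames has
the scalar and vertical part \<open>cos (\<theta>\<^sub>1 / 2) * cos (\<theta>\<^sub>2 / 2) * cis ((\<phi>\<^sub>2 - \<phi>\<^sub>1) / 2) * (cis \<delta> + G * cis (- \<delta>))\<close>
where \<open>\<delta> = (\<psi>\<^sub>2 - \<psi>\<^sub>1) / 2\<close>. The argument of this complex number is the half twist.\<close>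
definition half_twist :: "real \<Rightarrow> real \<Rightarrow> real \<Rightarrow> real \<Rightarrow> real \<Rightarrow> real \<Rightarrow> real" where
  "half_twist \<phi>1 g1 \<psi>1 \<phi>2 g2 \<psi>2 = (\<phi>2 - \<phi>1) / 2 + skew_angle (g1 * g2) ((\<psi>2 - \<psi>1) / 2)"

lemma half_twist_swap: "half_twist \<phi>2 g2 \<psi>2 \<phi>1 g1 \<psi>1 = - half_twist \<phi>1 g1 \<psi>1 \<phi>2 g2 \<psi>2"
  using skew_angle_minus[of "g1 * g2" "(\<psi>2 - \<psi>1) / 2"]
  by (simp add: half_twist_def mult.commute minus_divide_left[symmetric] diff_divide_distrib)

text \<open>The rate of the half twist along a great circle, multiplied by the denominator
\<open>1 + G\<^sup>2 + 2 * G * cos (x - y)\<close> in the derivative of \<open>skew_angle\<close>. Both terms are positive for slope angles below a right angle.\<close>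
lemma half_twist_rate_identity:
  fixes c g a x :: real
  assumes "a > 0"
  shows "cos x * (1 + a\<^sup>2) / (2 * a) / 2 * (1 + (g * a)\<^sup>2 + 2 * (g * a) * cos (x - y))
      + ((1 - (g * a)\<^sup>2) * (- cos x * (1 - a\<^sup>2) / (2 * a) / 2)
         - (g * (- sin x * (1 + a\<^sup>2) / 2)) * sin (x - y))
    = (a * (1 + g\<^sup>2) * cos x + g * (1 + a\<^sup>2) * cos y) / 2"
proof -
  have y: "cos y = cos x * cos (x - y) + sin x * sin (x - y)"
    using cos_diff[of x "x - y"] by simp
  show ?thesis unfolding y using assms by (simp add: field_simps power2_eq_square)
qed

context convex_arc
begin

text \<open>Against a fixed frame \<open>(f0, g0, p0)\<close>, the half twist of a convex arc grows at least at the rate attained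
along a great circle, which is bounded below.\<close>
lemma half_twist_growth:
  assumes g0: "0 < g0" "g0 \<le> 1" and p0: "- (pi/2) < p0" "p0 < pi/2"
    and ab: "0 \<le> a" "a \<le> b" "b \<le> L"
    and m: "0 \<le> m" "m \<le> g0 * cos p0 / 8"
  shows "half_twist f0 g0 p0 (az a) (g a) (\<psi> a) + m * (b - a) \<le> half_twist f0 g0 p0 (az b) (g b) (\<psi> b)"
proof (rule growth_if_rates_ge[OF ab(2)])
  fix s assume "a \<le> s" "s < b"
  then have s: "0 \<le> s" "s < L" and sI: "s \<in> {0..L}" using ab by auto
  let ?x = "\<psi> s" and ?a = "g s" and ?G = "g0 * g s"
  let ?D' = "- cos ?x * (1 - ?a\<^sup>2) / (2 * ?a) / 2" and ?G' = "g0 * (- sin ?x * (1 + ?a\<^sup>2) / 2)"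
  let ?A' = "cos ?x * (1 + ?a\<^sup>2) / (2 * ?a) / 2"
  have G: "((\<lambda>x. g0 * g x) has_real_derivative ?G') (at_right s)"
    by (rule DERIV_cmult[OF g_deriv[OF s]])
  have D: "lower_right_rate (\<lambda>x. (\<psi> x - p0) / 2) s ?D'"
    using lower_right_rate_affine[OF psi_rate[OF s], of "1/2" "- p0 / 2"]
    by (simp add: diff_divide_distrib)
  have A: "((\<lambda>x. (az x - f0) / 2) has_real_derivative ?A') (at_right s)"
    using DERIV_cdivide[OF DERIV_diff[OF az_deriv[OF s] DERIV_const[of f0]], of 2] by simp
  have Grange: "-1 < g0 * g x \<and> g0 * g x \<le> 1" if "x \<in> {0..L}" for x
    using g_pos[OF that] g_le_1[OF that] g0 by (auto intro: mult_le_one less_trans[of _ 0])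
  have Drange: "- (pi/2) < (\<psi> x - p0) / 2" "(\<psi> x - p0) / 2 < pi/2" if "x \<in> {0..L}" for x
    using psi_gt[OF that] psi_lt[OF that] p0 by auto
  let ?W = "1 + ?G\<^sup>2 + 2 * ?G * cos (2 * ((\<psi> s - p0) / 2))"
  let ?K = "(1 - ?G\<^sup>2) * ?D' - ?G' * sin (2 * ((\<psi> s - p0) / 2))"
  have "lower_right_rate (\<lambda>x. skew_angle (g0 * g x) ((\<psi> x - p0) / 2)) s (?K / ?W)"
    using eventually_mono[OF eventually_right[OF s]] Grange Drange sI
    by (intro lower_right_rate_skew_angle G D) auto
  from lower_right_rate_add[OF this A]
  have rate: "lower_right_rate (\<lambda>x. half_twist f0 g0 p0 (az x) (g x) (\<psi> x)) s (?A' + ?K / ?W)"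
    by (simp add: half_twist_def)
  have G01: "0 < ?G" "?G \<le> 1" using g0 g_pos[OF sI] Grange[OF sI] by auto
  have double: "2 * ((\<psi> s - p0) / 2) = \<psi> s - p0" by simp
  have W_pos: "?W > 0"
  proof -
    have "\<psi> s - p0 \<in> {-pi<..<pi}" using Drange[OF sI] by auto
    then have "cos (\<psi> s - p0) > -1"
      by (smt (verit) cos_ge_minus_one cos_minus_pi cos_pi cos_monotone_0_pi cos_minus greaterThanLessThan_iff pi_gt_zero cos_monotone_minus_pi_0)
    then have "?G * cos (\<psi> s - p0) > - ?G" using G01 mult_strict_left_mono[of "-1" _ ?G] by simp
    then have "?W > 1 + ?G\<^sup>2 - 2 * ?G" unfolding double by (simp add: mult.assoc)
    then show ?thesis using zero_le_power2[of "1 - ?G"] by (simp add: power2_eq_square algebra_simps)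
  qed
(* together with the factor 1/2 of the rate identity this accounts for the 8 in the assumption on m *)
  have W_le: "?W \<le> 4"
  proof -
    have "?G * cos (\<psi> s - p0) \<le> ?G * 1" using G01 by (intro mult_left_mono) auto
    then have "?G * cos (\<psi> s - p0) \<le> 1" using G01 by simp
    moreover have "?G\<^sup>2 \<le> 1" using G01 by (simp add: power_le_one)
    ultimately show ?thesis unfolding double by (simp add: mult.assoc)
  qed
  have "?A' + ?K / ?W = (?A' * ?W + ?K) / ?W" using W_pos by (simp add: add_divide_distrib)
  also have "\<dots> = ((?a * (1 + g0\<^sup>2) * cos ?x + g0 * (1 + ?a\<^sup>2) * cos p0) / 2) / ?W"
    by (simp only: double half_twist_rate_identity[OF g_pos[OF sI]])
  finally have eq: "?A' + ?K / ?W = ((?a * (1 + g0\<^sup>2) * cos ?x + g0 * (1 + ?a\<^sup>2) * cos p0) / 2) / ?W" .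
  have cp: "cos p0 > 0" using p0 by (auto intro: cos_gt_zero_pi)
  have "m * ?W \<le> m * 4" using W_le m by (intro mult_left_mono) auto
  also have "\<dots> \<le> g0 * cos p0 / 2" using m by simp
  also have "\<dots> \<le> (?a * (1 + g0\<^sup>2) * cos ?x + g0 * (1 + ?a\<^sup>2) * cos p0) / 2"
  proof -
    have "0 \<le> ?a * (1 + g0\<^sup>2) * cos ?x" using g_pos[OF sI] cos_psi_pos[OF sI] by (intro mult_nonneg_nonneg) auto
    moreover have "0 \<le> g0 * ?a\<^sup>2 * cos p0" using g0 cp by simp
    ultimately show ?thesis by (simp add: algebra_simps)
  qed
  finally have "m \<le> ?A' + ?K / ?W" unfolding eq pos_le_divide_eq[OF W_pos] .
  then show "\<exists>c\<ge>m. lower_right_rate (\<lambda>x. half_twist f0 g0 p0 (az x) (g x) (\<psi> x)) s c"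
    using rate by blast
next
  fix s assume "a < s" "s \<le> b"
  then have s: "0 < s" "s \<le> L" and sI: "s \<in> {0..L}" using ab by auto
  have Grange: "-1 < g0 * g x \<and> g0 * g x \<le> 1" if "x \<in> {0..L}" for x
    using g_pos[OF that] g_le_1[OF that] g0 by (auto intro: mult_le_one less_trans[of _ 0])
  have Drange: "- (pi/2) < (\<psi> x - p0) / 2" "(\<psi> x - p0) / 2 < pi/2" if "x \<in> {0..L}" for x
    using psi_gt[OF that] psi_lt[OF that] p0 by auto
  have D: "no_downward_jump (\<lambda>x. (\<psi> x - p0) / 2) s"
    using no_downward_jump_affine[OF psi_jump[OF s], of "1/2" "- p0 / 2"]
    by (simp add: diff_divide_distrib)
  have "no_downward_jump (\<lambda>x. skew_angle (g0 * g x) ((\<psi> x - p0) / 2)) s"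
    using eventually_mono[OF eventually_left[OF s]] Grange Drange sI D g_left[OF s]
    by (intro no_downward_jump_skew_angle tendsto_intros) auto
  moreover have "no_downward_jump (\<lambda>x. (az x - f0) / 2) s"
    using az_left[OF s] by (intro no_downward_jump_continuous tendsto_intros) auto
  ultimately show "no_downward_jump (\<lambda>x. half_twist f0 g0 p0 (az x) (g x) (\<psi> x)) s"
    unfolding half_twist_def by (rule no_downward_jump_add)
qed

end

locale convex_arc_pair = A: convex_arc L az1 g1 psi1 + B: convex_arc L az2 g2 psi2
  for L az1 g1 psi1 az2 g2 psi2
begin

definition twist :: "real \<Rightarrow> real \<Rightarrow> real" where
  "twist u s = half_twist (az1 u) (g1 u) (psi1 u) (az2 s) (g2 s) (psi2 s)"

text \<open>Exchanging the two arcs changes the sign of the half twist, so growth in the second argument gives decay in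
the first one.\<close>
lemma twist_grows:
  "\<exists>m>0. (\<forall>u\<in>{0..L}. \<forall>a\<in>{0..L}. \<forall>b\<in>{a..L}. twist u a + m * (b - a) \<le> twist u b) \<and>
         (\<forall>s\<in>{0..L}. \<forall>a\<in>{0..L}. \<forall>b\<in>{a..L}. twist b s + m * (b - a) \<le> twist a s)"
proof -
  obtain m1 where m1: "m1 > 0" "\<And>s. s \<in> {0..L} \<Longrightarrow> m1 \<le> g1 s * cos (psi1 s) / 8"
    using A.rate_bound by blast
  obtain m2 where m2: "m2 > 0" "\<And>s. s \<in> {0..L} \<Longrightarrow> m2 \<le> g2 s * cos (psi2 s) / 8"
    using B.rate_bound by blast
  define m where "m = min m1 m2"
  have "twist u a + m * (b - a) \<le> twist u b" if "u \<in> {0..L}" "a \<in> {0..L}" "b \<in> {a..L}" for u a b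
  proof -
    have "m \<le> g1 u * cos (psi1 u) / 8" "0 \<le> m" using m1(1) m1(2)[of u] m2(1) that by (auto simp: m_def)
    then show ?thesis
      unfolding twist_def using that A.g_pos A.g_le_1 A.psi_gt A.psi_lt
      by (intro B.half_twist_growth) auto
  qed
  moreover have "twist b s + m * (b - a) \<le> twist a s" if "s \<in> {0..L}" "a \<in> {0..L}" "b \<in> {a..L}" for s a b
  proof -
    have "m \<le> g2 s * cos (psi2 s) / 8" "0 \<le> m" using m2(1) m2(2)[of s] m1(1) that by (auto simp: m_def)
    then have "half_twist (az2 s) (g2 s) (psi2 s) (az1 a) (g1 a) (psi1 a) + m * (b - a)
      \<le> half_twist (az2 s) (g2 s) (psi2 s) (az1 b) (g1 b) (psi1 b)"
      using that B.g_pos B.g_le_1 B.psi_gt B.psi_lt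
      by (intro A.half_twist_growth) auto
    then show ?thesis
      using half_twist_swap[of "az1 a" "g1 a" "psi1 a" "az2 s" "g2 s" "psi2 s"]
        half_twist_swap[of "az1 b" "g1 b" "psi1 b" "az2 s" "g2 s" "psi2 s"]
      unfolding twist_def by simp
  qed
  ultimately show ?thesis using m1 m2 by (intro exI[of _ m]) (auto simp: m_def)
qed

lemma twist_closing: "twist u L = twist u 0 + pi" "twist L s = twist 0 s - pi"
  using A.az_closing A.g_closing A.psi_closing B.az_closing B.g_closing B.psi_closing
  by (auto simp: twist_def half_twist_def field_simps)

text \<open>For \<open>u \<le> s\<close> the chain \<open>twist s s \<le> twist s L = twist s 0 + pi \<le> twist s u + pi \<le> twist u u + pi\<close> bounds
the difference; the case \<open>s < u\<close> uses the closing relation of the first argument instead. The parameter lengths of the three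
inequalities add up to \<open>L\<close>, so the definite growth rate \<open>m\<close> improves the bound by \<open>m * L\<close>.\<close>
lemma diagonal_twist_oscillation:
  "\<exists>m>0. \<forall>s\<in>{0..L}. \<forall>u\<in>{0..L}. twist s s \<le> twist u u + (pi - m)"
proof -
  obtain m where m: "m > 0"
    "\<And>u a b. u \<in> {0..L} \<Longrightarrow> a \<in> {0..L} \<Longrightarrow> b \<in> {a..L} \<Longrightarrow> twist u a + m * (b - a) \<le> twist u b"
    "\<And>s a b. s \<in> {0..L} \<Longrightarrow> a \<in> {0..L} \<Longrightarrow> b \<in> {a..L} \<Longrightarrow> twist b s + m * (b - a) \<le> twist a s"
    using twist_grows by blast
  have "twist s s \<le> twist u u + (pi - m * L)" if s: "s \<in> {0..L}" and u: "u \<in> {0..L}" for s u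
  proof (cases "u \<le> s")
    case True
    have "twist s s + m * (L - s) \<le> twist s L" using m(2)[of s s L] s by auto
    moreover have "twist s 0 + m * u \<le> twist s u" using m(2)[of s 0 u] s u by auto
    moreover have "twist s u + m * (s - u) \<le> twist u u" using m(3)[of u u s] s u True by auto
    ultimately show ?thesis using twist_closing(1)[of s] by (simp add: algebra_simps)
  next
    case False
    have "twist s s + m * (u - s) \<le> twist s u" using m(2)[of s s u] s u False by auto
    moreover have "twist L u + m * (L - u) \<le> twist u u" using m(3)[of u u L] u by auto
    moreover have "twist s u + m * s \<le> twist 0 u" using m(3)[of u 0 s] s u by auto
    ultimately show ?thesis using twist_closing(2)[of u] by (simp add: algebra_simps)
  qed
  then show ?thesis using m(1) A.L_pos by (intro exI[of _ "m * L"]) auto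
qed

text \<open>Centre the interval of diagonal values at 0.\<close>
lemma exists_balancing_rotation:
  "\<exists>d. \<forall>s\<in>{0..L}. \<bar>twist s s + d\<bar> < pi / 2"
proof -
  obtain m where m: "m > 0" "\<And>s u. s \<in> {0..L} \<Longrightarrow> u \<in> {0..L} \<Longrightarrow> twist s s \<le> twist u u + (pi - m)"
    using diagonal_twist_oscillation by blast
  let ?T = "(\<lambda>s. twist s s) ` {0..L}"
  have 0: "0 \<in> {0..L}" using A.L_pos by auto
  have bdd: "bdd_below ?T"
    using m(2)[OF 0] by (intro bdd_belowI[of _ "twist 0 0 - (pi - m)"]) (auto simp: diff_le_eq)
  have low: "Inf ?T \<le> twist s s" if "s \<in> {0..L}" for s
    using bdd that by (intro cInf_lower) auto
  have high: "twist s s - (pi - m) \<le> Inf ?T" if "s \<in> {0..L}" for s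
    using m(2)[OF that] 0 by (intro cInf_greatest) (auto simp: diff_le_eq)
  show ?thesis
  proof (intro exI ballI)
    fix s assume s: "s \<in> {0..L}"
    show "\<bar>twist s s + (- (Inf ?T + (pi - m) / 2))\<bar> < pi / 2"
      using low[OF s] high[OF s] m(1) by (auto simp: abs_if field_simps)
  qed
qed

end

section \<open>Tangent angle of the sum of two arcs\<close>

text \<open>The rate of the tangent angle vanishes if both arcs are great circles: then the combination is flat
as well.\<close>
lemma tangent_rate_identity:
  fixes a b x y :: real
  assumes "a > 0" "b > 0"
  shows "(cos x * (1 + a\<^sup>2) / (2 * a) + cos y * (1 + b\<^sup>2) / (2 * b)) / 2 * (1 + (- (a * b))\<^sup>2 + 2 * (- (a * b)) * cos (x + y))
      + ((1 - (- (a * b))\<^sup>2) * ((- cos x * (1 - a\<^sup>2) / (2 * a) + - cos y * (1 - b\<^sup>2) / (2 * b)) / 2)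
         - (- (- sin x * (1 + a\<^sup>2) / 2 * b + a * (- sin y * (1 + b\<^sup>2) / 2))) * sin (x + y)) = 0"
proof -
  have y: "cos y = cos x * cos (x + y) + sin x * sin (x + y)"
    using cos_diff[of "x + y" x] by (simp add: algebra_simps)
  have x: "cos x = cos y * cos (x + y) + sin y * sin (x + y)"
    using cos_diff[of "x + y" y] by (simp add: algebra_simps)
  have "4 * a * b * ((cos x * (1 + a\<^sup>2) / (2 * a) + cos y * (1 + b\<^sup>2) / (2 * b)) / 2 * (1 + (- (a * b))\<^sup>2 + 2 * (- (a * b)) * cos (x + y))
      + ((1 - (- (a * b))\<^sup>2) * ((- cos x * (1 - a\<^sup>2) / (2 * a) + - cos y * (1 - b\<^sup>2) / (2 * b)) / 2)
         - (- (- sin x * (1 + a\<^sup>2) / 2 * b + a * (- sin y * (1 + b\<^sup>2) / 2))) * sin (x + y)))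
    = 2 * a * b * (a * (1 + b\<^sup>2) * (cos x - (cos y * cos (x + y) + sin y * sin (x + y)))
              + b * (1 + a\<^sup>2) * (cos y - (cos x * cos (x + y) + sin x * sin (x + y))))"
    using assms by (simp add: field_simps power2_eq_square)
  also have "\<dots> = 0" using x y by simp
  finally show ?thesis using assms by simp
qed

text \<open>The product is 1 exactly if both points are horizontal, since \<open>g = 1\<close> on the horizontal circle. Otherwise the sum of the two points has positive
height.\<close>
locale non_horizontal_arc_pair = convex_arc_pair +
  assumes gap_product_less_1: "s \<in> {0..L} \<Longrightarrow> g1 s * g2 s < 1"
begin

text \<open>The direction in which the centrally projected sum moves, minus a right angle (\<open>chart_deriv\<close>).\<close>
definition tangent_angle :: "real \<Rightarrow> real" where
  "tangent_angle s = (az1 s + az2 s) / 2 + skew_angle (- (g1 s * g2 s)) ((psi1 s + psi2 s) / 2)"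

lemma tangent_angle_mono:
  assumes ab: "0 \<le> a" "a \<le> b" "b \<le> L"
  shows "tangent_angle a \<le> tangent_angle b"
proof (rule nondecreasing_if_rates_nonneg[OF ab(2)])
  have Grange: "-1 < - (g1 x * g2 x) \<and> - (g1 x * g2 x) \<le> 1" if "x \<in> {0..L}" for x
    using A.g_pos[OF that] B.g_pos[OF that] gap_product_less_1[OF that] mult_pos_pos[of "g1 x" "g2 x"] by linarith
  have Drange: "- (pi/2) < (psi1 x + psi2 x) / 2" "(psi1 x + psi2 x) / 2 < pi/2" if "x \<in> {0..L}" for x
    using A.psi_gt[OF that] A.psi_lt[OF that] B.psi_gt[OF that] B.psi_lt[OF that] by auto
  {
    fix s assume "a \<le> s" "s < b"
    then have s: "0 \<le> s" "s < L" and sI: "s \<in> {0..L}" using ab by auto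
    let ?G = "- (g1 s * g2 s)"
    let ?D1 = "- cos (psi1 s) * (1 - (g1 s)\<^sup>2) / (2 * g1 s)" and ?D2 = "- cos (psi2 s) * (1 - (g2 s)\<^sup>2) / (2 * g2 s)"
    let ?A1 = "cos (psi1 s) * (1 + (g1 s)\<^sup>2) / (2 * g1 s)" and ?A2 = "cos (psi2 s) * (1 + (g2 s)\<^sup>2) / (2 * g2 s)"
    let ?G' = "- (- sin (psi1 s) * (1 + (g1 s)\<^sup>2) / 2 * g2 s + g1 s * (- sin (psi2 s) * (1 + (g2 s)\<^sup>2) / 2))"
    have G: "((\<lambda>x. - (g1 x * g2 x)) has_real_derivative ?G') (at_right s)"
      using DERIV_minus[OF DERIV_mult[OF A.g_deriv[OF s] B.g_deriv[OF s]]]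
      by (simp add: mult.commute add.commute)
    obtain F where F: "F s = psi2 s" "(F has_real_derivative ?D2) (at_right s)" "\<forall>\<^sub>F x in at_right s. F x \<le> psi2 x"
      using B.psi_rate[OF s] unfolding lower_right_rate_def by blast
    have "lower_right_rate (\<lambda>x. F x + psi1 x) s (?D2 + ?D1)"
      using lower_right_rate_add[OF A.psi_rate[OF s] F(2)] .
    then obtain H where H: "H s = F s + psi1 s" "(H has_real_derivative ?D2 + ?D1) (at_right s)"
       "\<forall>\<^sub>F x in at_right s. H x \<le> F x + psi1 x"
      unfolding lower_right_rate_def by blast
    have "lower_right_rate (\<lambda>x. psi1 x + psi2 x) s (?D1 + ?D2)"
      unfolding lower_right_rate_def
    proof (intro exI[of _ H] conjI)
      show "\<forall>\<^sub>F x in at_right s. H x \<le> psi1 x + psi2 x" using H(3) F(3) by eventually_elim simp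
    qed (use H F in \<open>auto simp: add.commute\<close>)
    then have D: "lower_right_rate (\<lambda>x. (psi1 x + psi2 x) / 2) s ((?D1 + ?D2) / 2)"
      using lower_right_rate_affine[of "\<lambda>x. psi1 x + psi2 x" s "?D1 + ?D2" "1/2" 0] by simp
    have A: "((\<lambda>x. (az1 x + az2 x) / 2) has_real_derivative (?A1 + ?A2) / 2) (at_right s)"
      using DERIV_cdivide[OF DERIV_add[OF A.az_deriv[OF s] B.az_deriv[OF s]], of 2] by simp
    let ?W = "1 + ?G\<^sup>2 + 2 * ?G * cos (2 * ((psi1 s + psi2 s) / 2))"
    let ?K = "(1 - ?G\<^sup>2) * ((?D1 + ?D2) / 2) - ?G' * sin (2 * ((psi1 s + psi2 s) / 2))"
    have "lower_right_rate (\<lambda>x. skew_angle (- (g1 x * g2 x)) ((psi1 x + psi2 x) / 2)) s (?K / ?W)"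
      using eventually_mono[OF A.eventually_right[OF s]] Grange Drange sI
      by (intro lower_right_rate_skew_angle G D) auto
    from lower_right_rate_add[OF this A]
    have rate: "lower_right_rate tangent_angle s ((?A1 + ?A2) / 2 + ?K / ?W)"
      by (simp add: tangent_angle_def[abs_def])
    have "1 + ?G\<^sup>2 + 2 * ?G * cos (2 * ((psi1 s + psi2 s) / 2)) \<ge> (1 + ?G)\<^sup>2"
    proof -
      have "?G * cos (2 * ((psi1 s + psi2 s) / 2)) \<ge> ?G * 1"
        using A.g_pos[OF sI] B.g_pos[OF sI] mult_pos_pos[of "g1 s" "g2 s"]
        by (intro mult_left_mono_neg) auto
      then have "2 * ?G * cos (2 * ((psi1 s + psi2 s) / 2)) \<ge> 2 * ?G" by linarith
      moreover have "(1 + ?G)\<^sup>2 = 1 + ?G\<^sup>2 + 2 * ?G" by (simp add: power2_eq_square algebra_simps)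
      ultimately show ?thesis by linarith
    qed
    moreover have "(1 + ?G)\<^sup>2 > 0" using Grange[OF sI] by simp
    ultimately have W: "?W > 0" by linarith
    have "(?A1 + ?A2) / 2 + ?K / ?W = ((?A1 + ?A2) / 2 * ?W + ?K) / ?W" using W by (simp add: add_divide_distrib)
    also have "(?A1 + ?A2) / 2 * ?W + ?K = 0"
    proof -
      have double: "2 * ((psi1 s + psi2 s) / 2) = psi1 s + psi2 s" by simp
      show ?thesis
        unfolding double by (rule tangent_rate_identity[OF A.g_pos[OF sI] B.g_pos[OF sI]])
    qed
    finally have "(?A1 + ?A2) / 2 + ?K / ?W = 0" by simp
    then show "\<exists>c\<ge>0. lower_right_rate tangent_angle s c" using rate by auto
  next
    fix s assume "a < s" "s \<le> b"
    then have s: "0 < s" "s \<le> L" and sI: "s \<in> {0..L}" using ab by auto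
    have "no_downward_jump (\<lambda>x. psi1 x + psi2 x) s"
      by (intro no_downward_jump_add A.psi_jump B.psi_jump s)
    then have "no_downward_jump (\<lambda>x. (psi1 x + psi2 x) / 2) s"
      using no_downward_jump_affine[of "\<lambda>x. psi1 x + psi2 x" s "1/2" 0] by simp
    then have "no_downward_jump (\<lambda>x. skew_angle (- (g1 x * g2 x)) ((psi1 x + psi2 x) / 2)) s"
      using eventually_mono[OF A.eventually_left[OF s]] Grange Drange sI A.g_left[OF s] B.g_left[OF s]
      by (intro no_downward_jump_skew_angle tendsto_intros) auto
    moreover have "no_downward_jump (\<lambda>x. (az1 x + az2 x) / 2) s"
      using A.az_left[OF s] B.az_left[OF s] by (intro no_downward_jump_continuous tendsto_intros) auto
    ultimately show "no_downward_jump tangent_angle s"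
      unfolding tangent_angle_def[abs_def] by (rule no_downward_jump_add)
  }
qed

lemma tangent_angle_closing: "tangent_angle L = tangent_angle 0 + 2 * pi"
  using A.az_closing A.g_closing A.psi_closing B.az_closing B.g_closing B.psi_closing
  by (simp add: tangent_angle_def field_simps)

end

section \<open>Closed plane curves with monotone tangent angle\<close>

abbreviation cone_over :: "real \<Rightarrow> (real \<Rightarrow> 'a::real_vector) \<Rightarrow> 'a set" where
  "cone_over L r \<equiv> {t *\<^sub>R r s |t s. 0 \<le> t \<and> s \<in> {0..L}}"

lemma inner_cis: "cis a \<bullet> (\<i> * cis b) = - sin (b - a)" "(\<i> * cis a) \<bullet> (\<i> * cis b) = cos (b - a)"
  "cis a \<bullet> cis b = cos (b - a)"
  by (auto simp: inner_complex_def sin_diff cos_diff algebra_simps)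

text \<open>The angle \<open>ang\<close> is the direction of the outer normal; it may jump, but it stays close to a continuous
function \<open>\<beta>\<close>. This prevents the curve from degenerating to a segment traversed back and forth.\<close>
locale closed_convex_curve =
  fixes L :: real and c :: "real \<Rightarrow> complex" and ang \<beta> :: "real \<Rightarrow> real"
  assumes L_pos: "0 < L"
    and c_cont: "continuous_on {0..L} c"
    and c_deriv: "0 \<le> s \<Longrightarrow> s < L \<Longrightarrow>
        \<exists>k>0. (c has_vector_derivative k *\<^sub>R (\<i> * cis (ang s))) (at_right s)"
    and c_closing: "c L = c 0"
    and ang_mono: "0 \<le> a \<Longrightarrow> a \<le> b \<Longrightarrow> b \<le> L \<Longrightarrow> ang a \<le> ang b"
    and ang_closing: "ang L = ang 0 + 2 * pi"
    and \<beta>_cont: "continuous_on {0..L} \<beta>"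
    and ang_near: "s \<in> {0..L} \<Longrightarrow> \<bar>ang s - \<beta> s\<bar> < pi / 2"
begin

lemma inner_deriv:
  assumes "0 \<le> s" "s < L"
  shows "\<exists>k>0. \<forall>v. ((\<lambda>x. v \<bullet> c x) has_real_derivative k * (v \<bullet> (\<i> * cis (ang s)))) (at_right s)"
proof -
  obtain k where k: "k > 0" "(c has_vector_derivative k *\<^sub>R (\<i> * cis (ang s))) (at_right s)"
    using c_deriv[OF assms] by blast
  have "((\<lambda>x. v \<bullet> c x) has_real_derivative k * (v \<bullet> (\<i> * cis (ang s)))) (at_right s)" for v
  proof -
    have "((\<lambda>x. v \<bullet> c x) has_vector_derivative v \<bullet> (k *\<^sub>R (\<i> * cis (ang s)))) (at_right s)"
      by (rule bounded_linear.has_vector_derivative[OF bounded_linear_inner_right k(2)])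
    then show ?thesis by (simp add: has_real_derivative_iff_has_vector_derivative)
  qed
  then show ?thesis using k(1) by blast
qed

text \<open>The distance of the curve from its tangent at \<open>s\<close> has derivative proportional to \<open>sin (ang x - ang s)\<close>.
Within half a turn after \<open>s\<close> it grows from 0, and after that it decreases to its final value, which is
the value at the start of the curve; the same holds backwards from \<open>s\<close>.\<close>
lemma supporting_lines:
  assumes s: "s \<in> {0..L}" and t: "t \<in> {0..L}"
  shows "cis (ang s) \<bullet> c t \<le> cis (ang s) \<bullet> c s"
proof -
  define G where "G = (\<lambda>x. - (cis (ang s) \<bullet> c x))"
  have cont: "continuous_on {a..b} G" if "0 \<le> a" "b \<le> L" for a b
    unfolding G_def using that by (intro continuous_intros continuous_on_subset[OF c_cont]) auto
  have der: "\<exists>k>0. (G has_real_derivative k * sin (ang x - ang s)) (at_right x)" if xL: "0 \<le> x" "x < L" for x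
  proof -
    obtain k where k: "k > 0" "((\<lambda>y. cis (ang s) \<bullet> c y) has_real_derivative k * (cis (ang s) \<bullet> (\<i> * cis (ang x)))) (at_right x)"
      using inner_deriv[OF xL] by blast
    then show ?thesis
      using DERIV_minus[OF k(2)] unfolding G_def by (intro exI[of _ k]) (simp add: inner_cis)
  qed
  have up: "G a \<le> G b" if "0 \<le> a" "a \<le> b" "b \<le> L" and sg: "\<And>x. a \<le> x \<Longrightarrow> x < b \<Longrightarrow> sin (ang x - ang s) \<ge> 0" for a b
  proof (rule nondecreasing_if_right_derivative_nonneg[OF that(2) cont])
    fix x assume "a \<le> x" "x < b"
    then obtain k where "k > 0" "(G has_real_derivative k * sin (ang x - ang s)) (at_right x)"
      using der[of x] \<open>0 \<le> a\<close> \<open>b \<le> L\<close> by auto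
    then show "\<exists>c\<ge>0. (G has_real_derivative c) (at_right x)"
      using sg[OF \<open>a \<le> x\<close> \<open>x < b\<close>] by (intro exI[of _ "k * sin (ang x - ang s)"]) auto
  qed (use that in auto)
  have down: "G b \<le> G a" if "0 \<le> a" "a \<le> b" "b \<le> L" and sg: "\<And>x. a \<le> x \<Longrightarrow> x < b \<Longrightarrow> sin (ang x - ang s) \<le> 0" for a b
  proof -
    have "- G a \<le> - G b"
    proof (rule nondecreasing_if_right_derivative_nonneg[OF that(2)])
      show "continuous_on {a..b} (\<lambda>x. - G x)" using cont that by (intro continuous_intros) auto
      fix x assume "a \<le> x" "x < b"
      then obtain k where "k > 0" "(G has_real_derivative k * sin (ang x - ang s)) (at_right x)"
        using der[of x] \<open>0 \<le> a\<close> \<open>b \<le> L\<close> by auto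
      then show "\<exists>c\<ge>0. ((\<lambda>x. - G x) has_real_derivative c) (at_right x)"
        using sg[OF \<open>a \<le> x\<close> \<open>x < b\<close>] DERIV_minus
        by (intro exI[of _ "- (k * sin (ang x - ang s))"]) (auto simp: mult_nonneg_nonpos)
    qed
    then show ?thesis by simp
  qed
  have sin_pos: "sin y \<ge> 0" if "0 \<le> y" "y \<le> pi" for y :: real using that by (rule sin_ge_zero)
  have sin_neg: "sin y \<le> 0" if "-pi \<le> y" "y \<le> 0" for y :: real
    using sin_ge_zero[of "-y"] that by simp
  have range: "ang s - 2 * pi \<le> ang x" "ang x \<le> ang s + 2 * pi" if "x \<in> {0..L}" for x
    using ang_mono[of 0 x] ang_mono[of x L] ang_mono[of 0 s] ang_mono[of s L] that s ang_closing by auto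
  have after: "G s \<le> G x" if "s \<le> x" "x \<le> L" "ang x \<le> ang s + pi" for x
  proof (rule up)
    fix y assume "s \<le> y" "y < x"
    then show "sin (ang y - ang s) \<ge> 0"
      using ang_mono[of s y] ang_mono[of y x] that s by (intro sin_pos) auto
  qed (use that s in auto)
  have late: "G L \<le> G x" if "s \<le> x" "x \<le> L" "ang s + pi < ang x" for x
  proof (rule down)
    fix y assume y: "x \<le> y" "y < L"
    then have "ang x \<le> ang y" using ang_mono[of x y] that s by auto
    then have "sin (ang y - ang s - 2 * pi) \<le> 0"
      using range[of y] that s y by (intro sin_neg) auto
    then show "sin (ang y - ang s) \<le> 0" by (simp add: sin_diff)
  qed (use that s in auto)
  have before: "G s \<le> G x" if "0 \<le> x" "x \<le> s" "ang s - pi \<le> ang x" for x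
  proof (rule down)
    fix y assume "x \<le> y" "y < s"
    then show "sin (ang y - ang s) \<le> 0"
      using ang_mono[of x y] ang_mono[of y s] that s by (intro sin_neg) auto
  qed (use that s in auto)
  have early: "G 0 \<le> G x" if "0 \<le> x" "x \<le> s" "ang x < ang s - pi" for x
  proof (rule up)
    fix y assume y: "0 \<le> y" "y < x"
    then have "ang y \<le> ang x" using ang_mono[of y x] that s by auto
    then have "sin (ang y - ang s + 2 * pi) \<ge> 0"
      using range[of y] that s y by (intro sin_pos) auto
    then show "sin (ang y - ang s) \<ge> 0" by (simp add: sin_add)
  qed (use that s in auto)
  have closing: "G L = G 0" by (simp add: G_def c_closing)
  have zero: "G s \<le> G 0"
  proof (cases "ang s - pi \<le> ang 0")
    case True then show ?thesis using before[of 0] s by auto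
  next
    case False
    then have "ang L \<le> ang s + pi" using ang_closing by simp
    then show ?thesis using after[of L] s closing by auto
  qed
  have "G s \<le> G t"
  proof (cases "s \<le> t")
    case True
    then show ?thesis using after[of t] late[of t] t closing zero by fastforce
  next
    case False
    then show ?thesis using before[of t] early[of t] t zero by fastforce
  qed
  then show ?thesis by (simp add: G_def)
qed

text \<open>If the curve is contained in a line, then \<open>ang\<close> is normal to this line throughout. But \<open>\<beta>\<close> attains a
direction of the line, and there \<open>ang\<close> is less than a right angle away from it.\<close>
lemma not_collinear:
  assumes "v \<noteq> 0"
  shows "\<exists>s\<in>{0..L}. \<exists>t\<in>{0..L}. v \<bullet> c s \<noteq> v \<bullet> c t"
proof (rule ccontr)
  assume contr: "\<not> (\<exists>s\<in>{0..L}. \<exists>t\<in>{0..L}. v \<bullet> c s \<noteq> v \<bullet> c t)"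
  have const: "v \<bullet> c s = v \<bullet> c 0" if "s \<in> {0..L}" for s
  proof -
    have "0 \<in> {0..L}" using L_pos by simp
    with contr that show ?thesis by blast
  qed
  define \<gamma> where "\<gamma> = Arg v"
  have v: "v = norm v *\<^sub>R cis \<gamma>"
    using rcis_cmod_Arg[of v] by (simp add: \<gamma>_def rcis_def scaleR_conv_of_real)
  have sin0: "sin (ang x - \<gamma>) = 0" if x: "0 \<le> x" "x < L" for x
  proof -
    obtain k where k: "k > 0" "((\<lambda>x. v \<bullet> c x) has_real_derivative k * (v \<bullet> (\<i> * cis (ang x)))) (at_right x)"
      using inner_deriv[OF x] by blast
    have "\<forall>\<^sub>F y in at_right x. 0 = (v \<bullet> c y - v \<bullet> c x) / (y - x)"
    proof (rule eventually_at_rightI)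
      fix y assume "y \<in> {x<..<L}"
      then have "v \<bullet> c y = v \<bullet> c 0" "v \<bullet> c x = v \<bullet> c 0" using x by (auto intro!: const)
      then show "0 = (v \<bullet> c y - v \<bullet> c x) / (y - x)" by simp
    qed (rule x)
    then have "((\<lambda>y. (v \<bullet> c y - v \<bullet> c x) / (y - x)) \<longlongrightarrow> 0) (at_right x)"
      by (rule Lim_transform_eventually[OF tendsto_const])
    moreover have "((\<lambda>y. (v \<bullet> c y - v \<bullet> c x) / (y - x)) \<longlongrightarrow> k * (v \<bullet> (\<i> * cis (ang x)))) (at_right x)"
      using k(2) by (simp add: has_field_derivative_iff)
    ultimately have "k * (v \<bullet> (\<i> * cis (ang x))) = 0"
      by (intro tendsto_unique[OF trivial_limit_at_right_real])
    then have "v \<bullet> (\<i> * cis (ang x)) = 0" using k(1) by simp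
    then have "norm v * (cis \<gamma> \<bullet> (\<i> * cis (ang x))) = 0" by (metis v inner_scaleR_left)
    then have "cis \<gamma> \<bullet> (\<i> * cis (ang x)) = 0" using assms by simp
    then show ?thesis by (simp add: inner_cis)
  qed
(* b is the first direction of the line beyond the angle at the start *)
  define k where "k = \<lfloor>(\<beta> 0 - \<gamma> - pi/2) / pi\<rfloor> + 1"
  define b where "b = \<gamma> + pi/2 + of_int k * pi"
  have b1: "\<beta> 0 < b"
  proof -
    have "(\<beta> 0 - \<gamma> - pi/2) / pi < of_int k" unfolding k_def by linarith
    then show ?thesis unfolding b_def by (simp add: pos_divide_less_eq)
  qed
  have b2: "b \<le> \<beta> 0 + pi"
  proof -
    have "of_int k - 1 \<le> (\<beta> 0 - \<gamma> - pi/2) / pi" unfolding k_def by linarith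
    then have "(of_int k - 1) * pi \<le> \<beta> 0 - \<gamma> - pi/2" by (simp add: pos_le_divide_eq)
    then show ?thesis unfolding b_def by (simp add: algebra_simps)
  qed
  have bL: "b < \<beta> L" using b2 ang_near[of 0] ang_near[of L] L_pos ang_closing by (auto simp: abs_if split: if_splits)
  obtain x where x: "0 \<le> x" "x \<le> L" "\<beta> x = b"
    using IVT'[of \<beta> 0 b L] b1 bL \<beta>_cont L_pos by auto
  then have "x < L" using bL by (cases "x = L") auto
  have "\<bar>ang x - b\<bar> < pi/2" using ang_near[of x] x by auto
  then have "0 < ang x - \<gamma> - of_int k * pi" "ang x - \<gamma> - of_int k * pi < pi"
    unfolding b_def abs_less_iff by linarith+
  then have "sin (ang x - \<gamma> - of_int k * pi) > 0" by (rule sin_gt_zero)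
  moreover have "sin (of_int k * pi) = 0" by (simp add: sin_zero_iff_int2)
  ultimately have "sin (ang x - \<gamma>) \<noteq> 0" by (auto simp: sin_diff)
  then show False using sin0[OF x(1) \<open>x < L\<close>] by simp
qed

text \<open>The closed convex cone generated by the curve at height 1, as the intersection of all half-spaces through
the origin that contain it.\<close>
definition body :: "(complex \<times> real) set" where
  "body = {x. \<forall>M. (\<forall>s\<in>{0..L}. 0 \<le> M \<bullet> (c s, 1)) \<longrightarrow> 0 \<le> M \<bullet> x}"

lemma curve_in_body: "s \<in> {0..L} \<Longrightarrow> (c s, 1) \<in> body"
  by (auto simp: body_def)

lemma body_conic: "x \<in> body \<Longrightarrow> y \<in> body \<Longrightarrow> 0 \<le> a \<Longrightarrow> 0 \<le> b \<Longrightarrow> a *\<^sub>R x + b *\<^sub>R y \<in> body"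
  by (auto simp: body_def inner_add_right)

lemma zero_in_body: "0 \<in> body" by (auto simp: body_def)

lemma convex_cone_body: "convex_cone body"
  unfolding convex_cone_def conic_def convex_def
  using body_conic body_conic[OF _ zero_in_body, of _ _ 0] zero_in_body by fastforce

lemma closed_body: "closed body"
proof -
  have "body = (\<Inter>M\<in>{M. \<forall>s\<in>{0..L}. 0 \<le> M \<bullet> (c s, 1)}. {x. 0 \<le> M \<bullet> x})"
    by (auto simp: body_def)
  then show ?thesis by (auto intro!: closed_INT closed_halfspace_ge)
qed

lemma interior_body_pos:
  assumes "P \<in> interior body" "M \<noteq> 0" "\<And>s. s \<in> {0..L} \<Longrightarrow> 0 \<le> M \<bullet> (c s, 1)"
  shows "0 < M \<bullet> P"
proof -
  have "body \<subseteq> {x. M \<bullet> x \<ge> 0}" unfolding body_def using assms(3) by blast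
  then have "P \<in> interior {x. M \<bullet> x \<ge> 0}" using assms(1) interior_mono by blast
  then show ?thesis using assms(2) by (simp add: interior_halfspace_ge)
qed

lemma interior_body_add:
  assumes "P \<in> interior body" "x \<in> body" "a > 0"
  shows "x + a *\<^sub>R P \<in> interior body"
proof (rule interiorI)
  show "open ((\<lambda>y. x + y) ` ((\<lambda>y. a *\<^sub>R y) ` interior body))"
    using assms(3) by (intro open_translation open_scaling) auto
  show "x + a *\<^sub>R P \<in> (\<lambda>y. x + y) ` ((\<lambda>y. a *\<^sub>R y) ` interior body)" using assms(1) by auto
  show "(\<lambda>y. x + y) ` ((\<lambda>y. a *\<^sub>R y) ` interior body) \<subseteq> body"
    using body_conic[OF assms(2), of _ 1 a] assms(3) interior_subset by fastforce
qed

lemma interior_body_nonempty: "interior body \<noteq> {}"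
proof
  assume "interior body = {}"
  then obtain M b where M: "M \<noteq> 0" "body \<subseteq> {x. M \<bullet> x = b}"
    using empty_interior_subset_hyperplane[of body] convex_cone_body unfolding convex_cone_def by metis
  then have "b = 0" using zero_in_body by auto
  then have "M \<bullet> (c s, 1) = 0" if "s \<in> {0..L}" for s using M(2) curve_in_body[OF that] by auto
  then have *: "fst M \<bullet> c s = - snd M" if "s \<in> {0..L}" for s using that by (force simp: inner_prod_def)
  show False
  proof (cases "fst M = 0")
    case True
    then have "snd M = 0" using *[of 0] L_pos by simp
    then show False using True M(1) by (simp add: prod_eq_iff)
  next
    case False
    then show False using not_collinear[OF False] * by auto
  qed
qed

definition normal :: "real \<Rightarrow> complex \<times> real" where
  "normal s = (- cis (ang s), cis (ang s) \<bullet> c s)"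

lemma normal_ge: "s \<in> {0..L} \<Longrightarrow> t \<in> {0..L} \<Longrightarrow> 0 \<le> normal s \<bullet> (c t, 1)"
  using supporting_lines by (simp add: normal_def)

lemma normal_nz: "normal s \<noteq> 0"
  by (simp add: normal_def prod_eq_iff)

lemma curve_not_interior: "s \<in> {0..L} \<Longrightarrow> (c s, 1) \<notin> interior body"
  using interior_body_pos[of "(c s, 1)" "normal s"] normal_ge normal_nz by (auto simp: normal_def)

lemma interior_body_snd_pos:
  assumes "P \<in> interior body"
  shows "snd P > 0"
proof -
  have "0 < (0::complex, 1::real) \<bullet> P"
    by (rule interior_body_pos[OF assms]) (simp_all add: prod_eq_iff)
  then show ?thesis by (cases P) simp
qed

text \<open>Seen from an inner point, the curve passes from the right side of a ray to its left side. At the last parameter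
where this happens the curve crosses the line of the ray in the positive sense, and the
supporting line there shows that the crossing lies on the ray and not on its opposite.\<close>
lemma ray_hits_curve:
  assumes P: "P \<in> interior body"
  shows "\<exists>s\<in>{0..L}. \<exists>l>0. c s = fst P /\<^sub>R snd P + l *\<^sub>R cis \<theta>"
proof -
  have e: "snd P > 0" by (rule interior_body_snd_pos[OF P])
  define o1 where "o1 = fst P /\<^sub>R snd P"
  define w where "w = (\<lambda>x. (\<i> * cis \<theta>) \<bullet> (c x - o1))"
  have wcont: "continuous_on {0..L} w" unfolding w_def by (intro continuous_intros c_cont)
  have sides: "\<exists>x\<in>{0..L}. \<sigma> * w x < 0" if "\<sigma> = 1 \<or> \<sigma> = -1" for \<sigma> :: real
  proof (rule ccontr)
    assume "\<not> ?thesis"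
    then have *: "0 \<le> \<sigma> * w x" if "x \<in> {0..L}" for x using that linorder_not_less by blast
    let ?M = "\<sigma> *\<^sub>R (\<i> * cis \<theta>, - ((\<i> * cis \<theta>) \<bullet> o1)) :: complex \<times> real"
    have "?M \<bullet> (c x, 1) = \<sigma> * w x" for x
      by (simp add: w_def inner_diff_right algebra_simps)
    then have "0 < ?M \<bullet> P" using * that
      by (intro interior_body_pos[OF P]) (auto simp: prod_eq_iff)
    moreover have "?M \<bullet> P = 0" using e by (simp add: o1_def inner_prod_def)
    ultimately show False by simp
  qed
  obtain a0 where a0: "a0 \<in> {0..L}" "w a0 < 0" using sides[of 1] by auto
  obtain b0 where b0: "b0 \<in> {0..L}" "w b0 > 0" using sides[of "-1"] by auto
  have "\<exists>a b. 0 \<le> a \<and> a \<le> b \<and> b \<le> L \<and> w a \<le> 0 \<and> w b > 0"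
  proof (cases "a0 \<le> b0")
    case True then show ?thesis using a0 b0 by (intro exI[of _ a0] exI[of _ b0]) auto
  next
    case False
    have "w L = w 0" by (simp add: w_def c_closing)
    show ?thesis
    proof (cases "w 0 > 0")
      case True
      then show ?thesis using a0 \<open>w L = w 0\<close> by (intro exI[of _ a0] exI[of _ L]) auto
    next
      case False
      then show ?thesis using b0 by (intro exI[of _ 0] exI[of _ b0]) auto
    qed
  qed
  then obtain a b where ab: "0 \<le> a" "a \<le> b" "b \<le> L" "w a \<le> 0" "w b > 0" by blast
  define X where "X = {x\<in>{a..b}. w x \<le> 0}"
  have "closed ({a..b} \<inter> w -` {..0})"
    using ab by (intro continuous_closed_preimage continuous_on_subset[OF wcont]) auto
  also have "{a..b} \<inter> w -` {..0} = X" by (auto simp: X_def)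
  finally have "closed X" .
  moreover have "X \<noteq> {}" using ab by (auto simp: X_def)
  moreover have "bdd_above X" by (rule bdd_aboveI[of _ b]) (auto simp: X_def)
  ultimately have sup: "Sup X \<in> X" by (intro closed_contains_Sup)
  define s where "s = Sup X"
  have s: "a \<le> s" "s \<le> b" "w s \<le> 0" using sup by (auto simp: X_def s_def)
  then have "s < b" using ab by (cases "s = b") auto
  have after: "w x > 0" if "s < x" "x \<le> b" for x
    using that s cSup_upper[of x X] \<open>bdd_above X\<close> unfolding s_def X_def by fastforce
  have sL: "0 \<le> s" "s < L" using s ab \<open>s < b\<close> by auto
  have "\<not> w s < 0"
  proof
    assume "w s < 0"
    then obtain x where "s \<le> x" "x \<le> b" "w x = w s / 2"
      using IVT'[of w s "w s / 2" b] ab s sL continuous_on_subset[OF wcont, of "{s..b}"] by auto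
    then show False using after[of x] \<open>w s < 0\<close> by (cases "x = s") auto
  qed
  then have ws: "w s = 0" using s by simp
  obtain k where k: "k > 0" "\<And>v. ((\<lambda>x. v \<bullet> c x) has_real_derivative k * (v \<bullet> (\<i> * cis (ang s)))) (at_right s)"
    using inner_deriv[OF sL] by blast
  have wd: "(w has_real_derivative k * cos (ang s - \<theta>)) (at_right s)"
    using DERIV_diff[OF k(2)[of "\<i> * cis \<theta>"] DERIV_const[of "(\<i> * cis \<theta>) \<bullet> o1"]]
    unfolding w_def by (simp add: inner_diff_right inner_cis)
  have "k * cos (ang s - \<theta>) \<ge> 0"
  proof (rule tendsto_lowerbound)
    show "((\<lambda>x. (w x - w s) / (x - s)) \<longlongrightarrow> k * cos (ang s - \<theta>)) (at_right s)"
      using wd by (simp add: has_field_derivative_iff)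
    show "\<forall>\<^sub>F x in at_right s. 0 \<le> (w x - w s) / (x - s)"
      using after ws \<open>s < b\<close> by (intro eventually_at_rightI[of _ b]) (auto intro!: divide_nonneg_nonneg less_imp_le)
  qed simp
  then have cos0: "cos (ang s - \<theta>) \<ge> 0" using k(1) by (simp add: zero_le_mult_iff)
  define l where "l = cis \<theta> \<bullet> (c s - o1)"
  have cs: "c s - o1 = l *\<^sub>R cis \<theta>"
  proof -
    have expand: "z = (cis \<theta> \<bullet> z) *\<^sub>R cis \<theta> + ((\<i> * cis \<theta>) \<bullet> z) *\<^sub>R (\<i> * cis \<theta>)" for z
    proof -
      have "Re z = cos \<theta> * (cos \<theta> * Re z + sin \<theta> * Im z) - sin \<theta> * (- sin \<theta> * Re z + cos \<theta> * Im z)"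
        "Im z = sin \<theta> * (cos \<theta> * Re z + sin \<theta> * Im z) + cos \<theta> * (- sin \<theta> * Re z + cos \<theta> * Im z)"
        using sin_cos_squared_add[of \<theta>] by algebra+
      then show ?thesis
        unfolding complex_eq_iff inner_complex_def
        by (simp add: mult.commute)
    qed
    show ?thesis using expand[of "c s - o1"] ws by (simp add: l_def w_def)
  qed
  have "0 < normal s \<bullet> P"
    using sL normal_ge normal_nz by (intro interior_body_pos[OF P]) auto
  also have "normal s \<bullet> P = snd P * (cis (ang s) \<bullet> (c s - o1))"
    using e by (simp add: normal_def o1_def inner_prod_def inner_diff_right algebra_simps)
  also have "\<dots> = snd P * (l * cos (ang s - \<theta>))"
    unfolding cs using inner_cis(3)[of "ang s" \<theta>] by (simp add: cos_diff mult.commute)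
  finally have "0 < l * cos (ang s - \<theta>)" using e by (simp add: zero_less_mult_iff)
  then have "l > 0" using cos0 by (simp add: zero_less_mult_iff)
  then show ?thesis using cs sL by (intro bexI[of _ s] exI[of _ l]) (auto simp: o1_def[symmetric] algebra_simps)
qed

text \<open>Project a boundary point \<open>x\<close> from an interior axis \<open>P\<close> to the curve: some point of the curve is
\<open>m * x + \<alpha> * P\<close> with \<open>m > 0\<close>. Since neither \<open>x\<close> nor the curve is interior, \<open>\<alpha> = 0\<close>.\<close>
lemma frontier_body: "frontier body = cone_over L (\<lambda>s. (c s, 1))"
proof
  obtain P where P: "P \<in> interior body" using interior_body_nonempty by blast
  have e: "snd P > 0" by (rule interior_body_snd_pos[OF P])
  show "cone_over L (\<lambda>s. (c s, 1)) \<subseteq> frontier body"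
  proof
    fix x :: "complex \<times> real" assume "x \<in> cone_over L (\<lambda>s. (c s, 1))"
    then obtain t s where t: "0 \<le> t" and s: "s \<in> {0..L}" and x: "x = t *\<^sub>R (c s, 1)" by blast
    have "t *\<^sub>R (c s, 1) \<in> body" using body_conic[OF curve_in_body[OF s] zero_in_body t, of 0] by simp
    moreover have "t *\<^sub>R (c s, 1) \<notin> interior body"
      using interior_body_pos[of "t *\<^sub>R (c s, 1)" "normal s"] normal_ge[OF s] normal_nz
      by (auto simp: normal_def)
    ultimately show "x \<in> frontier body"
      unfolding x using closed_body by (simp add: frontier_def del: scaleR_Pair)
  qed
  show "frontier body \<subseteq> cone_over L (\<lambda>s. (c s, 1))"
  proof
    fix x assume "x \<in> frontier body"
    then have x: "x \<in> body" "x \<notin> interior body" using closed_body by (auto simp: frontier_def)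
    define y where "y = snd P *\<^sub>R fst x - snd x *\<^sub>R fst P"
    show "x \<in> cone_over L (\<lambda>s. (c s, 1))"
    proof (cases "y = 0")
      case True
      then have "inverse (snd P) *\<^sub>R (snd P *\<^sub>R fst x) = inverse (snd P) *\<^sub>R (snd x *\<^sub>R fst P)"
        by (simp add: y_def)
      then have "fst x = (snd x / snd P) *\<^sub>R fst P"
        using e by (simp add: divide_inverse_commute)
      then have xP: "x = (snd x / snd P) *\<^sub>R P" using e by (simp add: prod_eq_iff)
      have "(0, 1) \<bullet> x \<ge> 0" using x(1) unfolding body_def by (auto dest: spec[of _ "(0, 1)"] simp del: split_paired_All)
      then have "snd x \<ge> 0" by (cases x) simp
      moreover have "snd x \<le> 0"
      proof (rule ccontr)
        assume "\<not> snd x \<le> 0"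
        then have "0 + (snd x / snd P) *\<^sub>R P \<in> interior body"
          using e by (intro interior_body_add P zero_in_body) auto
        then show False using xP x(2) by simp
      qed
      ultimately have "x = 0 *\<^sub>R (c 0, 1)" using xP by (simp del: scaleR_Pair)
      then show ?thesis using L_pos by (intro CollectI exI[of _ 0]) auto
    next
      case False
      define \<theta> where "\<theta> = Arg y"
      have y: "y = norm y *\<^sub>R cis \<theta>"
        using rcis_cmod_Arg[of y] by (simp add: \<theta>_def rcis_def scaleR_conv_of_real)
      obtain s l where s: "s \<in> {0..L}" and l: "l > 0" "c s = fst P /\<^sub>R snd P + l *\<^sub>R cis \<theta>"
        using ray_hits_curve[OF P] by blast
      define m where "m = l / norm y"
      have m: "m > 0" using l False by (simp add: m_def)
      define \<alpha> where "\<alpha> = inverse (snd P) - m * snd x"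
      have "l *\<^sub>R cis \<theta> = m *\<^sub>R y" using False by (subst y) (simp add: m_def)
      then have cs: "(c s, 1) = (m * snd P) *\<^sub>R x + \<alpha> *\<^sub>R P"
        using e l(2) by (auto simp: prod_eq_iff \<alpha>_def y_def algebra_simps)
      have mP: "m * snd P > 0" using m e by simp
      have inv: "inverse (m * snd P) * (m * snd P) = 1" using mP by (intro left_inverse) auto
      have "\<alpha> \<le> 0"
      proof (rule ccontr)
        assume "\<not> \<alpha> \<le> 0"
        then have "(m * snd P) *\<^sub>R x + \<alpha> *\<^sub>R P \<in> interior body"
          using body_conic[OF x(1) zero_in_body, of "m * snd P" 0] mP by (intro interior_body_add P) auto
        then show False using curve_not_interior[OF s] cs by simp
      qed
      moreover have "\<alpha> \<ge> 0"
      proof (rule ccontr)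
        assume a: "\<not> \<alpha> \<ge> 0"
        have "inverse (m * snd P) *\<^sub>R (c s, 1) + (inverse (m * snd P) * - \<alpha>) *\<^sub>R P \<in> interior body"
        proof (rule interior_body_add[OF P])
          have "0 \<le> inverse (m * snd P)" using mP by (intro less_imp_le positive_imp_inverse_positive)
          from body_conic[OF curve_in_body[OF s] zero_in_body this, of 0]
          show "inverse (m * snd P) *\<^sub>R (c s, 1) \<in> body" by simp
          show "0 < inverse (m * snd P) * - \<alpha>" using m e a by (intro mult_pos_pos positive_imp_inverse_positive) simp_all
        qed
        also have "inverse (m * snd P) *\<^sub>R (c s, 1) + (inverse (m * snd P) * - \<alpha>) *\<^sub>R P
            = inverse (m * snd P) *\<^sub>R ((c s, 1) - \<alpha> *\<^sub>R P)"
          by (simp add: scaleR_diff_right)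
        also have "\<dots> = x" unfolding cs using inv by (simp del: inverse_mult_distrib)
        finally show False using x(2) by simp
      qed
      ultimately have "(c s, 1) = (m * snd P) *\<^sub>R x" using cs by simp
      then have "x = inverse (m * snd P) *\<^sub>R (c s, 1)" using inv by (simp del: inverse_mult_distrib scaleR_Pair)
      then show ?thesis using mP s by (intro CollectI exI[of _ "inverse (m * snd P)"] exI[of _ s]) (simp del: inverse_mult_distrib scaleR_Pair)
    qed
  qed
qed

lemma body_ne_UNIV: "body \<noteq> UNIV"
  using curve_not_interior[of 0] L_pos by auto

end

section \<open>Central projection of the sum of two arcs\<close>

text \<open>The sine and the cosine of \<open>2 * arctan g\<close>.\<close>
definition radius :: "real \<Rightarrow> real" where "radius g = 2 * g / (1 + g\<^sup>2)"
definition height :: "real \<Rightarrow> real" where "height g = (1 - g\<^sup>2) / (1 + g\<^sup>2)"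

lemma one_plus_sq_pos: "0 < 1 + (g::real)\<^sup>2" by (simp add: add_pos_nonneg)

lemma height_radius_unit: "height g * height g + radius g * radius g = 1"
proof -
  have "height g * height g + radius g * radius g = ((1 - g\<^sup>2)\<^sup>2 + (2 * g)\<^sup>2) / (1 + g\<^sup>2)\<^sup>2"
    by (simp add: height_def radius_def power2_eq_square add_divide_distrib)
  also have "(1 - g\<^sup>2)\<^sup>2 + (2 * g)\<^sup>2 = (1 + g\<^sup>2)\<^sup>2" by (simp add: power2_eq_square algebra_simps)
  finally show ?thesis using one_plus_sq_pos[of g] by simp
qed

lemma radius_height_deriv:
  assumes g: "(g has_real_derivative - sin q * (1 + (g s)\<^sup>2) / 2) F" and F: "F = at s within S"
  shows "((\<lambda>x. radius (g x)) has_real_derivative - sin q * height (g s)) F"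
    and "((\<lambda>x. height (g x)) has_real_derivative sin q * radius (g s)) F"
proof -
  have ne: "1 + (g s)\<^sup>2 \<noteq> 0" using one_plus_sq_pos[of "g s"] by simp
  have sq: "((\<lambda>x. (g x)\<^sup>2) has_real_derivative - (g s * sin q * (1 + (g s)\<^sup>2))) F"
    using DERIV_power[OF g[unfolded F], of 2] unfolding F by (elim DERIV_cong) (simp add: field_simps)
  have den: "((\<lambda>x. 1 + (g x)\<^sup>2) has_real_derivative - (g s * sin q * (1 + (g s)\<^sup>2))) F"
    using DERIV_add[OF DERIV_const sq[unfolded F], of 1] unfolding F by simp
  show "((\<lambda>x. radius (g x)) has_real_derivative - sin q * height (g s)) F"
    unfolding radius_def
    using DERIV_divide[OF DERIV_cmult[OF g[unfolded F], of 2] den[unfolded F] ne] unfolding F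
  proof (elim DERIV_cong)
    have "2 * (- sin q * (1 + (g s)\<^sup>2) / 2) * (1 + (g s)\<^sup>2) - 2 * g s * - (g s * sin q * (1 + (g s)\<^sup>2))
        = - sin q * (1 - (g s)\<^sup>2) * (1 + (g s)\<^sup>2)"
      by (simp add: power2_eq_square field_simps)
    then show "(2 * (- sin q * (1 + (g s)\<^sup>2) / 2) * (1 + (g s)\<^sup>2) - 2 * g s * - (g s * sin q * (1 + (g s)\<^sup>2)))
        / ((1 + (g s)\<^sup>2) * (1 + (g s)\<^sup>2)) = - sin q * height (g s)"
      using ne by (simp add: height_def)
  qed
  show "((\<lambda>x. height (g x)) has_real_derivative sin q * radius (g s)) F"
    unfolding height_def
    using DERIV_divide[OF DERIV_diff[OF DERIV_const sq[unfolded F], of 1] den[unfolded F] ne] unfolding F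
  proof (elim DERIV_cong)
    have "(0 - - (g s * sin q * (1 + (g s)\<^sup>2))) * (1 + (g s)\<^sup>2) - (1 - (g s)\<^sup>2) * - (g s * sin q * (1 + (g s)\<^sup>2))
        = sin q * (2 * g s) * (1 + (g s)\<^sup>2)"
      by (simp add: power2_eq_square field_simps)
    then show "((0 - - (g s * sin q * (1 + (g s)\<^sup>2))) * (1 + (g s)\<^sup>2) - (1 - (g s)\<^sup>2) * - (g s * sin q * (1 + (g s)\<^sup>2)))
        / ((1 + (g s)\<^sup>2) * (1 + (g s)\<^sup>2)) = sin q * radius (g s)"
      using ne by (simp add: radius_def)
  qed
qed

lemma horizontal_deriv:
  assumes a: "(a has_real_derivative cos q * (1 + (g s)\<^sup>2) / (2 * g s)) (at s within S)"
    and g: "(g has_real_derivative - sin q * (1 + (g s)\<^sup>2) / 2) (at s within S)" and g0: "g s > 0"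
  shows "((\<lambda>x. radius (g x) *\<^sub>R cis (a x)) has_vector_derivative
     cis (a s) * (\<i> * cos q - height (g s) * sin q)) (at s within S)"
proof -
  have c: "((\<lambda>x. cis (a x)) has_vector_derivative (cos q * (1 + (g s)\<^sup>2) / (2 * g s)) *\<^sub>R (\<i> * cis (a s))) (at s within S)"
    using has_derivative_cis[OF a[unfolded has_field_derivative_def]]
    by (simp add: has_vector_derivative_def mult.commute)
  have "radius (g s) * (cos q * (1 + (g s)\<^sup>2) / (2 * g s)) = cos q"
    using g0 one_plus_sq_pos[of "g s"] by (simp add: radius_def)
  then have eq: "radius (g s) *\<^sub>R (cos q * (1 + (g s)\<^sup>2) / (2 * g s)) *\<^sub>R (\<i> * cis (a s)) = cos q *\<^sub>R (\<i> * cis (a s))"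
    by (simp only: scaleR_scaleR)
  show ?thesis
    using has_vector_derivative_scaleR[OF radius_height_deriv(1)[OF g refl] c] unfolding eq
    by (elim has_vector_derivative_eq_rhs) (simp add: scaleR_conv_of_real algebra_simps)
qed

text \<open>Factorization of the bilinear expression from \<open>sum_direction_identity\<close>. The first factor carries the
tangent angle; the second one is real, being the sum of conjugate numbers.\<close>
lemma mean_rotation_identity:
  fixes p1 p2 q1 q2 G :: real
  shows "\<i> * cis ((p1 + p2) / 2) * (cis ((q1 + q2) / 2) - G * cis (- ((q1 + q2) / 2)))
     * (cis ((p2 - p1) / 2) * (cis ((q2 - q1) / 2) + G * cis (- ((q2 - q1) / 2)))
        + cis (- ((p2 - p1) / 2)) * (cis (- ((q2 - q1) / 2)) + G * cis ((q2 - q1) / 2)))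
   = cis p1 * (\<i> * ((1 - G\<^sup>2) * cos q1) - (1 + G\<^sup>2) * sin q1 - 2 * G * sin q2)
   + cis p2 * (\<i> * ((1 - G\<^sup>2) * cos q2) - (1 + G\<^sup>2) * sin q2 - 2 * G * sin q1)"
proof -
  let ?P = "cis ((p1 + p2) / 2)" and ?M = "cis ((p2 - p1) / 2)" and ?M' = "cis (- ((p2 - p1) / 2))"
  let ?S = "cis ((q1 + q2) / 2)" and ?S' = "cis (- ((q1 + q2) / 2))" and ?D = "cis ((q2 - q1) / 2)" and ?D' = "cis (- ((q2 - q1) / 2))"
  have P: "?P * ?M = cis p2" "?P * ?M' = cis p1" by (simp_all add: cis_mult field_simps)
  have SD: "?S * ?D = cis q2" "?S * ?D' = cis q1" "?S' * ?D = cis (- q1)" "?S' * ?D' = cis (- q2)"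
    by (simp_all add: cis_mult field_simps)
  have "(?S - G * ?S') * (?D + G * ?D') = ?S * ?D + G * (?S * ?D') - G * (?S' * ?D) - G * (G * (?S' * ?D'))"
    by (simp add: algebra_simps)
  then have 1: "(?S - G * ?S') * (?D + G * ?D') = cis q2 + G * cis q1 - G * cis (- q1) - G * (G * cis (- q2))"
    unfolding SD .
  have "(?S - G * ?S') * (?D' + G * ?D) = ?S * ?D' + G * (?S * ?D) - G * (?S' * ?D') - G * (G * (?S' * ?D))"
    by (simp add: algebra_simps)
  then have 2: "(?S - G * ?S') * (?D' + G * ?D) = cis q1 + G * cis q2 - G * cis (- q2) - G * (G * cis (- q1))"
    unfolding SD .
  have "\<i> * ?P * (?S - G * ?S') * (?M * (?D + G * ?D') + ?M' * (?D' + G * ?D))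
     = (?P * ?M) * (\<i> * ((?S - G * ?S') * (?D + G * ?D'))) + (?P * ?M') * (\<i> * ((?S - G * ?S') * (?D' + G * ?D)))"
    by (simp add: algebra_simps)
  also have "\<dots> = cis p2 * (\<i> * (cis q2 + G * cis q1 - G * cis (- q1) - G * (G * cis (- q2))))
      + cis p1 * (\<i> * (cis q1 + G * cis q2 - G * cis (- q2) - G * (G * cis (- q1))))"
    unfolding P 1 2 ..
  also have "\<i> * (cis q2 + G * cis q1 - G * cis (- q1) - G * (G * cis (- q2)))
      = \<i> * ((1 - G\<^sup>2) * cos q2) - (1 + G\<^sup>2) * sin q2 - 2 * G * sin q1"
    by (simp add: complex_eq_iff power2_eq_square algebra_simps)
  also have "\<i> * (cis q1 + G * cis q2 - G * cis (- q2) - G * (G * cis (- q1)))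
      = \<i> * ((1 - G\<^sup>2) * cos q1) - (1 + G\<^sup>2) * sin q1 - 2 * G * sin q2"
    by (simp add: complex_eq_iff power2_eq_square algebra_simps)
  finally show ?thesis by (simp add: add.commute)
qed

text \<open>The numerator of the derivative of horizontal part over height, for the sum of two points of the unit sphere that
move with unit speed and slope angles \<open>q1\<close> and \<open>q2\<close>.\<close>
lemma sum_direction_identity:
  fixes p1 p2 q1 q2 a b :: real
  shows "(cis p1 * (\<i> * cos q1 - height a * sin q1) + cis p2 * (\<i> * cos q2 - height b * sin q2)) * (height a + height b)
     - (radius a * cis p1 + radius b * cis p2) * (radius a * sin q1 + radius b * sin q2)
   = (2 / ((1 + a\<^sup>2) * (1 + b\<^sup>2))) *
      (cis p1 * (\<i> * ((1 - (a * b)\<^sup>2) * cos q1) - (1 + (a * b)\<^sup>2) * sin q1 - 2 * (a * b) * sin q2)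
   + cis p2 * (\<i> * ((1 - (a * b)\<^sup>2) * cos q2) - (1 + (a * b)\<^sup>2) * sin q2 - 2 * (a * b) * sin q1))"
proof -
  let ?K = "2 / ((1 + a\<^sup>2) * (1 + b\<^sup>2))"
  have pos: "1 + a\<^sup>2 > 0" "1 + b\<^sup>2 > 0" by (rule one_plus_sq_pos)+
  have K1: "height a + height b = ?K * (1 - (a * b)\<^sup>2)"
    using pos by (simp add: height_def field_simps power2_eq_square)
  have K2: "1 + height a * height b = ?K * (1 + (a * b)\<^sup>2)"
  proof -
    have "1 + height a * height b = ((1 + a\<^sup>2) * (1 + b\<^sup>2) + (1 - a\<^sup>2) * (1 - b\<^sup>2)) / ((1 + a\<^sup>2) * (1 + b\<^sup>2))"
      using pos by (simp add: height_def add_divide_distrib)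
    also have "(1 + a\<^sup>2) * (1 + b\<^sup>2) + (1 - a\<^sup>2) * (1 - b\<^sup>2) = 2 * (1 + (a * b)\<^sup>2)"
      by (simp add: algebra_simps power_mult_distrib)
    finally show ?thesis by simp
  qed
  have K3: "radius a * radius b = ?K * (2 * (a * b))"
    using pos by (simp add: radius_def field_simps power2_eq_square)
  have "(cis p1 * (\<i> * cos q1 - height a * sin q1) + cis p2 * (\<i> * cos q2 - height b * sin q2)) * (height a + height b)
     - (radius a * cis p1 + radius b * cis p2) * (radius a * sin q1 + radius b * sin q2)
   = cis p1 * (\<i> * ((height a + height b) * cos q1) - (height a * height a + radius a * radius a) * sin q1 - height a * height b * sin q1 - radius a * radius b * sin q2)
   + cis p2 * (\<i> * ((height a + height b) * cos q2) - (height b * height b + radius b * radius b) * sin q2 - height a * height b * sin q2 - radius a * radius b * sin q1)"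
    by (simp add: algebra_simps)
  also have "\<dots> = cis p1 * (\<i> * complex_of_real ((height a + height b) * cos q1) - complex_of_real ((1 + height a * height b) * sin q1) - complex_of_real ((radius a * radius b) * sin q2))
   + cis p2 * (\<i> * complex_of_real ((height a + height b) * cos q2) - complex_of_real ((1 + height a * height b) * sin q2) - complex_of_real ((radius a * radius b) * sin q1))"
  proof -
    have v: "complex_of_real (height x) * complex_of_real (height x) + complex_of_real (radius x) * complex_of_real (radius x) = 1" for x
      using arg_cong[OF height_radius_unit[of x], of complex_of_real] by simp
    show ?thesis unfolding of_real_add of_real_mult v by (simp add: algebra_simps)
  qed
  also have "\<dots> = cis p1 * (\<i> * complex_of_real ((?K * (1 - (a * b)\<^sup>2)) * cos q1) - complex_of_real ((?K * (1 + (a * b)\<^sup>2)) * sin q1) - complex_of_real ((?K * (2 * (a * b))) * sin q2))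
   + cis p2 * (\<i> * complex_of_real ((?K * (1 - (a * b)\<^sup>2)) * cos q2) - complex_of_real ((?K * (1 + (a * b)\<^sup>2)) * sin q2) - complex_of_real ((?K * (2 * (a * b))) * sin q1))"
    unfolding K1 K2 K3 ..
  also have "\<dots> = ?K *
      (cis p1 * (\<i> * ((1 - (a * b)\<^sup>2) * cos q1) - (1 + (a * b)\<^sup>2) * sin q1 - 2 * (a * b) * sin q2)
   + cis p2 * (\<i> * ((1 - (a * b)\<^sup>2) * cos q2) - (1 + (a * b)\<^sup>2) * sin q2 - 2 * (a * b) * sin q1))"
    unfolding of_real_mult of_real_add of_real_diff of_real_1 of_real_numeral of_real_power by (simp only: ring_distribs mult_ac)
  finally show ?thesis .
qed

definition sphere_point :: "real \<Rightarrow> real \<Rightarrow> complex \<times> real" where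
  "sphere_point a g = (radius g *\<^sub>R cis a, height g)"

lemma height_nonneg: "0 < g \<Longrightarrow> g \<le> 1 \<Longrightarrow> 0 \<le> height g"
  using power_le_one[of g 2] by (simp add: height_def)

lemma height_pos: "0 < g \<Longrightarrow> g < 1 \<Longrightarrow> 0 < height g"
  using power_strict_mono[of g 1 2] one_plus_sq_pos[of g] by (simp add: height_def)

locale balanced_arc_pair = non_horizontal_arc_pair +
  assumes balanced: "s \<in> {0..L} \<Longrightarrow> \<bar>twist s s\<bar> < pi / 2"
begin

definition horizontal_sum :: "real \<Rightarrow> complex" where
  "horizontal_sum s = radius (g1 s) *\<^sub>R cis (az1 s) + radius (g2 s) *\<^sub>R cis (az2 s)"

definition height_sum :: "real \<Rightarrow> real" where
  "height_sum s = height (g1 s) + height (g2 s)"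

definition chart :: "real \<Rightarrow> complex" where
  "chart s = inverse (height_sum s) *\<^sub>R horizontal_sum s"

lemma height_sum_pos: assumes s: "s \<in> {0..L}" shows "height_sum s > 0"
proof -
  have "g1 s < 1 \<or> g2 s < 1"
    using gap_product_less_1[OF s] A.g_le_1[OF s] B.g_le_1[OF s] by fastforce
  then show ?thesis
    using height_pos height_nonneg A.g_pos[OF s] B.g_pos[OF s] A.g_le_1[OF s] B.g_le_1[OF s]
    unfolding height_sum_def by (meson add_pos_nonneg add_nonneg_pos)
qed

lemma chart_cont: "continuous_on {0..L} chart"
proof -
  have [simp]: "1 + x\<^sup>2 \<noteq> 0" for x :: real using one_plus_sq_pos[of x] by simp
  have "continuous_on {0..L} horizontal_sum" "continuous_on {0..L} height_sum"
    unfolding horizontal_sum_def height_sum_def radius_def height_def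
    by (intro continuous_intros A.g_cont B.g_cont A.az_cont B.az_cont; simp)+
  then show ?thesis unfolding chart_def using height_sum_pos by (intro continuous_intros) force+
qed

text \<open>The sum of a complex number of argument \<open>twist s s\<close> and its conjugate, hence positive by balance.\<close>
lemma twisted_product_real_part:
  assumes s: "s \<in> {0..L}"
  shows "\<exists>R>0. cis ((az2 s - az1 s) / 2) * (cis ((psi2 s - psi1 s) / 2) + (g1 s * g2 s) * cis (- ((psi2 s - psi1 s) / 2)))
      + cis (- ((az2 s - az1 s) / 2)) * (cis (- ((psi2 s - psi1 s) / 2)) + (g1 s * g2 s) * cis ((psi2 s - psi1 s) / 2)) = complex_of_real R"
proof -
  let ?d = "(psi2 s - psi1 s) / 2" and ?G = "g1 s * g2 s" and ?a = "(az2 s - az1 s) / 2"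
  have "cos ?d > 0"
    using A.psi_gt[OF s] A.psi_lt[OF s] B.psi_gt[OF s] B.psi_lt[OF s] by (intro cos_gt_zero_pi) auto
  moreover have "-1 < ?G" using A.g_pos[OF s] B.g_pos[OF s] mult_pos_pos[of "g1 s" "g2 s"] by linarith
  ultimately obtain R where R: "R > 0" "cis ?d + complex_of_real ?G * cis (- ?d) = complex_of_real R * cis (skew_angle ?G ?d)"
    using skew_angle_polar by blast
  have R': "cis (- ?d) + complex_of_real ?G * cis ?d = complex_of_real R * cis (- skew_angle ?G ?d)"
    using arg_cong[OF R(2), of cnj] by (simp add: cis_cnj)
  have "cis ?a * (cis ?d + complex_of_real ?G * cis (- ?d)) + cis (- ?a) * (cis (- ?d) + complex_of_real ?G * cis ?d)
     = R * (cis (twist s s) + cis (- twist s s))"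
  proof -
    have t: "twist s s = ?a + skew_angle ?G ?d" by (simp add: twist_def half_twist_def)
    have "cis (- twist s s) = cis (- ?a) * cis (- skew_angle ?G ?d)" "cis (twist s s) = cis ?a * cis (skew_angle ?G ?d)"
      unfolding t cis_mult by simp_all
    then show ?thesis unfolding R(2) R' by (simp add: algebra_simps)
  qed
  also have "\<dots> = complex_of_real (R * (2 * cos (twist s s)))"
    by (simp add: complex_eq_iff)
  finally have eq: "cis ?a * (cis ?d + complex_of_real ?G * cis (- ?d)) + cis (- ?a) * (cis (- ?d) + complex_of_real ?G * cis ?d)
      = complex_of_real (R * (2 * cos (twist s s)))" .
  have "cos (twist s s) > 0" using balanced[OF s] by (intro cos_gt_zero_pi) (auto simp: abs_less_iff)
  then show ?thesis using R(1) eq by (intro exI[of _ "R * (2 * cos (twist s s))"]) simp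
qed

text \<open>The quotient rule and the two identities above; the balance of the pair makes the factor \<open>k\<close> positive.\<close>
lemma chart_deriv:
  assumes s: "0 \<le> s" "s < L"
  shows "\<exists>k>0. (chart has_vector_derivative k *\<^sub>R (\<i> * cis (tangent_angle s))) (at_right s)"
proof -
  have sI: "s \<in> {0..L}" using s by simp
  note pos = A.g_pos[OF sI] B.g_pos[OF sI]
  let ?p1 = "az1 s" and ?p2 = "az2 s" and ?q1 = "psi1 s" and ?q2 = "psi2 s" and ?a = "g1 s" and ?b = "g2 s"
  let ?G = "?a * ?b"
  let ?h = "cis ?p1 * (\<i> * cos ?q1 - height ?a * sin ?q1) + cis ?p2 * (\<i> * cos ?q2 - height ?b * sin ?q2)"
  let ?e = "sin ?q1 * radius ?a + sin ?q2 * radius ?b"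
  let ?D = "inverse (height_sum s) *\<^sub>R ?h + - (inverse (height_sum s) * ?e * inverse (height_sum s)) *\<^sub>R horizontal_sum s"
  let ?V = "cis ?p1 * (\<i> * ((1 - (?a * ?b)\<^sup>2) * cos ?q1) - (1 + (?a * ?b)\<^sup>2) * sin ?q1 - 2 * (?a * ?b) * sin ?q2)
   + cis ?p2 * (\<i> * ((1 - (?a * ?b)\<^sup>2) * cos ?q2) - (1 + (?a * ?b)\<^sup>2) * sin ?q2 - 2 * (?a * ?b) * sin ?q1)"
  let ?M = "\<i> * cis ((?p1 + ?p2) / 2) * (cis ((?q1 + ?q2) / 2) - complex_of_real ?G * cis (- ((?q1 + ?q2) / 2)))
     * (cis ((?p2 - ?p1) / 2) * (cis ((?q2 - ?q1) / 2) + ?G * cis (- ((?q2 - ?q1) / 2)))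
        + cis (- ((?p2 - ?p1) / 2)) * (cis (- ((?q2 - ?q1) / 2)) + ?G * cis ((?q2 - ?q1) / 2)))"
  have hd: "(horizontal_sum has_vector_derivative ?h) (at_right s)"
    unfolding horizontal_sum_def[abs_def]
    by (intro has_vector_derivative_add horizontal_deriv A.az_deriv B.az_deriv A.g_deriv B.g_deriv s pos)
  have ed: "(height_sum has_real_derivative ?e) (at_right s)"
    unfolding height_sum_def[abs_def]
    by (intro DERIV_add radius_height_deriv(2)[OF _ refl] A.g_deriv B.g_deriv s)
  have e0: "height_sum s > 0" by (rule height_sum_pos[OF sI])
  then have "((\<lambda>x. inverse (height_sum x)) has_real_derivative - (inverse (height_sum s) * ?e * inverse (height_sum s))) (at_right s)"
    by (intro DERIV_inverse' ed) simp
  from has_vector_derivative_scaleR[OF this hd]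
  have cd: "(chart has_vector_derivative ?D) (at_right s)"
    unfolding chart_def[abs_def] .
  have "?D
     = (inverse (height_sum s))\<^sup>2 *\<^sub>R (?h * height_sum s - horizontal_sum s * ?e)"
    using e0 by (simp add: scaleR_conv_of_real power2_eq_square field_simps)
  also have "?h * height_sum s - horizontal_sum s * ?e = ?h * (height ?a + height ?b)
     - (radius ?a * cis ?p1 + radius ?b * cis ?p2) * (radius ?a * sin ?q1 + radius ?b * sin ?q2)"
    by (simp add: height_sum_def horizontal_sum_def scaleR_conv_of_real mult.commute)
  also have "\<dots> = (2 / ((1 + ?a\<^sup>2) * (1 + ?b\<^sup>2))) *
      ?V"
    by (rule sum_direction_identity)
  finally have step1: "?D
    = (inverse (height_sum s))\<^sup>2 *\<^sub>R ((2 / ((1 + ?a\<^sup>2) * (1 + ?b\<^sup>2))) *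
      ?V)" .
  obtain R1 where R1: "R1 > 0" "cis ((?p2 - ?p1) / 2) * (cis ((?q2 - ?q1) / 2) + ?G * cis (- ((?q2 - ?q1) / 2)))
      + cis (- ((?p2 - ?p1) / 2)) * (cis (- ((?q2 - ?q1) / 2)) + ?G * cis ((?q2 - ?q1) / 2)) = complex_of_real R1"
    using twisted_product_real_part[OF sI] by blast
  have "cos ((?q1 + ?q2) / 2) > 0"
    using A.psi_gt[OF sI] A.psi_lt[OF sI] B.psi_gt[OF sI] B.psi_lt[OF sI] by (intro cos_gt_zero_pi) auto
  moreover have "-1 < - ?G" using gap_product_less_1[OF sI] by simp
  ultimately obtain R2 where R2: "R2 > 0"
    "cis ((?q1 + ?q2) / 2) + complex_of_real (- ?G) * cis (- ((?q1 + ?q2) / 2)) = complex_of_real R2 * cis (skew_angle (- ?G) ((?q1 + ?q2) / 2))"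
    using skew_angle_polar by blast
  have R2': "cis ((?q1 + ?q2) / 2) - complex_of_real ?G * cis (- ((?q1 + ?q2) / 2)) = complex_of_real R2 * cis (skew_angle (- ?G) ((?q1 + ?q2) / 2))"
    using R2(2) by simp
  have "?M
     = complex_of_real (R1 * R2) * (\<i> * (cis ((?p1 + ?p2) / 2) * cis (skew_angle (- ?G) ((?q1 + ?q2) / 2))))"
    unfolding R1(2) R2' by (simp add: mult_ac)
  also have "cis ((?p1 + ?p2) / 2) * cis (skew_angle (- ?G) ((?q1 + ?q2) / 2)) = cis (tangent_angle s)"
    by (simp add: cis_mult tangent_angle_def)
  finally have mean: "?M
     = complex_of_real (R1 * R2) * (\<i> * cis (tangent_angle s))" .
  have step2: "?V
   = complex_of_real (R1 * R2) * (\<i> * cis (tangent_angle s))"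
    using mean_rotation_identity[of ?p1 ?p2 ?q1 ?q2 ?G] mean unfolding of_real_mult
    by (rule trans[OF sym])
  define k where "k = (inverse (height_sum s))\<^sup>2 * (2 / ((1 + ?a\<^sup>2) * (1 + ?b\<^sup>2))) * (R1 * R2)"
  have "k > 0" unfolding k_def using e0 R1(1) R2(1) one_plus_sq_pos by (intro mult_pos_pos divide_pos_pos zero_less_power) auto
  moreover have "?D
      = k *\<^sub>R (\<i> * cis (tangent_angle s))"
    unfolding step1 step2 k_def by (simp add: scaleR_conv_of_real)
  ultimately show ?thesis using cd by auto
qed

lemma chart_closing: "chart L = chart 0"
  using A.az_closing A.g_closing B.az_closing B.g_closing
  by (simp add: chart_def horizontal_sum_def height_sum_def cis_mult[symmetric])

end

section \<open>Linear isometries and lengths of curves\<close>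

definition euclidean_iso :: "('a::euclidean_space \<Rightarrow> 'b::euclidean_space) \<Rightarrow> bool" where
  "euclidean_iso J \<longleftrightarrow> linear J \<and> bij J \<and> (\<forall>x y. J x \<bullet> J y = x \<bullet> y)"

lemma euclidean_iso_compose: "euclidean_iso f \<Longrightarrow> euclidean_iso g \<Longrightarrow> euclidean_iso (\<lambda>x. f (g x))"
  unfolding euclidean_iso_def using linear_compose[of g f] bij_comp[of g f] by (auto simp: o_def)

lemma euclidean_iso_norm: "euclidean_iso J \<Longrightarrow> norm (J x) = norm x"
  by (simp add: euclidean_iso_def norm_eq_sqrt_inner)

lemma euclidean_iso_dist: "euclidean_iso J \<Longrightarrow> dist (J x) (J y) = dist x y"
  unfolding dist_norm using euclidean_iso_norm[of J "x - y"] by (simp add: euclidean_iso_def linear_diff)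

lemma euclidean_iso_inv: assumes "euclidean_iso J" shows "euclidean_iso (inv J)"
proof -
  have b: "bij J" "linear J" using assms by (auto simp: euclidean_iso_def)
  have J: "J (inv J x) = x" for x using b(1) by (simp add: bij_is_surj surj_f_inv_f)
  have J': "inv J (J x) = x" for x using b(1) by (simp add: bij_is_inj)
  have "linear (inv J)"
  proof (rule linearI)
    show "inv J (x + y) = inv J x + inv J y" for x y
      using J'[of "inv J x + inv J y"] by (simp add: linear_add[OF b(2)] J)
    show "inv J (c *\<^sub>R x) = c *\<^sub>R inv J x" for c x
      using J'[of "c *\<^sub>R inv J x"] by (simp add: linear_scale[OF b(2)] J)
  qed
  moreover have "inv J x \<bullet> inv J y = x \<bullet> y" for x y
    using assms J by (metis euclidean_iso_def)
  ultimately show ?thesis using bij_imp_bij_inv[OF b(1)] by (simp add: euclidean_iso_def)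
qed

lemma frontier_euclidean_iso: "euclidean_iso J \<Longrightarrow> frontier (J ` S) = J ` frontier S"
  unfolding frontier_def euclidean_iso_def
  by (metis bij_def closure_injective_linear_image image_set_diff interior_bijective_linear_image)

lemma interior_euclidean_iso: "euclidean_iso J \<Longrightarrow> interior (J ` S) = J ` interior S"
  unfolding euclidean_iso_def by (metis interior_bijective_linear_image)

text \<open>The polygon length in the definition of \<open>curve_length\<close>, in a form suited to induction.\<close>
fun chain_length :: "(real \<Rightarrow> 'a::metric_space) \<Rightarrow> real list \<Rightarrow> real" where
  "chain_length g (x # y # zs) = dist (g x) (g y) + chain_length g (y # zs)"
| "chain_length g _ = 0"

lemma chain_length_sum: "chain_length g ts = (\<Sum>i<length ts - 1. dist (g (ts ! i)) (g (ts ! Suc i)))"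
proof (induction g ts rule: chain_length.induct)
  case (1 g x y zs)
  then show ?case by (simp add: sum.lessThan_Suc_shift del: sum.lessThan_Suc)
qed auto

lemma chain_length_nonneg: "0 \<le> chain_length g ts"
  by (induction g ts rule: chain_length.induct) auto

lemma curve_length_chain:
  "curve_length g a b = (SUP ts \<in> {ts. sorted ts \<and> set ts \<subseteq> {a..b}}. ennreal (chain_length g ts))"
  unfolding curve_length_def chain_length_sum ..

lemma chain_length_le_curve_length:
  "sorted ts \<Longrightarrow> set ts \<subseteq> {a..b} \<Longrightarrow> ennreal (chain_length g ts) \<le> curve_length g a b"
  unfolding curve_length_chain by (rule SUP_upper) auto

lemma dist_le_curve_length:
  assumes "a \<le> s" "s \<le> t" "t \<le> b"
  shows "ennreal (dist (g s) (g t)) \<le> curve_length g a b"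
  using chain_length_le_curve_length[of "[s, t]" a b g] assms by simp

lemma chain_length_append: "chain_length g (xs @ b # ys) = chain_length g (xs @ [b]) + chain_length g (b # ys)"
proof (induction xs)
  case (Cons x xs)
  then show ?case by (cases xs) auto
qed simp

lemma chain_length_insert: "chain_length g (xs @ ys) \<le> chain_length g (xs @ b # ys)"
proof (induction xs)
  case Nil
  then show ?case by (cases ys) auto
next
  case (Cons x xs)
  then show ?case by (cases xs; cases ys) (auto simp: dist_triangle)
qed

lemma chain_length_append_le: "chain_length g xs + chain_length g ys \<le> chain_length g (xs @ ys)"
proof (induction xs)
  case (Cons x xs)
  then show ?case by (cases xs; cases ys) auto
qed simp

lemma curve_length_superadditive:
  assumes "a \<le> b" "b \<le> c"
  shows "curve_length g a b + curve_length g b c \<le> curve_length g a c"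
proof -
  let ?S = "\<lambda>a b. {ts. sorted ts \<and> set ts \<subseteq> {a..b :: real}}"
  have ne: "?S x y \<noteq> {}" for x y by (auto intro: exI[of _ "[]"])
  have "ennreal (chain_length g xs) + ennreal (chain_length g ys) \<le> curve_length g a c"
    if "xs \<in> ?S a b" "ys \<in> ?S b c" for xs ys
  proof -
    have "ennreal (chain_length g xs) + ennreal (chain_length g ys) \<le> ennreal (chain_length g (xs @ ys))"
      using chain_length_append_le[of g xs ys]
      by (simp add: chain_length_nonneg ennreal_leI flip: ennreal_plus)
    also have "\<dots> \<le> curve_length g a c"
    proof (intro chain_length_le_curve_length)
      show "sorted (xs @ ys)"
      proof -
        have "x \<le> y" if "x \<in> set xs" "y \<in> set ys" for x y
        proof -
          have "x \<le> b" "b \<le> y" using \<open>xs \<in> _\<close> \<open>ys \<in> _\<close> that by auto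
          then show ?thesis by simp
        qed
        then show ?thesis using that by (simp add: sorted_append)
      qed
      show "set (xs @ ys) \<subseteq> {a..c}" using that assms by auto
    qed
    finally show ?thesis .
  qed
  note join = this
  have inner: "ennreal (chain_length g xs) + curve_length g b c \<le> curve_length g a c" if "xs \<in> ?S a b" for xs
    unfolding curve_length_chain[of g b c] ennreal_SUP_add_right[OF ne]
    by (rule SUP_least) (rule join[OF that])
  show ?thesis
    unfolding curve_length_chain[of g a b] ennreal_SUP_add_left[OF ne, symmetric]
    by (rule SUP_least) (rule inner)
qed

lemma curve_length_subadditive:
  assumes "a \<le> b" "b \<le> c"
  shows "curve_length g a c \<le> curve_length g a b + curve_length g b c"
  unfolding curve_length_chain[of g a c]
proof (rule SUP_least, clarify)
  fix ts assume ts: "sorted ts" "set ts \<subseteq> {a..c}"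
  define xs where "xs = takeWhile (\<lambda>x. x \<le> b) ts"
  define ys where "ys = dropWhile (\<lambda>x. x \<le> b) ts"
  have split: "ts = xs @ ys" by (simp add: xs_def ys_def)
  have xs: "x \<le> b" "a \<le> x" if "x \<in> set xs" for x
    using that ts(2) unfolding xs_def by (auto dest: set_takeWhileD)
  have ys: "b \<le> y \<and> y \<le> c" if "y \<in> set ys" for y
  proof -
    have "ys \<noteq> []" using that by auto
    then have "\<not> hd ys \<le> b" unfolding ys_def by (rule hd_dropWhile)
    moreover have "hd ys \<le> y"
      using that ts(1) split \<open>ys \<noteq> []\<close> by (cases ys) (auto simp: sorted_append)
    ultimately show ?thesis using that ts(2) split by auto
  qed
  have srt: "sorted xs" "sorted ys" using ts(1) split by (auto simp: sorted_append)
  have "chain_length g ts \<le> chain_length g (xs @ [b]) + chain_length g (b # ys)"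
    using chain_length_insert[of g xs ys b] chain_length_append[of g xs b ys] split by simp
  then have "ennreal (chain_length g ts) \<le> ennreal (chain_length g (xs @ [b])) + ennreal (chain_length g (b # ys))"
    by (simp add: chain_length_nonneg ennreal_leI flip: ennreal_plus)
  also have "\<dots> \<le> curve_length g a b + curve_length g b c"
    using xs ys srt assms by (intro add_mono chain_length_le_curve_length) (auto simp: sorted_append)
  finally show "ennreal (chain_length g ts) \<le> curve_length g a b + curve_length g b c" .
qed

lemma curve_length_add:
  assumes "a \<le> b" "b \<le> c"
  shows "curve_length g a c = curve_length g a b + curve_length g b c"
  using curve_length_superadditive[OF assms] curve_length_subadditive[OF assms] by (intro antisym)

text \<open>Any superadditive interval function that dominates the distances of end points dominates the length. This
covers Lipschitz bounds, reparametrizations and images under isometries at once.\<close>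
lemma curve_length_le_superadditive:
  assumes dist_le: "\<And>s t. a \<le> s \<Longrightarrow> s \<le> t \<Longrightarrow> t \<le> b \<Longrightarrow> ennreal (dist (g s) (g t)) \<le> W s t"
    and super: "\<And>s t u. a \<le> s \<Longrightarrow> s \<le> t \<Longrightarrow> t \<le> u \<Longrightarrow> u \<le> b \<Longrightarrow> W s t + W t u \<le> W s u"
  shows "curve_length g a b \<le> W a b"
  unfolding curve_length_chain
proof (rule SUP_least, clarify)
  fix ts assume ts: "sorted ts" "set ts \<subseteq> {a..b}"
  have *: "ennreal (chain_length g (x # xs)) \<le> W x b" if "sorted (x # xs)" "set (x # xs) \<subseteq> {a..b}" for x xs
    using that
  proof (induction xs arbitrary: x)
    case (Cons y ys)
    have ord: "a \<le> x" "x \<le> y" "y \<le> b" using Cons.prems by auto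
    have "ennreal (chain_length g (x # y # ys)) = ennreal (dist (g x) (g y)) + ennreal (chain_length g (y # ys))"
      by (simp add: chain_length_nonneg)
    also have "\<dots> \<le> W x y + W y b"
      using Cons.prems by (intro add_mono dist_le[OF ord] Cons.IH) auto
    also have "\<dots> \<le> W x b" using ord by (rule super) simp
    finally show ?case .
  qed simp
  show "ennreal (chain_length g ts) \<le> W a b"
  proof (cases ts)
    case (Cons x xs)
    have x: "a \<le> x" "x \<le> b" using ts Cons by auto
    have "ennreal (chain_length g ts) \<le> W x b" using * ts unfolding Cons by blast
    also have "\<dots> \<le> W a x + W x b" by simp
    also have "\<dots> \<le> W a b" using x by (intro super) simp_all
    finally show ?thesis .
  qed simp
qed

lemma curve_length_Lipschitz:
  assumes "\<And>s t. a \<le> s \<Longrightarrow> s \<le> t \<Longrightarrow> t \<le> b \<Longrightarrow> dist (g s) (g t) \<le> M * (t - s)" "0 \<le> M"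
  shows "curve_length g a b \<le> ennreal (M * (b - a))"
proof (rule curve_length_le_superadditive)
  show "ennreal (M * (t - s)) + ennreal (M * (u - t)) \<le> ennreal (M * (u - s))" if "s \<le> t" "t \<le> u" for s t u
  proof -
    have "M * (t - s) + M * (u - t) = M * (u - s)" by (simp add: algebra_simps)
    then show ?thesis using that assms(2) by (simp flip: ennreal_plus)
  qed
qed (use assms in \<open>auto intro: ennreal_leI\<close>)

lemma curve_length_cong:
  assumes "\<And>s. a \<le> s \<Longrightarrow> s \<le> b \<Longrightarrow> g s = h s"
  shows "curve_length g a b = curve_length h a b"
proof -
  have *: "chain_length g ts = chain_length h ts" if "set ts \<subseteq> {a..b}" for ts
    using that
  proof (induction ts)
    case (Cons x xs)
    then show ?case using assms by (cases xs) simp_all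
  qed simp
  show ?thesis unfolding curve_length_chain by (intro SUP_cong) (auto simp: *)
qed

lemma curve_length_reparam:
  assumes ab: "a \<le> b" and cont: "continuous_on {a..b} p" and mono: "\<And>x y. a \<le> x \<Longrightarrow> x < y \<Longrightarrow> y \<le> b \<Longrightarrow> p x < p y"
  shows "curve_length (\<lambda>x. g (p x)) a b = curve_length g (p a) (p b)"
proof (rule antisym)
  have mono': "p x \<le> p y" if "a \<le> x" "x \<le> y" "y \<le> b" for x y
    using mono[of x y] that by (cases "x = y") auto
  show "curve_length (\<lambda>x. g (p x)) a b \<le> curve_length g (p a) (p b)"
    by (rule curve_length_le_superadditive[where W = "\<lambda>s t. curve_length g (p s) (p t)"])
       (auto intro!: dist_le_curve_length curve_length_superadditive mono')
  define q where "q = (\<lambda>y. SOME x. x \<in> {a..b} \<and> p x = y)"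
  have q: "q y \<in> {a..b}" "p (q y) = y" if "p a \<le> y" "y \<le> p b" for y
  proof -
    have "\<exists>x. x \<in> {a..b} \<and> p x = y" using IVT'[of p a y b] that ab cont by auto
    from someI_ex[OF this] show "q y \<in> {a..b}" "p (q y) = y" unfolding q_def by auto
  qed
  have qmono: "q y \<le> q z" if "p a \<le> y" "y \<le> z" "z \<le> p b" for y z
    using q[of y] q[of z] that mono[of "q z" "q y"] by (cases "q y \<le> q z") auto
  have inj: "x = y" if "x \<in> {a..b}" "y \<in> {a..b}" "p x = p y" for x y
    using mono[of x y] mono[of y x] that by (cases x y rule: linorder_cases) auto
  have pab: "p a \<le> p b" using mono'[of a b] ab by simp
  have qa: "q (p a) = a" using q[of "p a"] pab ab by (intro inj[OF q(1)]) auto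
  have qb: "q (p b) = b" using q[of "p b"] pab ab by (intro inj[OF q(1)]) auto
  have "curve_length g (p a) (p b) \<le> curve_length (\<lambda>x. g (p x)) (q (p a)) (q (p b))"
  proof (rule curve_length_le_superadditive)
    fix s t assume st: "p a \<le> s" "s \<le> t" "t \<le> p b"
    have "ennreal (dist (g (p (q s))) (g (p (q t)))) \<le> curve_length (\<lambda>x. g (p x)) (q s) (q t)"
      using qmono[OF st] by (intro dist_le_curve_length) auto
    then show "ennreal (dist (g s) (g t)) \<le> curve_length (\<lambda>x. g (p x)) (q s) (q t)"
      using q[of s] q[of t] st by auto
  qed (auto intro!: curve_length_superadditive qmono)
  then show "curve_length g (p a) (p b) \<le> curve_length (\<lambda>x. g (p x)) a b" by (simp add: qa qb)
qed

lemma curve_length_isometry: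
  assumes "\<And>x y. dist (J x) (J y) = dist x y"
  shows "curve_length (\<lambda>s. J (r s)) a b = curve_length r a b"
  unfolding curve_length_def assms ..

section \<open>Cone over the sum of a balanced pair\<close>

sublocale balanced_arc_pair \<subseteq> curve: closed_convex_curve L chart tangent_angle "\<lambda>s. (az1 s + az2 s) / 2"
proof
  show "continuous_on {0..L} (\<lambda>s. (az1 s + az2 s) / 2)"
    by (intro continuous_intros A.az_cont B.az_cont) simp
  show "\<bar>tangent_angle s - (az1 s + az2 s) / 2\<bar> < pi / 2" if "s \<in> {0..L}" for s
  proof -
    have "\<bar>skew_angle x y\<bar> < pi / 2" for x y
      unfolding skew_angle_def abs_less_iff using arctan_bounded minus_less_iff by blast
    then show ?thesis by (simp add: tangent_angle_def)
  qed
qed (use A.L_pos chart_cont chart_deriv chart_closing tangent_angle_mono tangent_angle_closing in auto)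

context balanced_arc_pair
begin

lemma sum_of_points: "s \<in> {0..L} \<Longrightarrow> sphere_point (az1 s) (g1 s) + sphere_point (az2 s) (g2 s) = height_sum s *\<^sub>R (chart s, 1)"
  using height_sum_pos[of s] by (simp add: sphere_point_def chart_def horizontal_sum_def height_sum_def)

lemma combination_eq_frontier:
  "cone_over L (\<lambda>s. sphere_point (az1 s) (g1 s) + sphere_point (az2 s) (g2 s)) = frontier curve.body"
  unfolding curve.frontier_body
proof (rule set_eqI, rule iffI)
  fix x assume "x \<in> cone_over L (\<lambda>s. sphere_point (az1 s) (g1 s) + sphere_point (az2 s) (g2 s))"
  then obtain t s where ts: "0 \<le> t" "s \<in> {0..L}" "x = t *\<^sub>R (sphere_point (az1 s) (g1 s) + sphere_point (az2 s) (g2 s))" by blast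
  then have "x = (t * height_sum s) *\<^sub>R (chart s, 1)" by (simp add: sum_of_points)
  then show "x \<in> cone_over L (\<lambda>s. (chart s, 1))"
    using ts height_sum_pos[OF ts(2)] by (intro CollectI exI[of _ "t * height_sum s"] exI[of _ s]) auto
next
  fix x :: "complex \<times> real" assume "x \<in> cone_over L (\<lambda>s. (chart s, 1))"
  then obtain t s where ts: "0 \<le> t" "s \<in> {0..L}" "x = t *\<^sub>R (chart s, 1)" by blast
  then have "x = (t / height_sum s) *\<^sub>R (sphere_point (az1 s) (g1 s) + sphere_point (az2 s) (g2 s))"
    using height_sum_pos[OF ts(2)] by (simp add: sum_of_points)
  then show "x \<in> cone_over L (\<lambda>s. sphere_point (az1 s) (g1 s) + sphere_point (az2 s) (g2 s))"
    using ts height_sum_pos[OF ts(2)] by (intro CollectI exI[of _ "t / height_sum s"] exI[of _ s]) auto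
qed

lemma combination_supported:
  assumes "x \<in> frontier curve.body"
  shows "0 \<le> snd x" "snd x = 0 \<Longrightarrow> x = 0"
  using assms unfolding curve.frontier_body by (auto simp: prod_eq_iff)

text \<open>The supporting plane is horizontal: all points \<open>(chart s, 1)\<close> have height 1.\<close>
lemma combination_strictly_convex:
  fixes J :: "complex \<times> real \<Rightarrow> real^3"
  assumes iso: "euclidean_iso J"
  shows "strictly_convex_cone_surface 0
     (cone_over L (\<lambda>s. J (sphere_point (az1 s) (g1 s)) + J (sphere_point (az2 s) (g2 s))))"
proof -
  have J: "linear J" "bij J" and inner: "J x \<bullet> J y = x \<bullet> y" for x y
    using iso unfolding euclidean_iso_def by blast+
  have eq: "cone_over L (\<lambda>s. J (sphere_point (az1 s) (g1 s)) + J (sphere_point (az2 s) (g2 s))) = J ` frontier curve.body"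
  proof -
    have J': "t *\<^sub>R (J x + J y) = J (t *\<^sub>R (x + y))" for t x y
      by (simp add: linear_scale[OF J(1)] linear_add[OF J(1)])
    show ?thesis unfolding combination_eq_frontier[symmetric] J' by blast
  qed
  have fr: "J ` frontier curve.body = frontier (J ` curve.body)"
    using frontier_euclidean_iso[OF iso] by simp
  have cone: "convex_cone_surface 0 (J ` frontier curve.body)"
    unfolding convex_cone_surface_def
  proof (intro exI[of _ "J ` curve.body"] conjI)
    show "convex_cone (J ` curve.body)" using curve.convex_cone_body J(1) by (intro convex_cone_linear_image conjI)
    have "interior (J ` curve.body) = J ` interior curve.body"
      by (rule interior_euclidean_iso[OF iso])
    then show "interior (J ` curve.body) \<noteq> {}" using curve.interior_body_nonempty by simp
    show "J ` curve.body \<noteq> UNIV" using curve.body_ne_UNIV J(2)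
      by (metis bij_def bij_image_Collect_eq inj_image_eq_iff surj_def)
  qed (simp add: fr)
  have n: "J (0, 1) \<noteq> 0"
    using inner[of "(0,1)" "(0,1)"] by auto
  have p: "J (0, 1) \<bullet> J y = snd y" for y using inner[of "(0,1)" y] by (cases y) simp
  have "0 \<in> frontier curve.body" unfolding curve.frontier_body using A.L_pos
    by (auto simp: prod_eq_iff intro!: exI[of _ 0])
  then have "J ` frontier curve.body \<inter> {x. J (0, 1) \<bullet> x = 0} = {0}"
    using combination_supported(2) linear_0[OF J(1)] by (force simp: p)
  then show ?thesis
    unfolding eq strictly_convex_cone_surface_def using cone n combination_supported(1) p
    by (intro conjI exI[of _ "J (0, 1)"] exI[of _ 0]) auto
qed

end

section \<open>Unit section of a cone in azimuth coordinates\<close>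

text \<open>The boundary of a cone over the unit circle in the horizontal plane, as height \<open>h\<close> over the angle, with right
slope \<open>p\<close>. Comparison with supporting planes, which have the profiles \<open>cos e * h x + sin e * p x\<close>, is the
form that convexity takes here.\<close>
locale polar_profile =
  fixes h p :: "real \<Rightarrow> real" and M :: real
  assumes h_nonneg: "0 \<le> h x" and p_bound: "\<bar>p x\<bar> \<le> M"
    and h_periodic: "h (x + 2 * pi) = h x" and p_periodic: "p (x + 2 * pi) = p x"
    and support: "\<bar>e\<bar> < pi / 2 \<Longrightarrow> cos e * h x + sin e * p x \<le> h (x + e)"
    and p_usc: "p x < b \<Longrightarrow> \<forall>\<^sub>F y in at x. p y < b"
    and h_cont: "continuous_on UNIV h"
begin

text \<open>Compare the supporting planes at \<open>x\<close> and at \<open>x + e\<close> in both directions.\<close>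
lemma p_growth:
  assumes "0 \<le> e" "e < pi / 2"
  shows "cos e * p x - sin e * h x \<le> p (x + e)"
proof (cases "e = 0")
  case False
  then have e: "0 < e" "sin e > 0" "cos e > 0" using assms by (auto intro: sin_gt_zero cos_gt_zero)
  have "cos e * h (x + e) - sin e * p (x + e) \<le> h x" using support[of "-e" "x + e"] e assms by simp
  moreover have "cos e * (cos e * h x + sin e * p x) \<le> cos e * h (x + e)"
    using support[of e x] e assms by (intro mult_left_mono) auto
  ultimately have "cos e * (cos e * h x + sin e * p x) - h x \<le> sin e * p (x + e)" by linarith
  moreover have "cos e * (cos e * h x + sin e * p x) - h x = sin e * (cos e * p x - sin e * h x)"
    using sin_cos_squared_add[of e] by algebra
  ultimately show ?thesis using e by simp
qed simp

lemma p_right_cont: "(p \<longlongrightarrow> p x) (at_right x)"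
proof (rule order_tendstoI)
  fix b assume "p x < b"
  then show "\<forall>\<^sub>F y in at_right x. p y < b" using p_usc filter_leD[OF at_le] by (metis subset_UNIV)
next
  fix b assume b: "b < p x"
  have "((\<lambda>y. cos (y - x) * p x - sin (y - x) * h x) \<longlongrightarrow> cos (x - x) * p x - sin (x - x) * h x) (at_right x)"
    by (intro tendsto_intros)
  then have "\<forall>\<^sub>F y in at_right x. b < cos (y - x) * p x - sin (y - x) * h x"
    using b by (intro order_tendstoD(1)) auto
  moreover have "\<forall>\<^sub>F y in at_right x. x < y \<and> y < x + pi/2"
    by (rule eventually_at_rightI[of _ "x + pi/2"]) auto
  ultimately show "\<forall>\<^sub>F y in at_right x. b < p y"
  proof eventually_elim
    case (elim y)
    then show ?case using p_growth[of "y - x" x] by simp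
  qed
qed

lemma h_deriv: "(h has_real_derivative p x) (at_right x)"
proof -
  let ?l = "\<lambda>y. ((cos (y - x) * h x + sin (y - x) * p x) - (cos (x - x) * h x + sin (x - x) * p x)) / (y - x)"
  let ?t = "\<lambda>y. (tan (y - x) - tan (x - x)) / (y - x)" and ?i = "\<lambda>y. (inverse (cos (y - x)) - inverse (cos (x - x))) / (y - x)"
  have l: "(?l \<longlongrightarrow> p x) (at_right x)"
  proof -
    have "((\<lambda>y. cos (y - x) * h x + sin (y - x) * p x) has_real_derivative p x) (at_right x)"
      by (auto intro!: derivative_eq_intros)
    then show ?thesis by (simp add: has_field_derivative_iff)
  qed
  have t: "(?t \<longlongrightarrow> 1) (at_right x)"
  proof -
    have "((\<lambda>y. tan (y - x)) has_real_derivative 1) (at_right x)"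
      by (auto intro!: derivative_eq_intros)
    then show ?thesis by (simp add: has_field_derivative_iff)
  qed
  have i: "(?i \<longlongrightarrow> 0) (at_right x)"
  proof -
    have "((\<lambda>y. inverse (cos (y - x))) has_real_derivative 0) (at_right x)"
      by (auto intro!: derivative_eq_intros)
    then show ?thesis by (simp add: has_field_derivative_iff)
  qed
  have u: "((\<lambda>y. ?i y * h x + ?t y * p y) \<longlongrightarrow> 0 * h x + 1 * p x) (at_right x)"
    by (intro tendsto_intros t i p_right_cont)
  have ev: "\<forall>\<^sub>F y in at_right x. x < y \<and> y < x + pi/2"
    by (rule eventually_at_rightI[of _ "x + pi/2"]) auto
  have "((\<lambda>y. (h y - h x) / (y - x)) \<longlongrightarrow> p x) (at_right x)"
  proof (rule tendsto_sandwich[OF _ _ l])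
    show "\<forall>\<^sub>F y in at_right x. ?l y \<le> (h y - h x) / (y - x)"
      using ev
    proof eventually_elim
      case (elim y)
      then show ?case using support[of "y - x" x] by (intro divide_right_mono) auto
    qed
    show "\<forall>\<^sub>F y in at_right x. (h y - h x) / (y - x) \<le> ?i y * h x + ?t y * p y"
      using ev
    proof eventually_elim
      case (elim y)
      then have c: "cos (y - x) > 0" by (intro cos_gt_zero) auto
      have "cos (y - x) * h y - sin (y - x) * p y \<le> h x" proof -
        have "cos (x - y) = cos (y - x)" "sin (x - y) = - sin (y - x)"
          by (metis cos_minus minus_diff_eq, metis sin_minus minus_diff_eq)
        then show ?thesis using support[of "x - y" y] elim by simp
      qed
      then have "inverse (cos (y - x)) * (cos (y - x) * h y) \<le> inverse (cos (y - x)) * (h x + sin (y - x) * p y)"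
        using c by (intro mult_left_mono) auto
      moreover have "inverse (cos (y - x)) * (cos (y - x) * h y) = h y" using c by simp
      ultimately have "h y \<le> inverse (cos (y - x)) * (h x + sin (y - x) * p y)" by linarith
      then have "h y \<le> inverse (cos (y - x)) * h x + tan (y - x) * p y"
        by (simp add: tan_def algebra_simps divide_inverse)
      then have "(h y - h x) / (y - x) \<le> ((inverse (cos (y - x)) - 1) * h x + tan (y - x) * p y) / (y - x)"
        using elim by (intro divide_right_mono) (auto simp: algebra_simps)
      then show ?case by (simp add: add_divide_distrib)
    qed
    show "((\<lambda>y. ?i y * h x + ?t y * p y) \<longlongrightarrow> p x) (at_right x)" using u by simp
  qed
  then show ?thesis by (simp add: has_field_derivative_iff)
qed

text \<open>The point of the cone over \<open>cis x\<close> has distance \<open>\<rho> x\<close> from the vertex, so \<open>trace\<close> is the unit section.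
Further, \<open>gap\<close> is the tangent of half the angle to the axis (\<open>trace_eq_sphere_point\<close>), and \<open>slope_angle\<close>
is the slope angle of \<open>trace\<close> over the circle of latitude.\<close>
definition \<rho> :: "real \<Rightarrow> real" where "\<rho> x = sqrt (1 + (h x)\<^sup>2)"
definition \<kappa> :: "real \<Rightarrow> real" where "\<kappa> x = sqrt (1 + (h x)\<^sup>2 + (p x)\<^sup>2)"
definition gap :: "real \<Rightarrow> real" where "gap x = \<rho> x - h x"
definition slope_angle :: "real \<Rightarrow> real" where "slope_angle x = arctan (p x / \<rho> x)"
definition trace :: "real \<Rightarrow> complex \<times> real" where "trace x = (cis x /\<^sub>R \<rho> x, h x / \<rho> x)"

lemma \<rho>_sq: "(\<rho> x)\<^sup>2 = 1 + (h x)\<^sup>2" by (simp add: \<rho>_def add_nonneg_nonneg)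
lemma \<rho>_ge_1: "1 \<le> \<rho> x" by (simp add: \<rho>_def)
lemma \<rho>_pos: "0 < \<rho> x" using \<rho>_ge_1[of x] by linarith
lemma \<kappa>_sq: "(\<kappa> x)\<^sup>2 = (\<rho> x)\<^sup>2 + (p x)\<^sup>2" by (simp add: \<kappa>_def \<rho>_sq add_nonneg_nonneg)
lemma \<kappa>_pos: "0 < \<kappa> x" by (simp add: \<kappa>_def add_pos_nonneg)

lemma gap_pos: "0 < gap x"
proof -
  have "(h x)\<^sup>2 < (\<rho> x)\<^sup>2" by (simp add: \<rho>_sq)
  then show ?thesis using power2_less_imp_less[of "h x" "\<rho> x"] \<rho>_pos[of x] by (simp add: gap_def)
qed

lemma gap_inverse: "gap x * (\<rho> x + h x) = 1"
  using \<rho>_sq[of x] by (simp add: gap_def algebra_simps power2_eq_square)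

lemma gap_le_1: "gap x \<le> 1"
proof -
  have "gap x * 1 \<le> gap x * (\<rho> x + h x)"
    using gap_pos[of x] \<rho>_ge_1[of x] h_nonneg[of x] by (intro mult_left_mono) auto
  then show ?thesis by (simp add: gap_inverse)
qed

lemma one_plus_gap_sq: "1 + (gap x)\<^sup>2 = 2 * \<rho> x * gap x"
  using gap_inverse[of x] by (simp add: gap_def algebra_simps power2_eq_square)

lemma one_minus_gap_sq: "1 - (gap x)\<^sup>2 = 2 * h x * gap x"
  using gap_inverse[of x] by (simp add: gap_def algebra_simps power2_eq_square)

lemma trace_eq_sphere_point: "trace x = sphere_point x (gap x)"
proof -
  have ne: "gap x \<noteq> 0" using gap_pos[of x] by simp
  have "radius (gap x) = inverse (\<rho> x)" "height (gap x) = h x / \<rho> x"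
    unfolding radius_def height_def one_plus_gap_sq one_minus_gap_sq using ne by (simp_all add: inverse_eq_divide)
  then show ?thesis by (simp add: trace_def sphere_point_def)
qed

lemma gap_eq_1_iff: "gap x = 1 \<longleftrightarrow> h x = 0"
proof
  assume "gap x = 1"
  then show "h x = 0" using one_minus_gap_sq[of x] by simp
next
  assume "h x = 0"
  then show "gap x = 1" by (simp add: gap_def \<rho>_def)
qed

lemma cos_slope: "cos (slope_angle x) = \<rho> x / \<kappa> x" and sin_slope: "sin (slope_angle x) = p x / \<kappa> x"
proof -
  have "sqrt (1 + (p x / \<rho> x)\<^sup>2) = sqrt ((\<kappa> x)\<^sup>2 / (\<rho> x)\<^sup>2)"
    unfolding \<kappa>_sq using \<rho>_pos[of x] by (simp add: add_divide_distrib power_divide)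
  also have "\<dots> = \<kappa> x / \<rho> x" using \<rho>_pos[of x] \<kappa>_pos[of x] by (simp add: real_sqrt_divide)
  finally have *: "sqrt (1 + (p x / \<rho> x)\<^sup>2) = \<kappa> x / \<rho> x" .
  show "cos (slope_angle x) = \<rho> x / \<kappa> x" "sin (slope_angle x) = p x / \<kappa> x"
    unfolding slope_angle_def cos_arctan sin_arctan * using \<rho>_pos[of x] by simp_all
qed

lemma \<rho>_deriv: "(\<rho> has_real_derivative h x * p x / \<rho> x) (at_right x)"
proof -
  have "((\<lambda>x. sqrt (1 + (h x)\<^sup>2)) has_real_derivative (2 * h x * p x) * (inverse (sqrt (1 + (h x)\<^sup>2)) / 2)) (at_right x)"
  proof -
    have "((\<lambda>x. 1 + (h x)\<^sup>2) has_real_derivative 2 * h x * p x) (at_right x)"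
      using DERIV_add[OF DERIV_const DERIV_power[OF h_deriv, of 2]] by (simp add: mult_ac)
    from DERIV_chain2[OF DERIV_real_sqrt this] show ?thesis by (simp add: add_pos_nonneg mult.commute)
  qed
  then show ?thesis by (simp add: \<rho>_def[abs_def] field_simps)
qed

lemma gap_deriv: "(gap has_real_derivative - gap x * p x / \<rho> x) (at_right x)"
proof -
  have "h x * p x / \<rho> x - p x = - gap x * p x / \<rho> x"
    using \<rho>_pos[of x] by (simp add: gap_def field_simps)
  then show ?thesis using DERIV_diff[OF \<rho>_deriv h_deriv, of x] unfolding gap_def[abs_def] by simp
qed

lemma trace_deriv:
  "(trace has_vector_derivative (cis x * (\<i> / \<rho> x - h x * p x / (\<rho> x)^3), p x / (\<rho> x)^3)) (at_right x)"
proof -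
  have ne: "\<rho> x \<noteq> 0" using \<rho>_pos[of x] by simp
  have inv: "((\<lambda>x. inverse (\<rho> x)) has_real_derivative - (h x * p x / (\<rho> x)^3)) (at_right x)"
    using DERIV_inverse'[OF \<rho>_deriv ne] by (simp add: divide_inverse power3_eq_cube mult_ac)
  have c: "(cis has_vector_derivative (\<i> * cis x)) (at_right x)"
    using has_derivative_cis[of "\<lambda>x. x" "\<lambda>t. t" x "{x<..}"] by (simp add: has_vector_derivative_def)
  have 1: "((\<lambda>x. cis x /\<^sub>R \<rho> x) has_vector_derivative cis x * (\<i> / \<rho> x - h x * p x / (\<rho> x)^3)) (at_right x)"
    using has_vector_derivative_scaleR[OF inv c]
    by (elim has_vector_derivative_eq_rhs) (simp add: scaleR_conv_of_real divide_inverse algebra_simps)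
  have "((\<lambda>x. h x / \<rho> x) has_real_derivative p x / (\<rho> x)^3) (at_right x)"
  proof -
    have "p x * inverse (\<rho> x) + - (h x * p x / (\<rho> x)^3) * h x = p x * ((\<rho> x)\<^sup>2 - (h x)\<^sup>2) / (\<rho> x)^3"
      using ne by (simp add: field_simps power2_eq_square power3_eq_cube)
    also have "\<dots> = p x / (\<rho> x)^3" by (simp add: \<rho>_sq)
    finally show ?thesis using DERIV_mult[OF h_deriv inv] by (simp add: divide_inverse)
  qed
  then have 2: "((\<lambda>x. h x / \<rho> x) has_vector_derivative p x / (\<rho> x)^3) (at_right x)"
    by (simp add: has_real_derivative_iff_has_vector_derivative)
  show ?thesis unfolding trace_def[abs_def] by (rule has_vector_derivative_Pair[OF 1 2])
qed

lemma trace_speed: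
  "norm (cis x * (\<i> / \<rho> x - h x * p x / (\<rho> x)^3), p x / (\<rho> x)^3) = \<kappa> x / (\<rho> x)\<^sup>2"
proof -
  have ne: "\<rho> x \<noteq> 0" using \<rho>_pos[of x] by simp
  have "(norm (cis x * (\<i> / \<rho> x - h x * p x / (\<rho> x)^3)))\<^sup>2 = (1 / \<rho> x)\<^sup>2 + (h x * p x / (\<rho> x)^3)\<^sup>2"
  proof -
    have eq: "\<i> / \<rho> x - h x * p x / (\<rho> x)^3 = Complex (- (h x * p x / (\<rho> x)^3)) (1 / \<rho> x)"
      by (simp add: complex_eq_iff Re_divide_of_real Im_divide_of_real flip: of_real_power of_real_mult of_real_divide)
    show ?thesis unfolding norm_mult norm_cis eq by (simp add: cmod_power2)
  qed
  then have "(norm (cis x * (\<i> / \<rho> x - h x * p x / (\<rho> x)^3), p x / (\<rho> x)^3))\<^sup>2 = (1 / \<rho> x)\<^sup>2 + (h x * p x / (\<rho> x)^3)\<^sup>2 + (p x / (\<rho> x)^3)\<^sup>2"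
    unfolding norm_Pair real_norm_def power2_abs by (simp only: real_sqrt_pow2 add_nonneg_nonneg zero_le_power2)
  also have "\<dots> = (1 / \<rho> x)\<^sup>2 + (1 + (h x)\<^sup>2) * (p x)\<^sup>2 / ((\<rho> x)^3)\<^sup>2"
  proof -
    have "(h x * p x / (\<rho> x)^3)\<^sup>2 + (p x / (\<rho> x)^3)\<^sup>2 = ((h x * p x)\<^sup>2 + (p x)\<^sup>2) / ((\<rho> x)^3)\<^sup>2"
      unfolding power_divide add_divide_distrib ..
    also have "(h x * p x)\<^sup>2 + (p x)\<^sup>2 = (1 + (h x)\<^sup>2) * (p x)\<^sup>2"
      unfolding power_mult_distrib distrib_right by simp
    finally show ?thesis by simp
  qed
  also have "\<dots> = (\<rho> x)\<^sup>2 / ((\<rho> x)\<^sup>2)\<^sup>2 + (p x)\<^sup>2 / ((\<rho> x)\<^sup>2)\<^sup>2"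
  proof -
    have "(1 / \<rho> x)\<^sup>2 = (\<rho> x)\<^sup>2 / ((\<rho> x)\<^sup>2)\<^sup>2" using ne by (simp add: power2_eq_square)
    moreover have "(\<rho> x)\<^sup>2 * (p x)\<^sup>2 / ((\<rho> x)^3)\<^sup>2 = (p x)\<^sup>2 / ((\<rho> x)\<^sup>2)\<^sup>2"
      using ne by (simp add: power2_eq_square power3_eq_cube)
    ultimately show ?thesis by (simp add: \<rho>_sq)
  qed
  also have "\<dots> = (\<kappa> x / (\<rho> x)\<^sup>2)\<^sup>2"
    unfolding power_divide \<kappa>_sq by (simp add: add_divide_distrib)
  finally show ?thesis using \<kappa>_pos[of x] by (intro power2_eq_imp_eq[of "norm _"]) auto
qed

end

context polar_profile
begin

lemma \<rho>_cont: "continuous_on UNIV \<rho>"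
  unfolding \<rho>_def[abs_def] by (intro continuous_intros h_cont)

lemma gap_cont: "continuous_on UNIV gap"
  unfolding gap_def[abs_def] by (intro continuous_intros h_cont \<rho>_cont)

lemma trace_cont: "continuous_on UNIV trace"
proof -
  have "\<rho> x \<noteq> 0" for x using \<rho>_pos[of x] by simp
  then show ?thesis unfolding trace_def[abs_def] by (intro continuous_intros h_cont \<rho>_cont) auto
qed

definition speed :: "real \<Rightarrow> real" where "speed x = \<kappa> x / (\<rho> x)\<^sup>2"

lemma speed_pos: "0 < speed x" using \<kappa>_pos[of x] \<rho>_pos[of x] by (simp add: speed_def)

lemma speed_le: "speed x \<le> 1 + M"
proof -
  have M: "0 \<le> M" using p_bound[of x] by linarith
  have "\<kappa> x \<le> \<rho> x + \<bar>p x\<bar>"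
  proof (rule power2_le_imp_le)
    show "(\<kappa> x)\<^sup>2 \<le> (\<rho> x + \<bar>p x\<bar>)\<^sup>2"
      unfolding \<kappa>_sq power2_sum power2_abs using \<rho>_pos[of x] by simp
  qed (use \<rho>_pos[of x] in simp)
  also have "\<dots> \<le> \<rho> x * 1 + \<rho> x * M"
    using p_bound[of x] \<rho>_ge_1[of x] mult_right_mono[of 1 "\<rho> x" M] M by simp
  also have "\<dots> = \<rho> x * (1 + M)" by (simp add: algebra_simps)
  also have "\<dots> \<le> (\<rho> x)\<^sup>2 * (1 + M)"
    using \<rho>_ge_1[of x] M by (intro mult_right_mono) (auto simp: power2_eq_square)
  finally show ?thesis using \<rho>_pos[of x] by (simp add: speed_def pos_divide_le_eq mult.commute)
qed

lemma speed_right_cont: "(speed \<longlongrightarrow> speed x) (at_right x)"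
proof -
  have "isCont h x" using h_cont by (simp add: continuous_on_eq_continuous_at)
  then have h: "(h \<longlongrightarrow> h x) (at_right x)" unfolding isCont_def filterlim_at_split by simp
  have r: "(\<rho> \<longlongrightarrow> \<rho> x) (at_right x)"
    unfolding \<rho>_def[abs_def] by (rule tendsto_real_sqrt[OF tendsto_add[OF tendsto_const tendsto_power[OF h]]])
  have k: "(\<kappa> \<longlongrightarrow> \<kappa> x) (at_right x)"
    unfolding \<kappa>_def[abs_def]
    by (rule tendsto_real_sqrt[OF tendsto_add[OF tendsto_add[OF tendsto_const tendsto_power[OF h]] tendsto_power[OF p_right_cont]]])
  have "(\<rho> x)\<^sup>2 \<noteq> 0" using \<rho>_pos[of x] by simp
  then show ?thesis
    unfolding speed_def[abs_def] by (rule tendsto_divide[OF k tendsto_power[OF r]])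
qed

lemma trace_length_le:
  assumes "x \<le> y" "\<And>z. x \<le> z \<Longrightarrow> z < y \<Longrightarrow> speed z \<le> V" "0 \<le> V"
  shows "curve_length trace x y \<le> ennreal (V * (y - x))"
proof (rule curve_length_Lipschitz[OF _ assms(3)])
  fix s t assume st: "x \<le> s" "s \<le> t" "t \<le> y"
  show "dist (trace s) (trace t) \<le> V * (t - s)"
  proof (rule right_derivative_bound[OF st(2)])
    fix z assume "s \<le> z" "z < t"
    then have "speed z \<le> V" using assms(2)[of z] st by simp
    then show "\<exists>D. (trace has_vector_derivative D) (at_right z) \<and> norm D \<le> V"
      unfolding speed_def trace_speed[symmetric] using trace_deriv by blast
  qed (rule continuous_on_subset[OF trace_cont subset_UNIV])
qed

lemma trace_arc_injective:
  assumes "x < y" "y - x < 2 * pi"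
  shows "trace x \<noteq> trace y"
proof
  assume eq: "trace x = trace y"
  then have "norm (cis x /\<^sub>R \<rho> x) = norm (cis y /\<^sub>R \<rho> y)" by (simp add: trace_def)
  then have "\<rho> x = \<rho> y" using \<rho>_pos[of x] \<rho>_pos[of y] by simp
  then have "cis x = cis y" using eq \<rho>_pos[of y] by (simp add: trace_def)
  then have "cis (y - x) = 1" by (metis cis_divide cis_neq_zero divide_self)
  then have "cos (y - x) = 1" by (simp add: complex_eq_iff)
  then obtain n :: int where n: "y - x = of_int n * 2 * pi" using cos_one_2pi_int by auto
  then have "0 < of_int n * (2 * pi)" "of_int n * (2 * pi) < 1 * (2 * pi)" using assms by (auto simp: algebra_simps)
  then have "0 < n" "n < 1" using pi_gt_zero by (auto simp: zero_less_mult_iff)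
  then show False by simp
qed

text \<open>Shortening the interval to length at most 1 avoids full turns, after which \<open>trace\<close> repeats.\<close>
lemma trace_length_pos:
  assumes "x < y"
  shows "0 < curve_length trace x y"
proof -
  define z where "z = min y (x + 1)"
  have z: "x < z" "z \<le> y" "z - x < 2 * pi" using assms pi_gt3 by (auto simp: z_def)
  have "0 < dist (trace x) (trace z)" using trace_arc_injective[OF z(1,3)] by simp
  then have "0 < ennreal (dist (trace x) (trace z))" by (simp add: ennreal_zero_less_mult_iff)
  also have "\<dots> \<le> curve_length trace x y" using z by (intro dist_le_curve_length) auto
  finally show ?thesis .
qed

end

text \<open>The function \<open>a\<close> gives the azimuth as a function of the arc length of the unit section.\<close>
locale arc_length_azimuth = polar_profile +
  fixes L :: real and a :: "real \<Rightarrow> real"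
  assumes L_pos: "0 < L"
    and a_cont: "continuous_on {0..L} a"
    and a_less: "0 \<le> s \<Longrightarrow> s < t \<Longrightarrow> t \<le> L \<Longrightarrow> a s < a t"
    and a_length: "s \<in> {0..L} \<Longrightarrow> curve_length trace (a 0) (a s) = ennreal s"
    and a_closing: "a L = a 0 + 2 * pi"
begin

lemma length_between:
  assumes "0 \<le> s" "s \<le> t" "t \<le> L"
  shows "curve_length trace (a s) (a t) = ennreal (t - s)"
proof -
  have le: "a x \<le> a y" if "0 \<le> x" "x \<le> y" "y \<le> L" for x y
    using a_less[of x y] that by (cases "x = y") auto
  have "ennreal s + curve_length trace (a s) (a t) = ennreal t"
    using curve_length_add[of "a 0" "a s" "a t" trace] le a_length[of s] a_length[of t] assms by auto
  also have "\<dots> = ennreal s + ennreal (t - s)" using assms by (simp flip: ennreal_plus)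
  finally show ?thesis by (simp add: ennreal_add_left_cancel)
qed

lemma a_right_limit:
  assumes "0 \<le> s" "s < L"
  shows "filterlim a (at_right (a s)) (at_right s)"
  unfolding filterlim_at
proof
  have "(a \<longlongrightarrow> a s) (at s within {0..L})" using a_cont assms by (simp add: continuous_on)
  moreover have "at_right s = at s within {s<..<L}" using assms by (intro at_right_eq_Ioo) simp
  ultimately show "(a \<longlongrightarrow> a s) (at_right s)" using assms by (auto elim: tendsto_within_subset)
  show "\<forall>\<^sub>F x in at_right s. a x \<in> {a s<..} \<and> a x \<noteq> a s"
  proof (rule eventually_at_rightI)
    fix x assume "x \<in> {s<..<L}"
    then have "a s < a x" using assms by (intro a_less) auto
    then show "a x \<in> {a s<..} \<and> a x \<noteq> a s" by simp
  qed (rule assms(2))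
qed

text \<open>The length between two points is at least the chord, and at most the parameter length times the maximal
speed in between; both estimates are sharp in the limit because the speed is right continuous.\<close>
lemma a_deriv:
  assumes s: "0 \<le> s" "s < L"
  shows "(a has_real_derivative inverse (speed (a s))) (at_right s)"
proof -
  let ?x = "a s"
  let ?D = "(cis ?x * (\<i> / \<rho> ?x - h ?x * p ?x / (\<rho> ?x)^3), p ?x / (\<rho> ?x)^3)"
  note lim = a_right_limit[OF s]
  have "((\<lambda>y. (trace y - trace ?x) /\<^sub>R (y - ?x)) \<longlongrightarrow> ?D) (at_right ?x)"
    by (rule vector_right_derivative_quotient[OF trace_deriv])
  then have "((\<lambda>y. norm ((trace y - trace ?x) /\<^sub>R (y - ?x))) \<longlongrightarrow> speed ?x) (at_right ?x)"
    unfolding speed_def trace_speed[symmetric] by (rule tendsto_norm)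
  then have low: "((\<lambda>t. norm ((trace (a t) - trace ?x) /\<^sub>R (a t - ?x))) \<longlongrightarrow> speed ?x) (at_right s)"
    by (rule filterlim_compose[OF _ lim])
  have evL: "\<forall>\<^sub>F t in at_right s. s < t \<and> t < L" by (rule eventually_at_rightI[of _ L]) (use s in auto)
  have "((\<lambda>t. (t - s) / (a t - ?x)) \<longlongrightarrow> speed ?x) (at_right s)"
  proof (rule order_tendstoI)
    fix b assume "b < speed ?x"
    then have "\<forall>\<^sub>F t in at_right s. b < norm ((trace (a t) - trace ?x) /\<^sub>R (a t - ?x))"
      by (rule order_tendstoD[OF low])
    then show "\<forall>\<^sub>F t in at_right s. b < (t - s) / (a t - ?x)"
      using evL
    proof eventually_elim
      case (elim t)
      have pos: "a t - ?x > 0" using a_less[of s t] elim s by auto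
      have "ennreal (dist (trace ?x) (trace (a t))) \<le> ennreal (t - s)"
        using dist_le_curve_length[of ?x ?x "a t" "a t" trace] length_between[of s t] pos elim s by auto
      then have "dist (trace ?x) (trace (a t)) \<le> t - s" using elim by (simp add: ennreal_le_iff)
      then have "norm ((trace (a t) - trace ?x) /\<^sub>R (a t - ?x)) \<le> (t - s) / (a t - ?x)"
        using pos by (simp add: dist_norm norm_minus_commute divide_right_mono inverse_eq_divide)
      then show ?case using elim by simp
    qed
  next
    fix b assume b: "speed ?x < b"
    then obtain c where c: "speed ?x < c" "c < b" using dense by blast
    have "\<forall>\<^sub>F y in at_right ?x. speed y < c" using speed_right_cont c(1) by (rule order_tendstoD)
    then obtain d where d: "d > ?x" "\<And>y. ?x < y \<Longrightarrow> y < d \<Longrightarrow> speed y < c"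
      unfolding eventually_at_right_field by blast
    have "\<forall>\<^sub>F y in at_right ?x. y < d" using d(1) by (intro eventually_at_rightI[of _ d]) auto
    then have "\<forall>\<^sub>F t in at_right s. a t < d" using lim by (auto simp: filterlim_iff)
    then show "\<forall>\<^sub>F t in at_right s. (t - s) / (a t - ?x) < b"
      using evL
    proof eventually_elim
      case (elim t)
      have pos: "a t - ?x > 0" using a_less[of s t] elim s by auto
      have "curve_length trace ?x (a t) \<le> ennreal (c * (a t - ?x))"
      proof (rule trace_length_le)
        fix z assume "?x \<le> z" "z < a t"
        then show "speed z \<le> c" using d(2)[of z] elim c(1) by (cases "z = ?x") auto
      qed (use pos c speed_pos[of ?x] in auto)
      then have "ennreal (t - s) \<le> ennreal (c * (a t - ?x))" using length_between[of s t] elim s by simp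
      then have "t - s \<le> c * (a t - ?x)" using pos c speed_pos[of ?x] by (subst (asm) ennreal_le_iff) auto
      also have "\<dots> < b * (a t - ?x)" using pos c by simp
      finally show ?case using pos by (simp add: pos_divide_less_eq)
    qed
  qed
  then have "((\<lambda>t. inverse ((t - s) / (a t - ?x))) \<longlongrightarrow> inverse (speed ?x)) (at_right s)"
    using speed_pos[of ?x] by (intro tendsto_inverse) auto
  then show ?thesis by (simp add: has_field_derivative_iff)
qed

end

context polar_profile
begin

text \<open>Invert the arc length function.\<close>
lemma exists_arc_length_azimuth: "\<exists>L a. arc_length_azimuth h p M L a \<and> a 0 = 0"
proof -
  define l where "l = (\<lambda>x. enn2real (curve_length trace 0 x))"
  have M: "0 \<le> 1 + M" using p_bound[of 0] by linarith
  have fin: "curve_length trace x y \<le> ennreal ((1 + M) * (y - x))" if "x \<le> y" for x y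
    using that M by (intro trace_length_le speed_le)
  have l: "curve_length trace 0 x = ennreal (l x)" if "0 \<le> x" for x
  proof -
    have "curve_length trace 0 x < top" using fin[OF that] by (rule le_less_trans) simp
    then show ?thesis by (simp add: l_def)
  qed
  have l0: "0 \<le> l x" for x by (simp add: l_def)
  have between: "curve_length trace x y = ennreal (l y - l x)" if "0 \<le> x" "x \<le> y" for x y
  proof -
    have "ennreal (l x) + curve_length trace x y = ennreal (l y)"
      using curve_length_add[of 0 x y trace] l[of x] l[of y] that by simp
    moreover from this have "l x \<le> l y"
      using l0 by (metis add_increasing2 ennreal_le_iff order_refl zero_le)
    moreover from this have "ennreal (l y) = ennreal (l x) + ennreal (l y - l x)"
      using l0 by (simp flip: ennreal_plus)
    ultimately show ?thesis by (simp add: ennreal_add_left_cancel)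
  qed
  have less: "l x < l y" if "0 \<le> x" "x < y" for x y
    using trace_length_pos[OF that(2)] between[of x y] that by (simp add: ennreal_eq_0_iff less_le)
  have lip: "dist (l x) (l y) \<le> (1 + M) * dist x y" if "0 \<le> x" "x \<le> y" for x y
  proof -
    have "ennreal (l y - l x) \<le> ennreal ((1 + M) * (y - x))" using fin[OF that(2)] between[OF that] by simp
    then have "l y - l x \<le> (1 + M) * (y - x)" using that M by (subst (asm) ennreal_le_iff) auto
    moreover have "l x \<le> l y" using less[of x y] that by (cases "x = y") auto
    ultimately show ?thesis using that by (simp add: dist_real_def)
  qed
  have "(1 + M)-lipschitz_on {0..2*pi} l"
  proof (rule lipschitz_onI[OF _ M])
    fix x y assume "x \<in> {0..2*pi}" "y \<in> {0..2*pi}"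
    then show "dist (l x) (l y) \<le> (1 + M) * dist x y"
      using lip[of x y] lip[of y x] by (cases "x \<le> y") (auto simp: dist_commute)
  qed
  then have cont: "continuous_on {0..2*pi} l" by (rule lipschitz_on_continuous_on)
  have zero: "l 0 = 0"
  proof -
    have "curve_length trace 0 0 \<le> ennreal 0" using fin[of 0 0] by simp
    then show ?thesis by (simp add: l_def)
  qed
  define L where "L = l (2 * pi)"
  define a where "a = the_inv_into {0..2*pi} l"
  have inj: "inj_on l {0..2*pi}"
    by (rule linorder_inj_onI) (use less in force)+
  have a_l: "a (l x) = x" if "x \<in> {0..2*pi}" for x
    using that inj by (simp add: a_def the_inv_into_f_f)
  have img: "l ` {0..2*pi} = {0..L}"
  proof (intro equalityI subsetI)
    fix y assume "y \<in> l ` {0..2*pi}"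
    then obtain x where x: "x \<in> {0..2*pi}" "y = l x" by blast
    then have "l x \<le> L" unfolding L_def using less[of x "2*pi"] by (cases "x = 2*pi") auto
    then show "y \<in> {0..L}" using x l0 by simp
  next
    fix y assume "y \<in> {0..L}"
    then have "\<exists>x\<ge>0. x \<le> 2*pi \<and> l x = y"
      by (intro IVT') (use zero cont in \<open>auto simp: L_def\<close>)
    then show "y \<in> l ` {0..2*pi}" by auto
  qed
  have a: "a s \<in> {0..2*pi} \<and> l (a s) = s" if "s \<in> {0..L}" for s
  proof -
    have "s \<in> l ` {0..2*pi}" unfolding img by (rule that)
    then obtain x where "x \<in> {0..2*pi}" "s = l x" by blast
    then show ?thesis by (simp add: a_l)
  qed
  have a0: "a 0 = 0" using a_l[of 0] zero by simp
  have aL: "a L = 2 * pi" using a_l[of "2*pi"] by (simp add: L_def)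
  have "arc_length_azimuth h p M L a"
  proof
    show "0 < L" using less[of 0 "2*pi"] zero by (simp add: L_def)
    have "continuous_on (l ` {0..2*pi}) a" using cont a_l by (intro continuous_on_inv) auto
    then show "continuous_on {0..L} a" unfolding img .
    show "a s < a t" if "0 \<le> s" "s < t" "t \<le> L" for s t
    proof (rule ccontr)
      assume "\<not> a s < a t"
      then have "l (a t) \<le> l (a s)" using less[of "a t" "a s"] a[of t] that by (cases "a t = a s") auto
      then show False using a[of s] a[of t] that by auto
    qed
    show "curve_length trace (a 0) (a s) = ennreal s" if "s \<in> {0..L}" for s
      using a[OF that] l[of "a s"] a0 by auto
    show "a L = a 0 + 2 * pi" using a0 aL by simp
  qed
  then show ?thesis using a0 by blast
qed

end

context arc_length_azimuth
begin

lemma a_limit: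
  assumes "0 < s" "s \<le> L" shows "(a \<longlongrightarrow> a s) (at_left s)"
  by (rule continuous_on_Icc_at_leftD[of 0]) (use assms in \<open>auto intro: continuous_on_subset[OF a_cont]\<close>)

text \<open>The minorant replaces the slope by that of the supporting plane at \<open>a s\<close>, see \<open>p_growth\<close>.\<close>
lemma slope_angle_rate:
  assumes s: "0 \<le> s" "s < L"
  shows "lower_right_rate (\<lambda>s. slope_angle (a s)) s (- (\<rho> (a s) * h (a s) / \<kappa> (a s)))"
proof -
  let ?x = "a s"
  let ?P = "\<lambda>t. cos (a t - ?x) * p ?x - sin (a t - ?x) * h ?x"
  let ?F = "\<lambda>t. arctan (?P t / \<rho> (a t))"
  let ?e = "inverse (speed ?x)"
  have r0: "\<rho> ?x \<noteq> 0" using \<rho>_pos[of ?x] by simp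
  have k0: "\<kappa> ?x \<noteq> 0" using \<kappa>_pos[of ?x] by simp
  have gt: "a s < a t" if "s < t" "t < L" for t using a_less[of s t] s that by auto
  have r: "((\<lambda>t. \<rho> (a t)) has_real_derivative h ?x * p ?x / \<rho> ?x * ?e) (at_right s)"
    by (rule right_derivative_chain[OF \<rho>_deriv a_deriv[OF s] gt s(2)])
  have P: "(?P has_real_derivative - (h ?x * ?e)) (at_right s)"
    by (rule derivative_eq_intros a_deriv[OF s] refl)+ simp
  have Q: "((\<lambda>t. ?P t / \<rho> (a t)) has_real_derivative
      (- (h ?x * ?e) * \<rho> ?x - p ?x * (h ?x * p ?x / \<rho> ?x * ?e)) / (\<rho> ?x * \<rho> ?x)) (at_right s)"
    using DERIV_divide[OF P r r0] by simp
  have "(?F has_real_derivative inverse (1 + (p ?x / \<rho> ?x)\<^sup>2) *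
      ((- (h ?x * ?e) * \<rho> ?x - p ?x * (h ?x * p ?x / \<rho> ?x * ?e)) / (\<rho> ?x * \<rho> ?x))) (at_right s)"
    using DERIV_chain2[OF DERIV_arctan Q] by simp
  moreover have "inverse (1 + (p ?x / \<rho> ?x)\<^sup>2) *
      ((- (h ?x * ?e) * \<rho> ?x - p ?x * (h ?x * p ?x / \<rho> ?x * ?e)) / (\<rho> ?x * \<rho> ?x)) = - (\<rho> ?x * h ?x / \<kappa> ?x)"
  proof -
    have 1: "1 + (p ?x / \<rho> ?x)\<^sup>2 = (\<kappa> ?x)\<^sup>2 / (\<rho> ?x)\<^sup>2"
      using r0 by (simp add: \<kappa>_sq add_divide_distrib power_divide)
    have "- (h ?x * ?e) * \<rho> ?x - p ?x * (h ?x * p ?x / \<rho> ?x * ?e) = - (h ?x * ?e) * ((\<rho> ?x)\<^sup>2 + (p ?x)\<^sup>2) / \<rho> ?x"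
    proof -
      have "- (H * E) * R - P * (H * P / R * E) = - (H * E) * (R\<^sup>2 + P\<^sup>2) / R" if "R \<noteq> 0" for H E P R :: real
        using that by (simp add: field_simps power2_eq_square)
      from this[OF r0] show ?thesis .
    qed
    also have "\<dots> = - (h ?x * ?e) * (\<kappa> ?x)\<^sup>2 / \<rho> ?x" by (simp add: \<kappa>_sq)
    finally have 2: "- (h ?x * ?e) * \<rho> ?x - p ?x * (h ?x * p ?x / \<rho> ?x * ?e) = - (h ?x * ?e) * (\<kappa> ?x)\<^sup>2 / \<rho> ?x" .
    show ?thesis unfolding 1 2 unfolding speed_def using r0 k0 by (simp add: power2_eq_square)
  qed
  ultimately have F: "(?F has_real_derivative - (\<rho> ?x * h ?x / \<kappa> ?x)) (at_right s)" by simp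
  have "\<forall>\<^sub>F y in at_right ?x. y < ?x + pi / 2" by (rule eventually_at_rightI[of _ "?x + pi/2"]) auto
  then have "\<forall>\<^sub>F t in at_right s. a t < ?x + pi / 2" using a_right_limit[OF s] by (auto simp: filterlim_iff)
  moreover have "\<forall>\<^sub>F t in at_right s. s < t \<and> t < L" by (rule eventually_at_rightI[of _ L]) (use s in auto)
  ultimately have "\<forall>\<^sub>F t in at_right s. ?F t \<le> slope_angle (a t)"
  proof eventually_elim
    case (elim t)
    then have "?P t \<le> p (a t)" using p_growth[of "a t - ?x" ?x] gt[of t] by simp
    then show ?case unfolding slope_angle_def using \<rho>_pos[of "a t"]
      by (intro arctan_monotone' divide_right_mono) auto
  qed
  then show ?thesis unfolding lower_right_rate_def using F
    by (intro exI[of _ ?F]) (simp add: slope_angle_def)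
qed

text \<open>Upper semicontinuity of the slope \<open>p\<close>, which is a right derivative of a convex function.\<close>
lemma slope_angle_jump:
  assumes s: "0 < s" "s \<le> L"
  shows "no_downward_jump (\<lambda>s. slope_angle (a s)) s"
  unfolding no_downward_jump_def
proof (intro allI impI)
  fix e :: real assume e: "e > 0"
  let ?x = "a s"
  note lim = a_limit[OF s]
  have "((\<lambda>y. arctan (y / \<rho> ?x)) \<longlongrightarrow> arctan (p ?x / \<rho> ?x)) (at_right (p ?x))"
    using \<rho>_pos[of ?x] by (intro tendsto_arctan tendsto_divide tendsto_ident_at tendsto_const) auto
  then have "\<forall>\<^sub>F y in at_right (p ?x). arctan (y / \<rho> ?x) < slope_angle ?x + e"
    using e by (intro order_tendstoD(2)) (auto simp: slope_angle_def)
  moreover have "\<forall>\<^sub>F y in at_right (p ?x). p ?x < y" by (rule eventually_at_rightI[of _ "p ?x + 1"]) auto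
  ultimately have "\<forall>\<^sub>F y in at_right (p ?x). arctan (y / \<rho> ?x) < slope_angle ?x + e \<and> p ?x < y" by eventually_elim simp
  then obtain y where y: "arctan (y / \<rho> ?x) < slope_angle ?x + e" "p ?x < y"
    using eventually_happens'[OF trivial_limit_at_right_real] by blast
  have "isCont \<rho> ?x" using \<rho>_cont by (simp add: continuous_on_eq_continuous_at)
  then have "((\<lambda>t. \<rho> (a t)) \<longlongrightarrow> \<rho> ?x) (at_left s)" using lim by (rule isCont_tendsto_compose)
  then have "((\<lambda>t. arctan (y / \<rho> (a t))) \<longlongrightarrow> arctan (y / \<rho> ?x)) (at_left s)"
    using \<rho>_pos[of ?x] by (intro tendsto_arctan tendsto_divide tendsto_const) auto
  then have 1: "\<forall>\<^sub>F t in at_left s. arctan (y / \<rho> (a t)) < slope_angle ?x + e" using y(1) by (rule order_tendstoD)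
  have 2: "\<forall>\<^sub>F t in at_left s. p (a t) < y"
  proof -
    have "\<forall>\<^sub>F z in nhds ?x. p z < y"
      using p_usc[OF y(2)] y(2) by (auto simp: eventually_at_filter elim: eventually_mono)
    then show ?thesis using lim by (auto simp: filterlim_iff)
  qed
  from 1 2 show "\<forall>\<^sub>F t in at_left s. slope_angle (a t) < slope_angle ?x + e"
  proof eventually_elim
    case (elim t)
    have "slope_angle (a t) \<le> arctan (y / \<rho> (a t))"
      unfolding slope_angle_def using elim \<rho>_pos[of "a t"] by (intro arctan_monotone' divide_right_mono) auto
    then show ?case using elim by simp
  qed
qed

lemma convex_arc: "convex_arc L a (\<lambda>s. gap (a s)) (\<lambda>s. slope_angle (a s))"
proof
  show "0 < gap (a s)" "gap (a s) \<le> 1" for s by (rule gap_pos gap_le_1)+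
  show "- (pi/2) < slope_angle (a s)" "slope_angle (a s) < pi/2" for s
    unfolding slope_angle_def using arctan_bounded by blast+
  show "continuous_on {0..L} (\<lambda>s. gap (a s))"
    using continuous_on_compose2[OF gap_cont a_cont] by simp
  show "\<exists>c>0. \<forall>s\<in>{0..L}. c \<le> cos (slope_angle (a s))"
  proof (intro exI conjI ballI)
    have M: "0 \<le> M" using p_bound[of 0] by linarith
    then show "0 < 1 / sqrt (1 + M\<^sup>2)" by (simp add: add_pos_nonneg)
    fix s
    have "\<bar>p (a s) / \<rho> (a s)\<bar> \<le> \<bar>p (a s)\<bar>"
      using \<rho>_ge_1[of "a s"] by (simp add: pos_divide_le_eq mult_le_cancel_left1 \<rho>_pos)
    then have "(p (a s) / \<rho> (a s))\<^sup>2 \<le> M\<^sup>2" using p_bound[of "a s"] by (intro abs_le_square_iff[THEN iffD1]) auto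
    then show "1 / sqrt (1 + M\<^sup>2) \<le> cos (slope_angle (a s))"
      unfolding slope_angle_def cos_arctan by (intro divide_left_mono) (auto simp: add_pos_nonneg)
  qed
  fix s assume s: "0 \<le> s" "s < L"
  have g0: "gap (a s) \<noteq> 0" and r0: "\<rho> (a s) \<noteq> 0" and k0: "\<kappa> (a s) \<noteq> 0"
    using gap_pos[of "a s"] \<rho>_pos[of "a s"] \<kappa>_pos[of "a s"] by simp_all
  have "cos (slope_angle (a s)) * (1 + (gap (a s))\<^sup>2) / (2 * gap (a s)) = inverse (speed (a s))"
    unfolding cos_slope one_plus_gap_sq speed_def using g0 by (simp add: power2_eq_square)
  then show "(a has_real_derivative cos (slope_angle (a s)) * (1 + (gap (a s))\<^sup>2) / (2 * gap (a s))) (at_right s)"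
    using a_deriv[OF s] by simp
  have gt: "a s < a t" if "s < t" "t < L" for t using a_less[of s t] s that by auto
  have d: "((\<lambda>s. gap (a s)) has_real_derivative - gap (a s) * p (a s) / \<rho> (a s) * inverse (speed (a s))) (at_right s)"
    by (rule right_derivative_chain[OF gap_deriv a_deriv[OF s] gt s(2)])
  have "- gap (a s) * p (a s) / \<rho> (a s) * inverse (speed (a s)) = - sin (slope_angle (a s)) * (1 + (gap (a s))\<^sup>2) / 2"
    unfolding sin_slope one_plus_gap_sq speed_def using r0 k0 by (simp add: power2_eq_square)
  then show "((\<lambda>s. gap (a s)) has_real_derivative - sin (slope_angle (a s)) * (1 + (gap (a s))\<^sup>2) / 2) (at_right s)"
    by (rule DERIV_cong[OF d])
  have "- cos (slope_angle (a s)) * (1 - (gap (a s))\<^sup>2) / (2 * gap (a s)) = - (\<rho> (a s) * h (a s) / \<kappa> (a s))"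
    unfolding cos_slope one_minus_gap_sq using g0 by simp
  then show "lower_right_rate (\<lambda>s. slope_angle (a s)) s (- cos (slope_angle (a s)) * (1 - (gap (a s))\<^sup>2) / (2 * gap (a s)))"
    using slope_angle_rate[OF s] by simp
next
  show "no_downward_jump (\<lambda>s. slope_angle (a s)) s" if "0 < s" "s \<le> L" for s
    using that by (rule slope_angle_jump)
  show "gap (a L) = gap (a 0)" "slope_angle (a L) = slope_angle (a 0)"
    unfolding a_closing gap_def slope_angle_def \<rho>_def by (simp_all add: h_periodic p_periodic)
qed (use L_pos a_cont a_closing in auto)

end

section \<open>Solid cones around the vertical axis\<close>

text \<open>Such a cone is the region above the graph of a sublinear function \<open>H\<close> on the horizontal plane.\<close>
locale upward_cone =
  fixes S :: "(complex \<times> real) set"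
  assumes closed_S: "closed S" and cone_S: "convex_cone S"
    and axis_inside: "(0, 1) \<in> interior S"
    and snd_nonneg: "x \<in> S \<Longrightarrow> 0 \<le> snd x"
begin

lemmas scale = convex_cone_scaleR[OF cone_S]
lemmas add = convex_cone_add[OF cone_S]

definition H :: "complex \<Rightarrow> real" where "H w = Inf {h. (w, h) \<in> S}"

lemma bounded_by_norm: "\<exists>M\<ge>0. \<forall>w. (w, M * norm w) \<in> S"
proof -
  obtain e where e: "e > 0" "cball (0, 1) e \<subseteq> S" using axis_inside mem_interior_cball by blast
  have "(w, norm w / e) \<in> S" for w :: complex
  proof (cases "w = 0")
    case True
    then show ?thesis using convex_cone_contains_0[OF cone_S] by (simp add: zero_prod_def[symmetric])
  next
    case False
    have "((e / norm w) *\<^sub>R w, 1) \<in> cball (0, 1) e"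
      using e(1) False by (simp add: dist_Pair_Pair)
    then have "(norm w / e) *\<^sub>R ((e / norm w) *\<^sub>R w, 1::real) \<in> S"
      using e by (intro scale) auto
    moreover have "norm w / e * (e / norm w) = 1" using e(1) False by simp
    ultimately show ?thesis by simp
  qed
  then show ?thesis using e(1) by (intro exI[of _ "inverse e"]) (auto simp: divide_inverse_commute)
qed

lemma fiber_nonempty: "{h. (w, h) \<in> S} \<noteq> {}" using bounded_by_norm by blast

lemma fiber_bdd: "bdd_below {h. (w, h) \<in> S}"
  by (rule bdd_belowI[of _ 0]) (use snd_nonneg in force)

lemma H_le: "(w, h) \<in> S \<Longrightarrow> H w \<le> h"
  unfolding H_def using fiber_bdd by (intro cInf_lower) auto

lemma H_in: "(w, H w) \<in> S"
proof -
  have "{h. (w, h) \<in> S} = Pair w -` S" by auto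
  moreover have "closed (Pair w -` S)"
    by (rule continuous_closed_vimage[OF closed_S]) (intro continuous_intros)
  ultimately have "H w \<in> {h. (w, h) \<in> S}"
    unfolding H_def by (intro closed_contains_Inf fiber_nonempty fiber_bdd) simp
  then show ?thesis by simp
qed

lemma axis_in: "(0, 1) \<in> S" using axis_inside interior_subset by blast

lemma in_S_iff: "(w, h) \<in> S \<longleftrightarrow> H w \<le> h"
proof
  assume "H w \<le> h"
  then have "(w, H w) + (h - H w) *\<^sub>R (0, 1) \<in> S" by (intro add H_in scale axis_in) simp
  then show "(w, h) \<in> S" by simp
qed (rule H_le)

lemma H_nonneg: "0 \<le> H w" using snd_nonneg[OF H_in[of w]] by simp

lemma H_add: "H (v + w) \<le> H v + H w"
  using add[OF H_in[of v] H_in[of w]] by (simp add: in_S_iff)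

lemma H_scale: assumes "0 \<le> c" shows "H (c *\<^sub>R w) = c * H w"
proof (rule antisym)
  show "H (c *\<^sub>R w) \<le> c * H w" using scale[OF assms H_in[of w]] by (simp add: in_S_iff)
  show "c * H w \<le> H (c *\<^sub>R w)"
  proof (cases "c = 0")
    case True then show ?thesis by (simp add: H_nonneg)
  next
    case False
    then have c: "0 < c" using assms by simp
    have "inverse c *\<^sub>R (c *\<^sub>R w, H (c *\<^sub>R w)) \<in> S" using c by (intro scale H_in) simp
    then have "H w \<le> inverse c * H (c *\<^sub>R w)" using c by (simp add: in_S_iff)
    then have "c * H w \<le> c * (inverse c * H (c *\<^sub>R w))" using c by (intro mult_left_mono) auto
    also have "c * (inverse c * H (c *\<^sub>R w)) = H (c *\<^sub>R w)" using c by simp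
    finally show ?thesis .
  qed
qed

lemma H_bound: "\<exists>M\<ge>0. \<forall>w. H w \<le> M * norm w"
  using bounded_by_norm by (simp add: in_S_iff)

lemma H_cont: "continuous_on UNIV H"
proof -
  obtain M where M: "M \<ge> 0" "\<And>w. H w \<le> M * norm w" using H_bound by blast
  have "H v - H w \<le> M * dist v w" for v w
    using H_add[of w "v - w"] M(2)[of "v - w"] by (simp add: dist_norm)
  then have "dist (H v) (H w) \<le> M * dist v w" for v w
    by (metis abs_le_iff dist_commute dist_real_def minus_diff_eq)
  then have "M-lipschitz_on UNIV H" by (intro lipschitz_onI M(1)) auto
  then show ?thesis by (rule lipschitz_on_continuous_on)
qed

lemma frontier_iff: "x \<in> frontier S \<longleftrightarrow> snd x = H (fst x)"
proof
  assume "x \<in> frontier S"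
  then have x: "x \<in> S" "x \<notin> interior S" using closed_S by (auto simp: frontier_def)
  have "H (fst x) \<le> snd x" using x(1) in_S_iff[of "fst x" "snd x"] by simp
  moreover have "\<not> H (fst x) < snd x"
  proof
    assume less: "H (fst x) < snd x"
    have open_set: "open {y. H (fst y) < snd y}"
      by (intro open_Collect_less continuous_intros continuous_on_compose2[OF H_cont]) auto
    have "{y. H (fst y) < snd y} \<subseteq> S" using in_S_iff by force
    then have "x \<in> interior S" using open_set less by (auto intro: interiorI)
    then show False using x(2) by simp
  qed
  ultimately show "snd x = H (fst x)" by simp
next
  assume eq: "snd x = H (fst x)"
  then have "x \<in> S" using H_in[of "fst x"] by (metis prod.collapse)
  moreover have "x \<notin> interior S"
  proof
    assume "x \<in> interior S"
    then obtain e where e: "e > 0" "cball x e \<subseteq> S" using mem_interior_cball by blast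
    have "(fst x, snd x - e) \<in> cball x e" using e(1) by (cases x) (simp add: dist_Pair_Pair dist_real_def)
    then have "H (fst x) \<le> snd x - e" using e(2) in_S_iff by blast
    then show False using e(1) eq by simp
  qed
  ultimately show "x \<in> frontier S" using closed_S by (simp add: frontier_def)
qed

text \<open>The slope is the right derivative of \<open>H\<close> along the tangent of the unit circle, written as an infimum because
the difference quotients of a convex function are monotone.\<close>
definition circle_height :: "real \<Rightarrow> real" where "circle_height x = H (cis x)"
definition slope_quotient :: "real \<Rightarrow> real \<Rightarrow> real" where "slope_quotient x e = (H (cis x + e *\<^sub>R (\<i> * cis x)) - H (cis x)) / e"
definition circle_slope :: "real \<Rightarrow> real" where "circle_slope x = Inf (slope_quotient x ` {0<..})"

lemma slope_quotient_ge:
  assumes "0 < d" "0 < e"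
  shows "(H (cis x) - H (cis x - d *\<^sub>R (\<i> * cis x))) / d \<le> slope_quotient x e"
proof -
  let ?v = "\<i> * cis x"
  have "e *\<^sub>R (cis x - d *\<^sub>R ?v) + d *\<^sub>R (cis x + e *\<^sub>R ?v) = (d + e) *\<^sub>R cis x"
    by (simp add: algebra_simps)
  then have "(d + e) * H (cis x) \<le> e * H (cis x - d *\<^sub>R ?v) + d * H (cis x + e *\<^sub>R ?v)"
    using H_add[of "e *\<^sub>R (cis x - d *\<^sub>R ?v)" "d *\<^sub>R (cis x + e *\<^sub>R ?v)"] assms
    by (simp add: H_scale)
  then have "e * (H (cis x) - H (cis x - d *\<^sub>R ?v)) \<le> d * (H (cis x + e *\<^sub>R ?v) - H (cis x))"
    by (simp add: algebra_simps)
  then show ?thesis unfolding slope_quotient_def using assms by (simp add: divide_simps mult.commute)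
qed

lemma slope_quotient_bdd: "bdd_below (slope_quotient x ` {0<..})"
  using slope_quotient_ge[of 1] by (intro bdd_belowI2) auto

lemma circle_slope_le: "0 < e \<Longrightarrow> circle_slope x \<le> slope_quotient x e"
  unfolding circle_slope_def using slope_quotient_bdd by (intro cInf_lower) auto

lemma circle_slope_ge: "0 < d \<Longrightarrow> (H (cis x) - H (cis x - d *\<^sub>R (\<i> * cis x))) / d \<le> circle_slope x"
  unfolding circle_slope_def using slope_quotient_ge by (intro cInf_greatest) auto

text \<open>The line through the point over \<open>cis x\<close> with slope \<open>circle_slope x\<close> supports the graph of \<open>H\<close> over the
tangent of the unit circle. The point \<open>cis (x + e)\<close> is a multiple of a point on this tangent, so
homogeneity of \<open>H\<close> transfers the estimate to the circle.\<close>
lemma line_support: "H (cis x) + t * circle_slope x \<le> H (cis x + t *\<^sub>R (\<i> * cis x))"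
proof (cases t "0::real" rule: linorder_cases)
  case less
  have "(H (cis x) - H (cis x - (- t) *\<^sub>R (\<i> * cis x))) / (- t) \<le> circle_slope x" using less by (intro circle_slope_ge) simp
  then have "H (cis x) - H (cis x - (- t) *\<^sub>R (\<i> * cis x)) \<le> circle_slope x * (- t)"
    using less by (subst (asm) pos_divide_le_eq) auto
  then show ?thesis by (simp add: algebra_simps)
next
  case greater
  then show ?thesis using circle_slope_le[of t x] by (simp add: slope_quotient_def pos_le_divide_eq algebra_simps)
qed simp

lemma cis_add_tan: "cos e \<noteq> 0 \<Longrightarrow> cis (x + e) = cos e *\<^sub>R (cis x + tan e *\<^sub>R (\<i> * cis x))"
  by (simp add: complex_eq_iff cos_add sin_add tan_def algebra_simps)

lemma profile: "\<exists>M. polar_profile circle_height circle_slope M"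
proof -
  obtain M where M: "M \<ge> 0" "\<And>w. H w \<le> M * norm w" using H_bound by blast
  have "polar_profile circle_height circle_slope M"
  proof
    fix x
    show "0 \<le> circle_height x" by (simp add: circle_height_def H_nonneg)
    have "circle_slope x \<le> slope_quotient x 1" by (rule circle_slope_le) simp
    also have "\<dots> \<le> H (\<i> * cis x)" using H_add[of "cis x" "\<i> * cis x"] by (simp add: slope_quotient_def)
    also have "\<dots> \<le> M" using M(2)[of "\<i> * cis x"] by (simp add: norm_mult)
    finally have up: "circle_slope x \<le> M" .
    have "- M \<le> - H (- (\<i> * cis x))" using M(2)[of "- (\<i> * cis x)"] by (simp add: norm_mult)
    also have "\<dots> \<le> H (cis x) - H (cis x - \<i> * cis x)" using H_add[of "cis x" "- (\<i> * cis x)"] by simp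
    also have "\<dots> \<le> circle_slope x" using circle_slope_ge[of 1 x] by simp
    finally show "\<bar>circle_slope x\<bar> \<le> M" using up by (simp add: abs_le_iff)
    have per: "cis (x + 2 * pi) = cis x" by (simp add: cis_mult[symmetric])
    show "circle_height (x + 2 * pi) = circle_height x" by (simp only: circle_height_def per)
    show "circle_slope (x + 2 * pi) = circle_slope x" by (simp only: circle_slope_def slope_quotient_def[abs_def] per)
    show "cos e * circle_height x + sin e * circle_slope x \<le> circle_height (x + e)" if "\<bar>e\<bar> < pi / 2" for e
    proof -
      have c: "cos e > 0" using that by (intro cos_gt_zero_pi) (auto simp: abs_less_iff)
      have "circle_height (x + e) = cos e * H (cis x + tan e *\<^sub>R (\<i> * cis x))"
        unfolding circle_height_def using c by (subst cis_add_tan) (auto simp: H_scale)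
      moreover have "cos e * (H (cis x) + tan e * circle_slope x) \<le> cos e * H (cis x + tan e *\<^sub>R (\<i> * cis x))"
        using c by (intro mult_left_mono line_support) simp
      moreover have "cos e * (H (cis x) + tan e * circle_slope x) = cos e * circle_height x + sin e * circle_slope x"
        using c by (simp add: circle_height_def tan_def algebra_simps)
      ultimately show ?thesis by simp
    qed
    show "\<forall>\<^sub>F y in at x. circle_slope y < b" if "circle_slope x < b" for b
    proof -
      obtain e where e: "0 < e" "slope_quotient x e < b"
      proof -
        have "slope_quotient x ` {0<..} \<noteq> {}" by simp
        from cInf_lessD[OF this] obtain z where "z \<in> slope_quotient x ` {0<..}" "z < b"
          using \<open>circle_slope x < b\<close> unfolding circle_slope_def by blast
        with that show ?thesis by auto
      qed
      have "continuous_on UNIV (\<lambda>y. slope_quotient y e)"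
        unfolding slope_quotient_def using e(1)
        by (intro continuous_intros continuous_on_compose2[OF H_cont]) auto
      then have "((\<lambda>y. slope_quotient y e) \<longlongrightarrow> slope_quotient x e) (at x)" by (simp add: continuous_on)
      then have "\<forall>\<^sub>F y in at x. slope_quotient y e < b" using e(2) by (rule order_tendstoD)
      then show ?thesis
      proof eventually_elim
        case (elim y)
        then show ?case using circle_slope_le[OF e(1), of y] by simp
      qed
    qed
    show "continuous_on UNIV circle_height"
      unfolding circle_height_def[abs_def] by (intro continuous_intros continuous_on_compose2[OF H_cont]) auto
  qed
  then show ?thesis ..
qed

end

text \<open>An injective continuous function on an interval is strictly monotone; the value at the midpoint decides the
direction, and continuity extends it to the right end.\<close>
lemma strict_mono_if_injective_on_half_open:
  fixes b :: "real \<Rightarrow> real"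
  assumes L: "0 < L" and cont: "continuous_on {0..L} b" and inj: "inj_on b {0..<L}" and start: "b 0 < b (L / 2)"
    and st: "0 \<le> s" "s < t" "t \<le> L"
  shows "b s < b t"
proof -
  have mono: "(b 0 < b x \<and> b x < b u) \<or> (b u < b x \<and> b x < b 0)" if "0 < x" "x < u" "u < L" for x u
    using that by (intro continuous_inj_imp_mono continuous_on_subset[OF cont] inj_on_subset[OF inj]) auto
  have pos: "b 0 < b x" if x: "0 < x" "x < L" for x
  proof -
    define u where "u = (max x (L/2) + L) / 2"
    have u: "x < u" "L/2 < u" "u < L" using x L by (auto simp: u_def max_def)
    then have "b 0 < b u" using mono[of "L/2" u] start L by auto
    then show ?thesis using mono[of x u] u x by auto
  qed
  have less: "b x < b y" if "0 \<le> x" "x < y" "y < L" for x y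
  proof (cases "x = 0")
    case True then show ?thesis using pos[of y] that by simp
  next
    case False then show ?thesis using mono[of x y] pos[of y] that by auto
  qed
  show ?thesis
  proof (cases "t = L")
    case True
    define m where "m = (s + L) / 2"
    have m: "s < m" "m < L" using st True by (auto simp: m_def)
    have "(b \<longlongrightarrow> b L) (at_left L)" using cont L by (rule continuous_on_Icc_at_leftD)
    moreover have "\<forall>\<^sub>F x in at_left L. b m \<le> b x"
    proof (rule eventually_at_leftI)
      fix x assume "x \<in> {m<..<L}" then show "b m \<le> b x" using less[of m x] m st by auto
    qed (rule m(2))
    ultimately have "b m \<le> b L" by (rule tendsto_lowerbound) simp
    moreover have "b s < b m" using less[of s m] m st by simp
    ultimately show ?thesis using True by simp
  next
    case False then show ?thesis using less[of s t] st by simp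
  qed
qed

text \<open>A choice of bound for the slopes makes \<open>upward_cone\<close> an instance of \<open>polar_profile\<close>.\<close>
definition (in upward_cone) bound :: real where "bound = (SOME M. polar_profile circle_height circle_slope M)"

sublocale upward_cone \<subseteq> polar_profile circle_height circle_slope bound
  unfolding bound_def using profile by (rule someI_ex)

context upward_cone
begin

lemma trace_unit: "norm (trace x) = 1"
proof -
  have "(norm (trace x))\<^sup>2 = (inverse (\<rho> x))\<^sup>2 * (1 + (circle_height x)\<^sup>2)"
    using \<rho>_pos[of x] by (simp add: trace_def norm_Pair power_divide power_mult_distrib algebra_simps divide_inverse)
  also have "\<dots> = 1" using \<rho>_pos[of x] by (simp add: \<rho>_sq[symmetric] flip: power_mult_distrib)
  finally show ?thesis by (simp add: power2_eq_1_iff norm_ge_zero) (metis norm_ge_zero not_one_le_zero neg_0_le_iff_le)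
qed

lemma trace_in_frontier: "trace x \<in> frontier S"
proof -
  have "H (cis x /\<^sub>R \<rho> x) = circle_height x / \<rho> x" using \<rho>_pos[of x] by (simp add: H_scale circle_height_def divide_inverse_commute)
  then show ?thesis by (simp add: frontier_iff trace_def)
qed

lemma unit_frontier_point:
  assumes "x \<in> frontier S" "norm x = 1"
  shows "fst x \<noteq> 0" "cis t = fst x /\<^sub>R norm (fst x) \<Longrightarrow> x = trace t"
proof -
  have sx: "snd x = H (fst x)" using assms(1) frontier_iff by simp
  show nz: "fst x \<noteq> 0"
  proof
    assume "fst x = 0"
    moreover have "H 0 = 0" using H_scale[of 0 0] by simp
    ultimately have "x = 0" using sx by (simp add: prod_eq_iff)
    then show False using assms(2) by simp
  qed
  assume t: "cis t = fst x /\<^sub>R norm (fst x)"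
  define r where "r = norm (fst x)"
  have r: "r > 0" using nz by (simp add: r_def)
  have fx: "fst x = r *\<^sub>R cis t" using t r by (simp add: r_def)
  have hx: "snd x = r * circle_height t" using sx r by (simp add: fx H_scale circle_height_def)
  have "(norm x)\<^sup>2 = r\<^sup>2 + (r * circle_height t)\<^sup>2"
    using hx by (cases x) (simp add: norm_Pair r_def)
  also have "\<dots> = (r * \<rho> t)\<^sup>2" by (simp add: \<rho>_sq power_mult_distrib algebra_simps)
  finally have "(r * \<rho> t)\<^sup>2 = 1\<^sup>2" using assms(2) by simp
  then have "r * \<rho> t = 1" using r \<rho>_pos[of t] by (subst (asm) power2_eq_iff_nonneg) auto
  then have "r = inverse (\<rho> t)" using \<rho>_pos[of t] by (simp add: field_simps)
  then show "x = trace t" using fx hx by (simp add: trace_def prod_eq_iff divide_inverse_commute)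
qed

lemma trace_cis: "cis s = cis t \<Longrightarrow> trace s = trace t"
  by (simp add: trace_def \<rho>_def circle_height_def)

end

text \<open>An arc length parametrization of the unit section, of either orientation and with any starting point.\<close>
locale unit_section = upward_cone +
  fixes L :: real and r :: "real \<Rightarrow> complex \<times> real"
  assumes L_pos: "0 < L"
    and r_unit: "s \<in> {0..L} \<Longrightarrow> r s \<in> frontier S \<and> norm (r s) = 1"
    and r_closed: "r L = r 0"
    and r_inj: "inj_on r {0..<L}"
    and r_length: "s \<in> {0..L} \<Longrightarrow> curve_length r 0 s = ennreal s"
begin

lemma r_cont: "continuous_on {0..L} r"
proof -
  have le: "dist (r s) (r t) \<le> t - s" if "0 \<le> s" "s \<le> t" "t \<le> L" for s t
  proof -
    have "ennreal s + curve_length r s t = ennreal t"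
      using curve_length_add[of 0 s t r] r_length[of s] r_length[of t] that by auto
    also have "\<dots> = ennreal s + ennreal (t - s)" using that by (simp flip: ennreal_plus)
    finally have "curve_length r s t = ennreal (t - s)" by (simp add: ennreal_add_left_cancel)
    then have "ennreal (dist (r s) (r t)) \<le> ennreal (t - s)"
      using dist_le_curve_length[of s s t t r] that by simp
    then show ?thesis using that by (subst (asm) ennreal_le_iff) auto
  qed
  have "1-lipschitz_on {0..L} r"
  proof (rule lipschitz_onI)
    fix s t assume "s \<in> {0..L}" "t \<in> {0..L}"
    then show "dist (r s) (r t) \<le> 1 * dist s t"
      using le[of s t] le[of t s] by (cases "s \<le> t") (auto simp: dist_real_def dist_commute)
  qed simp
  then show ?thesis by (rule lipschitz_on_continuous_on)
qed

lemma arc_length_azimuth_if_increasing: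
  assumes cont: "continuous_on {0..L} b" and eq: "\<And>s. s \<in> {0..L} \<Longrightarrow> r s = trace (b s)"
    and start: "b 0 < b (L / 2)"
  shows "arc_length_azimuth circle_height circle_slope bound L b"
proof
  have inj: "inj_on b {0..<L}"
    using r_inj eq by (intro inj_onI) (metis atLeastAtMost_iff atLeastLessThan_iff inj_onD less_imp_le)
  show less: "b s < b t" if "0 \<le> s" "s < t" "t \<le> L" for s t
    by (rule strict_mono_if_injective_on_half_open[OF L_pos cont inj start that])
  show "curve_length trace (b 0) (b s) = ennreal s" if "s \<in> {0..L}" for s
  proof -
    have "curve_length (\<lambda>x. trace (b x)) 0 s = curve_length trace (b 0) (b s)"
      using that by (intro curve_length_reparam continuous_on_subset[OF cont] less) auto
    moreover have "curve_length r 0 s = curve_length (\<lambda>x. trace (b x)) 0 s"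
      using that by (intro curve_length_cong eq) auto
    ultimately show ?thesis using r_length[OF that] by simp
  qed
  show "b L = b 0 + 2 * pi"
  proof (rule antisym)
    have bL: "b 0 < b L" using less[of 0 L] L_pos by simp
    show "b 0 + 2 * pi \<le> b L"
    proof (rule ccontr)
      assume "\<not> b 0 + 2 * pi \<le> b L"
      then have "trace (b 0) \<noteq> trace (b L)" using bL by (intro trace_arc_injective) auto
      then show False using eq[of 0] eq[of L] r_closed L_pos by simp
    qed
    show "b L \<le> b 0 + 2 * pi"
    proof (rule ccontr)
      assume n: "\<not> b L \<le> b 0 + 2 * pi"
      then obtain s where s: "0 \<le> s" "s \<le> L" "b s = b 0 + 2 * pi"
        using IVT'[of b 0 "b 0 + 2 * pi" L] cont L_pos by auto
      have "s \<noteq> 0" "s \<noteq> L" using s(3) n by auto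
      then have sI: "s \<in> {0..<L}" "0 \<in> {0..<L}" using s L_pos by auto
      have "trace (b s) = trace (b 0)" unfolding s(3) by (rule trace_cis) (simp add: cis_mult[symmetric])
      then have "r s = r 0" using eq[of s] eq[of 0] s L_pos by simp
      then have "s = 0" using r_inj sI by (auto dest: inj_onD)
      then show False using \<open>s \<noteq> 0\<close> by simp
    qed
  qed
qed (use L_pos cont in auto)

text \<open>A continuous logarithm of the horizontal part.\<close>
lemma azimuth_lift:
  "\<exists>b. continuous_on {0..L} b \<and> (\<forall>s\<in>{0..L}. r s = trace (b s)) \<and> b 0 \<noteq> b (L / 2)"
proof -
  let ?c = "\<lambda>s. fst (r s) /\<^sub>R norm (fst (r s))"
  have nz: "fst (r s) \<noteq> 0" if "s \<in> {0..L}" for s using r_unit[OF that] unit_frontier_point(1) by blast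
  have "continuous_on {0..L} ?c" using nz by (intro continuous_intros r_cont) auto
  moreover have "contractible {0..L}" by (rule convex_imp_contractible) simp
  ultimately obtain k where k: "continuous_on {0..L} k" "\<And>s. s \<in> {0..L} \<Longrightarrow> ?c s = exp (k s)"
    by (rule continuous_logarithm_on_contractible) (use nz in auto)
  define b where "b = (\<lambda>s. Im (k s))"
  have cont: "continuous_on {0..L} b" unfolding b_def by (intro continuous_intros k)
  have eq: "r s = trace (b s)" if "s \<in> {0..L}" for s
  proof (rule unit_frontier_point(2))
    have "norm (?c s) = 1" using nz[OF that] by simp
    then have "exp (Re (k s)) = 1" using k(2)[OF that] by simp
    then show "cis (b s) = ?c s" using k(2)[OF that] by (simp add: b_def exp_eq_polar)
  qed (use r_unit[OF that] in auto)
  have "r 0 \<noteq> r (L / 2)" using r_inj L_pos by (auto dest: inj_onD)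
  then have "b 0 \<noteq> b (L / 2)" using eq[of 0] eq[of "L/2"] L_pos by auto
  then show ?thesis using cont eq by blast
qed

end

text \<open>A reflection that reverses the orientation of azimuths.\<close>
definition flip :: "complex \<times> real \<Rightarrow> complex \<times> real" where "flip x = (cnj (fst x), snd x)"

lemma flip_flip [simp]: "flip (flip x) = x" by (simp add: flip_def)
lemma linear_flip: "linear flip" by (rule linearI) (auto simp: flip_def)
lemma bij_flip: "bij flip" by (rule o_bij[of flip]) auto
lemma inner_flip: "flip x \<bullet> flip y = x \<bullet> y" by (simp add: flip_def inner_prod_def inner_complex_def)
lemma euclidean_iso_flip: "euclidean_iso flip"
  by (simp add: euclidean_iso_def linear_flip bij_flip inner_flip)

lemmas norm_flip = euclidean_iso_norm[OF euclidean_iso_flip]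
lemmas frontier_flip = frontier_euclidean_iso[OF euclidean_iso_flip]
lemmas curve_length_flip = curve_length_isometry[of flip, OF euclidean_iso_dist[OF euclidean_iso_flip]]

lemma (in upward_cone) upward_cone_flip: "upward_cone (flip ` S)"
proof
  show "closed (flip ` S)" using closed_S linear_flip bij_flip
    by (metis bij_def closed_injective_linear_image)
  show "convex_cone (flip ` S)" using cone_S linear_flip by (intro convex_cone_linear_image conjI)
  have "flip (0, 1) \<in> flip ` interior S" using axis_inside by (rule imageI)
  then show "(0, 1) \<in> interior (flip ` S)"
    using interior_euclidean_iso[OF euclidean_iso_flip, of S] by (simp add: flip_def)
  show "0 \<le> snd x" if "x \<in> flip ` S" for x using that snd_nonneg by (auto simp: flip_def)
qed

lemma (in unit_section) unit_section_flip: "unit_section (flip ` S) L (\<lambda>s. flip (r s))"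
proof (intro unit_section.intro upward_cone_flip unit_section_axioms.intro)
  show "flip (r s) \<in> frontier (flip ` S) \<and> norm (flip (r s)) = 1" if "s \<in> {0..L}" for s
    using r_unit[OF that] by (simp add: frontier_flip norm_flip)
  show "inj_on (\<lambda>s. flip (r s)) {0..<L}"
    using r_inj by (intro inj_onI) (metis flip_flip inj_onD)
qed (use L_pos r_closed r_length in \<open>auto simp: curve_length_flip\<close>)

lemma (in upward_cone) trace_flip: "polar_profile.trace (upward_cone.circle_height (flip ` S)) (- x) = flip (trace x)"
proof -
  interpret F: upward_cone "flip ` S" by (rule upward_cone_flip)
  show ?thesis
  proof (rule sym, rule F.unit_frontier_point(2))
    show "flip (trace x) \<in> frontier (flip ` S)" using trace_in_frontier by (simp add: frontier_flip)
    show "norm (flip (trace x)) = 1" by (simp add: norm_flip trace_unit)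
    show "cis (- x) = fst (flip (trace x)) /\<^sub>R norm (fst (flip (trace x)))"
      using \<rho>_pos[of x] by (simp add: flip_def trace_def cis_cnj)
  qed
qed

text \<open>If the azimuth decreases, that of the reflected cone increases.\<close>
lemma (in unit_section) oriented_azimuth:
  "(\<exists>b. arc_length_azimuth circle_height circle_slope bound L b \<and> (\<forall>s\<in>{0..L}. r s = trace (b s))) \<or>
   (\<exists>b. arc_length_azimuth (upward_cone.circle_height (flip ` S)) (upward_cone.circle_slope (flip ` S)) (upward_cone.bound (flip ` S)) L b \<and>
      (\<forall>s\<in>{0..L}. flip (r s) = polar_profile.trace (upward_cone.circle_height (flip ` S)) (b s)))"
proof -
  obtain b where b: "continuous_on {0..L} b" "\<And>s. s \<in> {0..L} \<Longrightarrow> r s = trace (b s)" "b 0 \<noteq> b (L / 2)"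
    using azimuth_lift by blast
  show ?thesis
  proof (cases "b 0 < b (L / 2)")
    case True
    then show ?thesis using arc_length_azimuth_if_increasing[OF b(1,2)] b(2) by blast
  next
    case False
    interpret F: unit_section "flip ` S" L "\<lambda>s. flip (r s)" by (rule unit_section_flip)
    have eq: "flip (r s) = F.trace (- b s)" if "s \<in> {0..L}" for s
      using b(2)[OF that] trace_flip by simp
    have "arc_length_azimuth F.circle_height F.circle_slope F.bound L (\<lambda>s. - b s)"
      using b(1,3) False eq by (intro F.arc_length_azimuth_if_increasing continuous_on_minus) auto
    then show ?thesis using eq by (intro disjI2 exI[of _ "\<lambda>s. - b s"]) blast
  qed
qed

section \<open>Balancing by a rotation or a reflection\<close>

definition rot :: "real \<Rightarrow> complex \<times> real \<Rightarrow> complex \<times> real" where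
  "rot d x = (cis d * fst x, snd x)"

lemma linear_rot: "linear (rot d)" by (rule linearI) (auto simp: rot_def algebra_simps)
lemma rot_rot: "rot d (rot e x) = rot (d + e) x" by (simp add: rot_def cis_mult flip: mult.assoc)
lemma bij_rot: "bij (rot d)" by (rule o_bij[of "rot (- d)"]) (auto simp: rot_rot fun_eq_iff, simp_all add: rot_def)

lemma inner_rot: "rot d x \<bullet> rot d y = x \<bullet> y"
proof -
  have "(cos d * a - sin d * b) * (cos d * a' - sin d * b') + (cos d * b + sin d * a) * (cos d * b' + sin d * a') = a * a' + b * b'" for a b a' b' :: real
    using sin_cos_squared_add[of d] by algebra
  from this[of "Re (fst x)" "Im (fst x)" "Re (fst y)" "Im (fst y)"]
  show ?thesis by (simp add: rot_def inner_prod_def inner_complex_def add.commute)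
qed

lemma euclidean_iso_rot: "euclidean_iso (rot d)"
  by (simp add: euclidean_iso_def linear_rot bij_rot inner_rot)

lemma rot_sphere_point: "rot d (sphere_point a g) = sphere_point (a + d) g"
  by (simp add: rot_def sphere_point_def cis_mult[symmetric] mult.commute)

text \<open>Shifting the azimuth of the second arc by \<open>2 * d\<close> adds \<open>d\<close> to the twist. The isometry \<open>J\<close> only carries the
result from coordinates to the ambient space.\<close>
lemma exists_balancing_rotation_of_arcs:
  assumes arc1: "convex_arc L a1 g1 q1" and arc2: "convex_arc L a2 g2 q2"
    and ne: "\<And>s. s \<in> {0..L} \<Longrightarrow> \<not> (g1 s = 1 \<and> g2 s = 1)"
  shows "\<exists>d. \<forall>J :: complex \<times> real \<Rightarrow> real^3. euclidean_iso J \<longrightarrow> strictly_convex_cone_surface 0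
     (cone_over L (\<lambda>s. J (sphere_point (a1 s) (g1 s)) + J (rot d (sphere_point (a2 s) (g2 s)))))"
proof -
  interpret P: convex_arc_pair L a1 g1 q1 a2 g2 q2 using arc1 arc2 by (rule convex_arc_pair.intro)
  obtain d where d: "\<And>s. s \<in> {0..L} \<Longrightarrow> \<bar>P.twist s s + d\<bar> < pi / 2" using P.exists_balancing_rotation by blast
  have arc2': "convex_arc L (\<lambda>s. a2 s + 2 * d) g2 q2" using arc2 by (rule convex_arc.shift_azimuth)
  interpret Q: convex_arc_pair L a1 g1 q1 "\<lambda>s. a2 s + 2 * d" g2 q2 using arc1 arc2' by (rule convex_arc_pair.intro)
  have tw: "Q.twist s s = P.twist s s + d" for s unfolding P.twist_def Q.twist_def half_twist_def by (simp add: field_simps)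
  interpret R: balanced_arc_pair L a1 g1 q1 "\<lambda>s. a2 s + 2 * d" g2 q2
  proof
    show "g1 s * g2 s < 1" if s: "s \<in> {0..L}" for s
    proof -
      have b: "0 < g1 s" "g1 s \<le> 1" "0 < g2 s" "g2 s \<le> 1"
        using P.A.g_pos[OF s] P.A.g_le_1[OF s] P.B.g_pos[OF s] P.B.g_le_1[OF s] by auto
      have "g1 s * g2 s \<noteq> 1"
      proof
        assume eq: "g1 s * g2 s = 1"
        have "g1 s * g2 s \<le> g1 s * 1" "g1 s * g2 s \<le> 1 * g2 s" using b by (intro mult_left_mono mult_right_mono; simp)+
        then have "g1 s = 1" "g2 s = 1" using b eq by auto
        then show False using ne[OF s] by simp
      qed
      moreover have "g1 s * g2 s \<le> 1" using b by (simp add: mult_le_one)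
      ultimately show ?thesis by simp
    qed
    show "\<bar>Q.twist s s\<bar> < pi / 2" if "s \<in> {0..L}" for s using d[OF that] by (simp add: tw)
  qed
  show ?thesis
    using R.combination_strictly_convex unfolding rot_sphere_point by blast
qed

lemma exists_balancing_rotation_of_cones:
  assumes "arc_length_azimuth h1 p1 M1 L a1" and "arc_length_azimuth h2 p2 M2 L a2"
    and ne: "\<And>s. s \<in> {0..L} \<Longrightarrow> \<not> (snd (polar_profile.trace h1 (a1 s)) = 0 \<and> snd (polar_profile.trace h2 (a2 s)) = 0)"
  shows "\<exists>d. \<forall>J :: complex \<times> real \<Rightarrow> real^3. euclidean_iso J \<longrightarrow> strictly_convex_cone_surface 0
     (cone_over L (\<lambda>s. J (polar_profile.trace h1 (a1 s)) + J (rot d (polar_profile.trace h2 (a2 s)))))"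
proof -
  interpret A: arc_length_azimuth h1 p1 M1 L a1 by fact
  interpret B: arc_length_azimuth h2 p2 M2 L a2 by fact
  have "\<not> (A.gap (a1 s) = 1 \<and> B.gap (a2 s) = 1)" if "s \<in> {0..L}" for s
    using ne[OF that] by (auto simp: A.gap_eq_1_iff B.gap_eq_1_iff A.trace_def B.trace_def)
  from exists_balancing_rotation_of_arcs[OF A.convex_arc B.convex_arc this]
  show ?thesis by (simp add: A.trace_eq_sphere_point B.trace_eq_sphere_point)
qed

lemma exists_balancing_isometry:
  assumes A: "arc_length_azimuth h1 p1 M1 L a1" and B: "unit_section S2 L r2"
    and ne: "\<And>s. s \<in> {0..L} \<Longrightarrow> \<not> (snd (polar_profile.trace h1 (a1 s)) = 0 \<and> snd (r2 s) = 0)"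
  shows "\<exists>R. euclidean_iso R \<and> (\<forall>J :: complex \<times> real \<Rightarrow> real^3. euclidean_iso J \<longrightarrow> strictly_convex_cone_surface 0
     (cone_over L (\<lambda>s. J (polar_profile.trace h1 (a1 s)) + J (R (r2 s)))))"
proof -
  interpret B: unit_section S2 L r2 by fact
  have go: ?thesis
    if F: "euclidean_iso F" and az: "arc_length_azimuth h2 p2 M2 L b"
      and eq: "\<And>s. s \<in> {0..L} \<Longrightarrow> F (r2 s) = polar_profile.trace h2 (b s)"
      and sn: "\<And>x. snd (F x) = snd x" for F h2 p2 M2 b
  proof -
    have "\<not> (snd (polar_profile.trace h1 (a1 s)) = 0 \<and> snd (polar_profile.trace h2 (b s)) = 0)" if "s \<in> {0..L}" for s
      using ne[OF that] eq[OF that, symmetric] sn by simp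
    from exists_balancing_rotation_of_cones[OF A az this] obtain d where
      d: "\<And>J :: complex \<times> real \<Rightarrow> real^3. euclidean_iso J \<Longrightarrow> strictly_convex_cone_surface 0
       (cone_over L (\<lambda>s. J (polar_profile.trace h1 (a1 s)) + J (rot d (polar_profile.trace h2 (b s)))))"
      by blast
    have same: "cone_over L (\<lambda>s. J (polar_profile.trace h1 (a1 s)) + J (rot d (polar_profile.trace h2 (b s))))
       = cone_over L (\<lambda>s. J (polar_profile.trace h1 (a1 s)) + J (rot d (F (r2 s))))" for J :: "complex \<times> real \<Rightarrow> real^3"
    proof -
      have "t *\<^sub>R (J (polar_profile.trace h1 (a1 s)) + J (rot d (polar_profile.trace h2 (b s)))) = t *\<^sub>R (J (polar_profile.trace h1 (a1 s)) + J (rot d (F (r2 s))))"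
        if "s \<in> {0..L}" for t s using eq[OF that] by simp
      then show ?thesis by (smt (verit) Collect_cong)
    qed
    show ?thesis
      using d euclidean_iso_compose[OF euclidean_iso_rot F] unfolding same
      by (intro exI[of _ "\<lambda>x. rot d (F x)"] conjI allI impI)
  qed
  from B.oriented_azimuth show ?thesis
  proof (elim disjE exE conjE)
    fix b assume "arc_length_azimuth B.circle_height B.circle_slope B.bound L b" "\<forall>s\<in>{0..L}. r2 s = B.trace (b s)"
    then show ?thesis by (intro go[of "\<lambda>x. x"]) (auto simp: euclidean_iso_def linear_ident bij_id[unfolded id_def])
  next
    fix b assume "arc_length_azimuth (upward_cone.circle_height (flip ` S2)) (upward_cone.circle_slope (flip ` S2)) (upward_cone.bound (flip ` S2)) L b"
      "\<forall>s\<in>{0..L}. flip (r2 s) = polar_profile.trace (upward_cone.circle_height (flip ` S2)) (b s)"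
    then show ?thesis by (intro go[OF euclidean_iso_flip]) (auto simp: flip_def)
  qed
qed

section \<open>Central axis of a solid cone\<close>

locale solid_cone =
  fixes T :: "'a::euclidean_space set"
  assumes closed_T: "closed T" and cone_T: "convex_cone T" and interior_T: "interior T \<noteq> {}" and T_proper: "T \<noteq> UNIV"
begin

lemma convex_T: "convex T" using cone_T by (simp add: convex_cone_def)

lemma scale_T: "x \<in> T \<Longrightarrow> 0 \<le> c \<Longrightarrow> c *\<^sub>R x \<in> T"
  by (rule convex_cone_scaleR[OF cone_T])

lemmas zero_T = convex_cone_contains_0[OF cone_T]
lemmas add_T = convex_cone_add[OF cone_T]

lemma add_interior: assumes "x \<in> T" "y \<in> interior T" shows "x + y \<in> interior T"
proof (rule interiorI)
  show "open ((\<lambda>z. x + z) ` interior T)" by (intro open_translation) simp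
  show "x + y \<in> (\<lambda>z. x + z) ` interior T" using assms(2) by auto
  show "(\<lambda>z. x + z) ` interior T \<subseteq> T" using add_T[OF assms(1)] interior_subset by blast
qed

lemma scale_interior: assumes "y \<in> interior T" "0 < c" shows "c *\<^sub>R y \<in> interior T"
proof (rule interiorI)
  show "open ((\<lambda>z. c *\<^sub>R z) ` interior T)" using assms(2) by (intro open_scaling) auto
  show "c *\<^sub>R y \<in> (\<lambda>z. c *\<^sub>R z) ` interior T" using assms(1) by auto
  show "(\<lambda>z. c *\<^sub>R z) ` interior T \<subseteq> T" using scale_T assms(2) interior_subset by fastforce
qed

lemma zero_not_interior: "0 \<notin> interior T"
proof
  assume "0 \<in> interior T"
  then obtain e where e: "e > 0" "cball 0 e \<subseteq> T" using mem_interior_cball by blast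
  have "x \<in> T" for x
  proof (cases "x = 0")
    case False
    have "(e / norm x) *\<^sub>R x \<in> T" using e False by auto
    from scale_T[OF this, of "norm x / e"] show ?thesis using e False by simp
  qed (simp add: zero_T)
  then show False using T_proper by blast
qed

lemma frontier_T: "x \<in> frontier T \<longleftrightarrow> x \<in> T \<and> x \<notin> interior T"
  using closed_T by (auto simp: frontier_def)

lemma scale_frontier: assumes "x \<in> frontier T" "0 \<le> c" shows "c *\<^sub>R x \<in> frontier T"
proof (cases "c = 0")
  case True
  then show ?thesis using zero_T zero_not_interior by (simp add: frontier_T)
next
  case False
  have "c *\<^sub>R x \<notin> interior T"
  proof
    assume "c *\<^sub>R x \<in> interior T"
    from scale_interior[OF this, of "inverse c"] have "x \<in> interior T" using False assms(2) by simp
    then show False using assms(1) by (simp add: frontier_T)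
  qed
  then show ?thesis using assms scale_T by (simp add: frontier_T)
qed

lemma opposite_in_frontier: assumes "x \<in> T" "- x \<in> T" shows "x \<in> frontier T" "- x \<in> frontier T"
  using assms add_interior[of x "- x"] add_interior[of "- x" x] zero_not_interior by (auto simp: frontier_T)

text \<open>Choose \<open>e\<close> in the interior of \<open>T\<close> and in the relative interior of the dual cone \<open>D\<close>. If these sets were disjoint,
a separating hyperplane would have a normal in \<open>D\<close> that is nonpositive on \<open>D\<close>, which is impossible. If \<open>x\<close> in
\<open>T\<close> is orthogonal to a relative interior point of \<open>D\<close>, it is orthogonal to \<open>D\<close>, so \<open>- x\<close> is in the
bidual cone \<open>T\<close>.\<close>
lemma exists_central_axis:
  "\<exists>e. norm e = 1 \<and> e \<in> interior T \<and> (\<forall>x\<in>T. 0 \<le> e \<bullet> x) \<and> (\<forall>x\<in>T. e \<bullet> x = 0 \<longrightarrow> - x \<in> T)"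
proof -
  define D where "D = {y. \<forall>x\<in>T. 0 \<le> y \<bullet> x}"
  have D_Int: "D = (\<Inter>x\<in>T. {y. 0 \<le> x \<bullet> y})" by (auto simp: D_def inner_commute)
  have D_convex: "convex D" unfolding D_Int by (intro convex_INT ballI convex_halfspace_ge)
  have D0: "0 \<in> D" by (simp add: D_def)
  have "interior T \<inter> rel_interior D \<noteq> {}"
  proof
    assume disj: "interior T \<inter> rel_interior D = {}"
    have "rel_interior D \<noteq> {}" using rel_interior_eq_empty[OF D_convex] D0 by auto
    then obtain a b where ab: "a \<noteq> 0" "\<And>x. x \<in> rel_interior D \<Longrightarrow> a \<bullet> x \<le> b" "\<And>x. x \<in> interior T \<Longrightarrow> b \<le> a \<bullet> x"
      using separating_hyperplane_sets[of "rel_interior D" "interior T"] disj interior_T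
        convex_rel_interior[OF D_convex] convex_interior[OF convex_T] by blast
    have T1: "b \<le> a \<bullet> x" if "x \<in> T" for x
    proof -
      have "closure (interior T) \<subseteq> {x. b \<le> a \<bullet> x}"
        using ab(3) by (intro closure_minimal closed_halfspace_ge) auto
      then show ?thesis using that closure_subset[of T] convex_closure_interior[OF convex_T interior_T] by auto
    qed
    have D1: "a \<bullet> x \<le> b" if "x \<in> D" for x
    proof -
      have "closure (rel_interior D) \<subseteq> {x. a \<bullet> x \<le> b}"
        using ab(2) by (intro closure_minimal closed_halfspace_le) auto
      then show ?thesis using that closure_subset[of D] convex_closure_rel_interior[OF D_convex] by auto
    qed
    have "b = 0" using T1[OF zero_T] D1[OF D0] by simp
    then have "a \<in> D" using T1 by (simp add: D_def)
    then have "a \<bullet> a \<le> 0" using D1 \<open>b = 0\<close> by blast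
    moreover have "0 < a \<bullet> a" using ab(1) inner_gt_zero_iff by blast
    ultimately show False by linarith
  qed
  then obtain e where e: "e \<in> interior T" "e \<in> rel_interior D" by blast
  have e0: "e \<noteq> 0" using e(1) zero_not_interior by auto
  have eD: "e \<in> D" using e(2) rel_interior_subset by blast
  have opp: "- x \<in> T" if x: "x \<in> T" "e \<bullet> x = 0" for x
  proof (rule ccontr)
    assume "- x \<notin> T"
    then obtain a b where ab: "a \<bullet> (- x) < b" "\<And>y. y \<in> T \<Longrightarrow> b < a \<bullet> y"
      using separating_hyperplane_closed_point[OF convex_T closed_T] by blast
    have b0: "b < 0" using ab(2)[OF zero_T] by simp
    have "a \<in> D"
      unfolding D_def
    proof (intro CollectI ballI)
      fix y assume y: "y \<in> T"
      show "0 \<le> a \<bullet> y"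
      proof (rule ccontr)
        assume neg: "\<not> 0 \<le> a \<bullet> y"
        have "(b / (a \<bullet> y)) *\<^sub>R y \<in> T" using y neg b0 by (intro scale_T) (auto intro: divide_nonpos_neg)
        from ab(2)[OF this] show False using neg by simp
      qed
    qed
    then have "a \<in> affine hull D" by (rule hull_inc)
    then obtain m where m: "m > 1" "(1 - m) *\<^sub>R a + m *\<^sub>R e \<in> D"
      using convex_rel_interior_if2[OF D_convex e(2)] by blast
    have "0 \<le> ((1 - m) *\<^sub>R a + m *\<^sub>R e) \<bullet> x" using m(2) x(1) by (simp add: D_def)
    then have "0 \<le> (1 - m) * (a \<bullet> x)" using x(2) by (simp add: inner_add_left)
    moreover have "0 < a \<bullet> x" using ab(1) b0 by simp
    ultimately show False using m(1) by (simp add: zero_le_mult_iff)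
  qed
  show ?thesis
  proof (intro exI conjI ballI impI)
    show "norm (e /\<^sub>R norm e) = 1" using e0 by simp
    show "e /\<^sub>R norm e \<in> interior T" using e0 by (intro scale_interior e(1)) simp
    show "0 \<le> (e /\<^sub>R norm e) \<bullet> x" if "x \<in> T" for x using that eD e0 by (simp add: D_def)
    show "- x \<in> T" if "x \<in> T" "(e /\<^sub>R norm e) \<bullet> x = 0" for x using that e0 by (intro opp) simp_all
  qed
qed

text \<open>A supporting plane at \<open>w\<close> contains the whole line of \<open>x\<close>.\<close>
lemma segment_in_frontier:
  assumes x: "x \<in> T" "- x \<in> T" and w: "w \<in> frontier T"
  shows "closed_segment x w \<subseteq> frontier T"
proof
  have wT: "w \<in> T" "w \<notin> interior T" using w by (auto simp: frontier_T)
  then have "w \<notin> rel_interior T" by (simp add: rel_interior_nonempty_interior[OF interior_T])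
  then obtain a where a: "a \<noteq> 0" "\<And>y. y \<in> T \<Longrightarrow> a \<bullet> w \<le> a \<bullet> y"
    by (rule supporting_hyperplane_rel_boundary[OF convex_T wT(1)]) blast
  have "a \<bullet> w = 0" using a(2)[OF zero_T] a(2)[OF scale_T[OF wT(1), of 2]] by simp
  then have nonneg: "0 \<le> a \<bullet> y" if "y \<in> T" for y using a(2)[OF that] by simp
  then have "a \<bullet> x = 0" using x[THEN nonneg] by simp
  fix z assume "z \<in> closed_segment x w"
  then obtain u where u: "0 \<le> u" "u \<le> 1" "z = (1 - u) *\<^sub>R x + u *\<^sub>R w" by (auto simp: in_segment)
  have "z \<in> T" unfolding u(3) using u x wT by (intro add_T scale_T) auto
  moreover have "z \<notin> interior T"
  proof
    assume "z \<in> interior T"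
    moreover have "T \<subseteq> {y. a \<bullet> y \<ge> 0}" using nonneg by auto
    ultimately have "z \<in> interior {y. a \<bullet> y \<ge> 0}" using interior_mono by blast
    then have "0 < a \<bullet> z" using a(1) by (simp add: interior_halfspace_ge)
    then show False using \<open>a \<bullet> x = 0\<close> \<open>a \<bullet> w = 0\<close> by (simp add: u(3) inner_add_right)
  qed
  ultimately show "z \<in> frontier T" by (simp add: frontier_T)
qed

end

text \<open>Passing to the closure changes neither the interior nor the frontier of a convex set.\<close>
lemma convex_cone_surface_solid:
  assumes "convex_cone_surface v F"
  obtains T where "solid_cone T" "F = (\<lambda>x. v + x) ` frontier T"
proof -
  obtain S where S: "convex_cone S" "interior S \<noteq> {}" "S \<noteq> UNIV" "F = (\<lambda>x. v + x) ` frontier S"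
    using assms unfolding convex_cone_surface_def by blast
  have conv: "convex S" and con: "conic S" using S(1) by (auto simp: convex_cone_def)
  have int: "interior (closure S) = interior S" using conv by (rule convex_interior_closure)
  have "solid_cone (closure S)"
  proof
    show "convex_cone (closure S)"
      using S(1) conv con convex_closure conic_closure unfolding convex_cone_def by (metis closure_eq_empty)
    show "interior (closure S) \<noteq> {}" using S(2) int by simp
    show "closure S \<noteq> UNIV"
    proof
      assume "closure S = UNIV"
      then have "interior S = UNIV" using int by simp
      then show False using S(3) interior_subset by blast
    qed
  qed simp
  moreover have "frontier (closure S) = frontier S" using int by (simp add: frontier_def)
  ultimately show ?thesis using that S(4) by metis
qed

definition embed3 :: "complex \<times> real \<Rightarrow> real^3" where
  "embed3 x = vector [Re (fst x), Im (fst x), snd x]"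

lemma euclidean_iso_embed3: "euclidean_iso embed3"
  unfolding euclidean_iso_def
proof (intro conjI allI)
  show "linear embed3" by (rule linearI) (auto simp: embed3_def vec_eq_iff forall_3)
  show "bij embed3"
    by (rule o_bij[of "\<lambda>y. (Complex (y$1) (y$2), y$3)"]) (auto simp: embed3_def fun_eq_iff vec_eq_iff forall_3)
  show "embed3 x \<bullet> embed3 y = x \<bullet> y" for x y
    by (simp add: embed3_def inner_vec_def sum_3 inner_prod_def inner_complex_def)
qed

lemma exists_coordinates:
  fixes e :: "real^3" assumes "norm e = 1"
  obtains J :: "complex \<times> real \<Rightarrow> real^3" where "euclidean_iso J" "J (0, 1) = e"
proof -
  have "norm (embed3 (0, 1)) = 1"
    using euclidean_iso_embed3 by (simp add: norm_eq_1 euclidean_iso_def)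
  then obtain f where f: "orthogonal_transformation f" "f (embed3 (0, 1)) = e"
    using orthogonal_transformation_exists_1[OF _ assms] by blast
  have "euclidean_iso f"
    using f(1) orthogonal_transformation_bij unfolding euclidean_iso_def orthogonal_transformation_def by blast
  then have "euclidean_iso (\<lambda>x. f (embed3 x))" by (rule euclidean_iso_compose[OF _ euclidean_iso_embed3])
  then show ?thesis using that f(2) by blast
qed

lemma (in solid_cone) upward_cone_coordinates:
  fixes J :: "complex \<times> real \<Rightarrow> 'a"
  assumes J: "euclidean_iso J" and e: "J (0, 1) \<in> interior T" "\<And>x. x \<in> T \<Longrightarrow> 0 \<le> J (0, 1) \<bullet> x"
  shows "upward_cone (inv J ` T)"
proof
  have I: "euclidean_iso (inv J)" using J by (rule euclidean_iso_inv)
  have inv: "inv J (J x) = x" "J (inv J y) = y" for x y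
    using J by (auto simp: euclidean_iso_def bij_def surj_f_inv_f)
  show "closed (inv J ` T)" using closed_T I unfolding euclidean_iso_def
    by (metis bij_def closed_injective_linear_image)
  show "convex_cone (inv J ` T)" using cone_T I unfolding euclidean_iso_def
    by (intro convex_cone_linear_image conjI) auto
  have "inv J (J (0, 1)) \<in> inv J ` interior T" using e(1) by (rule imageI)
  then show "(0, 1) \<in> interior (inv J ` T)" by (simp add: interior_euclidean_iso[OF I] inv)
  show "0 \<le> snd x" if "x \<in> inv J ` T" for x
  proof -
    have "J x \<in> T" using that inv by auto
    then have "0 \<le> J (0, 1) \<bullet> J x" by (rule e(2))
    also have "J (0, 1) \<bullet> J x = (0, 1) \<bullet> x" using J unfolding euclidean_iso_def by blast
    also have "\<dots> = snd x" by (cases x) simp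
    finally show ?thesis .
  qed
qed

section \<open>Isometries of cone surfaces\<close>

lemma dist_le_intrinsic_dist: "ennreal (dist x y) \<le> intrinsic_dist F x y"
  unfolding intrinsic_dist_def
proof (rule INF_greatest)
  fix g :: "real \<Rightarrow> 'a" assume "g \<in> {g. continuous_on {0..1} g \<and> g ` {0..1} \<subseteq> F \<and> g 0 = x \<and> g 1 = y}"
  then show "ennreal (dist x y) \<le> curve_length g 0 1" using dist_le_curve_length[of 0 0 1 1 g] by auto
qed

lemma intrinsic_dist_le_curve_length:
  assumes st: "s \<le> t" and r: "continuous_on {s..t} r" "r ` {s..t} \<subseteq> F"
  shows "intrinsic_dist F (r s) (r t) \<le> curve_length r s t"
proof (cases "s = t")
  case True
  have "intrinsic_dist F (r s) (r t) \<le> curve_length (\<lambda>_. r s) 0 1"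
    unfolding intrinsic_dist_def using r True by (intro INF_lower) auto
  also have "\<dots> \<le> ennreal (0 * (1 - 0))" by (rule curve_length_Lipschitz) auto
  finally show ?thesis by simp
next
  case False
  define p where "p = (\<lambda>u. s + u * (t - s))"
  have p: "continuous_on {0..1} p" unfolding p_def by (intro continuous_intros)
  have mono: "p x < p y" if "x < y" for x y using that st False by (simp add: p_def)
  have pI: "p u \<in> {s..t}" if "u \<in> {0..1}" for u
  proof -
    have "u * (t - s) \<le> 1 * (t - s)" using that st by (intro mult_right_mono) auto
    then show ?thesis using that st by (simp add: p_def)
  qed
  have "continuous_on {0..1} (\<lambda>u. r (p u))"
    by (rule continuous_on_compose2[OF r(1) p]) (use pI in auto)
  then have "intrinsic_dist F (r s) (r t) \<le> curve_length (\<lambda>u. r (p u)) 0 1"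
    unfolding intrinsic_dist_def using r(2) pI by (intro INF_lower) (auto simp: p_def)
  also have "\<dots> = curve_length r (p 0) (p 1)" by (rule curve_length_reparam[OF _ p mono]) auto
  finally show ?thesis by (simp add: p_def)
qed

text \<open>On a segment in the surface, the intrinsic distance is the Euclidean one.\<close>
lemma intrinsic_dist_segment:
  fixes x y :: "'a::real_normed_vector"
  assumes "closed_segment x y \<subseteq> F"
  shows "intrinsic_dist F x y = ennreal (dist x y)"
proof (rule antisym[OF _ dist_le_intrinsic_dist])
  have "intrinsic_dist F (linepath x y 0) (linepath x y 1) \<le> curve_length (linepath x y) 0 1"
    using assms by (intro intrinsic_dist_le_curve_length continuous_on_linepath) (auto simp flip: path_image_def)
  also have "\<dots> \<le> ennreal (dist x y * (1 - 0))"
  proof (rule curve_length_Lipschitz)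
    fix s t :: real assume "s \<le> t"
    have "linepath x y s - linepath x y t = (s - t) *\<^sub>R (y - x)" by (simp add: linepath_def algebra_simps)
    then show "dist (linepath x y s) (linepath x y t) \<le> dist x y * (t - s)"
      using \<open>s \<le> t\<close> by (simp add: dist_norm norm_minus_commute mult.commute)
  qed simp
  finally show "intrinsic_dist F x y \<le> ennreal (dist x y)" by (simp add: linepath_def)
qed

text \<open>Equality in the triangle inequality.\<close>
lemma point_on_segment:
  fixes a b :: "'a::real_inner"
  assumes t: "0 \<le> t" and a: "norm a = t * norm b" and ab: "norm (b - a) \<le> (1 - t) * norm b"
  shows "a = t *\<^sub>R b"
proof -
  have "(norm (b - a))\<^sup>2 \<le> ((1 - t) * norm b)\<^sup>2" using ab by (intro power_mono) auto
  moreover have "(norm (b - a))\<^sup>2 = (norm b)\<^sup>2 - 2 * (a \<bullet> b) + (norm a)\<^sup>2"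
    by (simp add: power2_norm_eq_inner algebra_simps inner_commute)
  ultimately have 1: "(norm b)\<^sup>2 - 2 * (a \<bullet> b) + t\<^sup>2 * (norm b)\<^sup>2 \<le> (1 - t)\<^sup>2 * (norm b)\<^sup>2"
    by (simp add: a power_mult_distrib)
  have "(1 - t)\<^sup>2 * (norm b)\<^sup>2 = (norm b)\<^sup>2 - 2 * t * (norm b)\<^sup>2 + t\<^sup>2 * (norm b)\<^sup>2"
    by (simp add: power2_eq_square algebra_simps)
  then have "t * (norm b)\<^sup>2 \<le> a \<bullet> b" using 1 by simp
  then have "t * (t * (norm b)\<^sup>2) \<le> t * (a \<bullet> b)" using t by (rule mult_left_mono)
  moreover have "(norm (a - t *\<^sub>R b))\<^sup>2 = (norm a)\<^sup>2 - 2 * (t * (a \<bullet> b)) + t * (t * (norm b)\<^sup>2)"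
    by (simp add: power2_norm_eq_inner algebra_simps inner_commute)
  moreover have "(norm a)\<^sup>2 = t * (t * (norm b)\<^sup>2)" by (simp add: a power2_eq_square)
  ultimately have "(norm (a - t *\<^sub>R b))\<^sup>2 \<le> 0" by linarith
  then show ?thesis by simp
qed

text \<open>Here \<open>K1\<close> and \<open>K2\<close> are the cones translated to the origin, and \<open>\<phi>\<close> below is the isometry between
them.\<close>
locale isometric_cones =
  fixes K1 K2 :: "(real^3) set" and v1 v2 :: "real^3" and f :: "real^3 \<Rightarrow> real^3"
  assumes cone1: "x \<in> K1 \<Longrightarrow> 0 \<le> c \<Longrightarrow> c *\<^sub>R x \<in> K1"
    and cone2: "x \<in> K2 \<Longrightarrow> 0 \<le> c \<Longrightarrow> c *\<^sub>R x \<in> K2"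
    and iso: "cone_isometry v1 ((\<lambda>x. v1 + x) ` K1) v2 ((\<lambda>x. v2 + x) ` K2) f"
begin

abbreviation "F1 \<equiv> (\<lambda>x. v1 + x) ` K1"
abbreviation "F2 \<equiv> (\<lambda>x. v2 + x) ` K2"

definition \<phi> :: "real^3 \<Rightarrow> real^3" where "\<phi> x = f (v1 + x) - v2"

lemma f_eq: "f (v1 + x) = v2 + \<phi> x" by (simp add: \<phi>_def)

lemma \<phi>_in: "x \<in> K1 \<Longrightarrow> \<phi> x \<in> K2"
proof -
  assume "x \<in> K1"
  then have "f (v1 + x) \<in> F2" using iso unfolding cone_isometry_def bij_betw_def by blast
  then show ?thesis by (auto simp: \<phi>_def)
qed

lemma \<phi>_onto: assumes "y \<in> K2" obtains x where "x \<in> K1" "\<phi> x = y"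
proof -
  have "v2 + y \<in> f ` F1" using assms iso unfolding cone_isometry_def bij_betw_def by blast
  then obtain x where x: "x \<in> K1" "v2 + y = f (v1 + x)" by blast
  have "\<phi> x = y" unfolding \<phi>_def x(2)[symmetric] by simp
  with x(1) show ?thesis by (rule that)
qed

lemma \<phi>_inj: "inj_on \<phi> K1"
proof (rule inj_onI)
  fix x y assume xy: "x \<in> K1" "y \<in> K1" "\<phi> x = \<phi> y"
  then have "f (v1 + x) = f (v1 + y)" by (simp add: \<phi>_def)
  moreover have "inj_on f F1" using iso unfolding cone_isometry_def bij_betw_def by blast
  ultimately have "v1 + x = v1 + y" using xy by (auto dest: inj_onD)
  then show "x = y" by simp
qed

lemma f_v1: "f v1 = v2" using iso by (simp add: cone_isometry_def)

lemma intrinsic_eq: "x \<in> K1 \<Longrightarrow> y \<in> K1 \<Longrightarrow> intrinsic_dist F2 (v2 + \<phi> x) (v2 + \<phi> y) = intrinsic_dist F1 (v1 + x) (v1 + y)"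
  using iso unfolding cone_isometry_def f_eq[symmetric] by blast

lemma shifted_segment: "closed_segment (v + x) (v + y) = (\<lambda>z. v + z) ` closed_segment x (y::real^3)"
  by (rule closed_segment_translation)

lemma \<phi>_contracts_segment:
  assumes "x \<in> K1" "y \<in> K1" "closed_segment x y \<subseteq> K1"
  shows "dist (\<phi> x) (\<phi> y) \<le> dist x y"
proof -
  have "ennreal (dist (v2 + \<phi> x) (v2 + \<phi> y)) \<le> intrinsic_dist F1 (v1 + x) (v1 + y)"
    using dist_le_intrinsic_dist intrinsic_eq[OF assms(1,2)] by metis
  also have "\<dots> = ennreal (dist (v1 + x) (v1 + y))"
    using assms(3) by (intro intrinsic_dist_segment) (auto simp: shifted_segment)
  finally show ?thesis by (simp add: ennreal_le_iff)
qed

lemma \<phi>_expands_segment: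
  assumes "x \<in> K1" "y \<in> K1" "closed_segment (\<phi> x) (\<phi> y) \<subseteq> K2"
  shows "dist x y \<le> dist (\<phi> x) (\<phi> y)"
proof -
  have "ennreal (dist (v1 + x) (v1 + y)) \<le> intrinsic_dist F2 (v2 + \<phi> x) (v2 + \<phi> y)"
    using dist_le_intrinsic_dist intrinsic_eq[OF assms(1,2)] by metis
  also have "\<dots> = ennreal (dist (v2 + \<phi> x) (v2 + \<phi> y))"
    using assms(3) by (intro intrinsic_dist_segment) (auto simp: shifted_segment)
  finally show ?thesis by (simp add: ennreal_le_iff)
qed

lemma \<phi>_0: "\<phi> 0 = 0" by (simp add: \<phi>_def f_v1)

lemma ray_segment1: "x \<in> K1 \<Longrightarrow> closed_segment (s *\<^sub>R x) (t *\<^sub>R x) \<subseteq> K1" if "0 \<le> s" "0 \<le> t" for s t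
proof
  fix z assume x: "x \<in> K1" and "z \<in> closed_segment (s *\<^sub>R x) (t *\<^sub>R x)"
  then obtain u where u: "0 \<le> u" "u \<le> 1" "z = (1 - u) *\<^sub>R (s *\<^sub>R x) + u *\<^sub>R (t *\<^sub>R x)" by (auto simp: in_segment)
  then have "z = ((1 - u) * s + u * t) *\<^sub>R x" by (simp add: algebra_simps)
  then show "z \<in> K1" using x u that by (simp add: cone1)
qed

lemma ray_segment2: "x \<in> K2 \<Longrightarrow> closed_segment 0 x \<subseteq> K2"
  using cone2 by (auto simp: in_segment)

lemma norm_\<phi>: assumes x: "x \<in> K1" shows "norm (\<phi> x) = norm x"
proof (rule antisym)
  have 0: "0 \<in> K1" using cone1[OF x, of 0] by simp
  show "norm (\<phi> x) \<le> norm x"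
    using \<phi>_contracts_segment[OF 0 x] ray_segment1[of 0 1 x] x by (simp add: \<phi>_0)
  show "norm x \<le> norm (\<phi> x)"
    using \<phi>_expands_segment[OF 0 x] ray_segment2[OF \<phi>_in[OF x]] by (simp add: \<phi>_0)
qed

text \<open>The image of a ray is a ray: distances to the vertex are preserved and distances along the ray do not increase, so
the triangle inequality through \<open>t *\<^sub>R x\<close> is an equality.\<close>
lemma \<phi>_shrink: assumes x: "x \<in> K1" and t: "0 \<le> t" "t \<le> 1" shows "\<phi> (t *\<^sub>R x) = t *\<^sub>R \<phi> x"
proof (rule point_on_segment[OF t(1)])
  have tx: "t *\<^sub>R x \<in> K1" by (rule cone1[OF x t(1)])
  show "norm (\<phi> (t *\<^sub>R x)) = t * norm (\<phi> x)" using norm_\<phi>[OF tx] norm_\<phi>[OF x] t by simp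
  have "dist (\<phi> (t *\<^sub>R x)) (\<phi> x) \<le> dist (t *\<^sub>R x) x"
    using ray_segment1[of t 1 x] x t tx by (intro \<phi>_contracts_segment) auto
  also have "dist (t *\<^sub>R x) x = (1 - t) * norm (\<phi> x)"
  proof -
    have "t *\<^sub>R x - x = (t - 1) *\<^sub>R x" by (simp add: algebra_simps)
    then show ?thesis using t norm_\<phi>[OF x] by (simp add: dist_norm)
  qed
  finally show "norm (\<phi> x - \<phi> (t *\<^sub>R x)) \<le> (1 - t) * norm (\<phi> x)" by (simp add: dist_norm norm_minus_commute)
qed

lemma \<phi>_scale: assumes x: "x \<in> K1" and t: "0 \<le> t" shows "\<phi> (t *\<^sub>R x) = t *\<^sub>R \<phi> x"
proof (cases "t \<le> 1")
  case True then show ?thesis by (rule \<phi>_shrink[OF x t])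
next
  case False
  have "\<phi> (inverse t *\<^sub>R (t *\<^sub>R x)) = inverse t *\<^sub>R \<phi> (t *\<^sub>R x)"
    using False by (intro \<phi>_shrink cone1 x t) (auto simp: inverse_le_1_iff)
  then have "t *\<^sub>R \<phi> x = t *\<^sub>R (inverse t *\<^sub>R \<phi> (t *\<^sub>R x))" using False by simp
  then show ?thesis using False by simp
qed

text \<open>Lengths of curves depend on the intrinsic metric only. One inequality for \<open>\<phi>\<close> and one for its inverse, both
by domination of chords.\<close>
lemma \<phi>_curve_length:
  assumes r: "continuous_on {a..b} r" "r ` {a..b} \<subseteq> K1" and ab: "a \<le> b"
    and unit: "\<And>s t. a \<le> s \<Longrightarrow> s \<le> t \<Longrightarrow> t \<le> b \<Longrightarrow> curve_length r s t = ennreal (t - s)"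
  shows "curve_length (\<lambda>s. \<phi> (r s)) a b = ennreal (b - a)"
proof -
  let ?g = "\<lambda>s. \<phi> (r s)"
  have shift: "curve_length (\<lambda>s. v + p s) s t = curve_length p s t" for v and p :: "real \<Rightarrow> real^3" and s t
    unfolding curve_length_def by simp
  have rK: "r s \<in> K1" if "a \<le> s" "s \<le> b" for s using r(2) that by auto
  have le1: "ennreal (dist (?g s) (?g t)) \<le> curve_length r s t" if st: "a \<le> s" "s \<le> t" "t \<le> b" for s t
  proof -
    have K: "r s \<in> K1" "r t \<in> K1" using r(2) st by auto
    have "ennreal (dist (v2 + ?g s) (v2 + ?g t)) \<le> intrinsic_dist F1 (v1 + r s) (v1 + r t)"
      using dist_le_intrinsic_dist intrinsic_eq[OF K] by metis
    also have "\<dots> \<le> curve_length (\<lambda>s. v1 + r s) s t"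
      using st by (intro intrinsic_dist_le_curve_length continuous_intros continuous_on_subset[OF r(1)]) (auto intro!: rK imageI)
    finally show ?thesis by (simp add: shift)
  qed
  then have up: "curve_length ?g a b \<le> curve_length r a b"
    by (intro curve_length_le_superadditive curve_length_superadditive) auto
  have lip: "dist (?g s) (?g t) \<le> t - s" if "a \<le> s" "s \<le> t" "t \<le> b" for s t
    using le1[OF that] unit[OF that] that by (simp add: ennreal_le_iff)
  have "1-lipschitz_on {a..b} ?g"
  proof (rule lipschitz_onI)
    fix s t assume "s \<in> {a..b}" "t \<in> {a..b}"
    then show "dist (?g s) (?g t) \<le> 1 * dist s t"
      using lip[of s t] lip[of t s] by (cases "s \<le> t") (auto simp: dist_real_def dist_commute)
  qed simp
  then have gc: "continuous_on {a..b} ?g" by (rule lipschitz_on_continuous_on)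
  have "ennreal (dist (r s) (r t)) \<le> curve_length ?g s t" if st: "a \<le> s" "s \<le> t" "t \<le> b" for s t
  proof -
    have K: "r s \<in> K1" "r t \<in> K1" using r(2) st by auto
    have "ennreal (dist (v1 + r s) (v1 + r t)) \<le> intrinsic_dist F2 (v2 + ?g s) (v2 + ?g t)"
      using dist_le_intrinsic_dist intrinsic_eq[OF K] by metis
    also have "\<dots> \<le> curve_length (\<lambda>s. v2 + ?g s) s t"
      using st by (intro intrinsic_dist_le_curve_length continuous_intros continuous_on_subset[OF gc]) (auto intro!: rK \<phi>_in imageI)
    finally show ?thesis by (simp add: shift)
  qed
  then have "curve_length r a b \<le> curve_length ?g a b"
    by (intro curve_length_le_superadditive curve_length_superadditive) auto
  then show ?thesis using up unit[of a b] ab by auto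
qed

end

section \<open>Strictly convex isometric combinations\<close>

text \<open>Starting at azimuth 0, one turn covers the principal values of the argument.\<close>
lemma (in upward_cone) section_of_azimuth:
  assumes az: "arc_length_azimuth circle_height circle_slope bound L a" and a0: "a 0 = 0"
  shows "(\<lambda>s. trace (a s)) ` {0..L} = frontier S \<inter> sphere 0 1" (is ?image)
    and "inj_on (\<lambda>s. trace (a s)) {0..<L}" (is ?inj)
    and "trace (a 0) = trace (a L)" (is ?closed)
    and "continuous_on {0..L} (\<lambda>s. trace (a s))" (is ?cont)
    and "0 \<le> s \<Longrightarrow> s \<le> t \<Longrightarrow> t \<le> L \<Longrightarrow> curve_length (\<lambda>s. trace (a s)) s t = ennreal (t - s)"
proof -
  interpret A: arc_length_azimuth circle_height circle_slope bound L a by (rule az)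
  have aL: "a L = 2 * pi" using A.a_closing a0 by simp
  show ?image
  proof (intro equalityI subsetI)
    fix x assume x: "x \<in> frontier S \<inter> sphere 0 1"
    then have n: "norm x = 1" "x \<in> frontier S" by auto
    let ?t = "Arg2pi (fst x)"
    have ne: "fst x \<noteq> 0" using unit_frontier_point(1)[OF n(2,1)] .
    have "fst x = norm (fst x) * exp (\<i> * ?t)" by (rule Arg2pi_eq)
    then have "cis ?t = fst x /\<^sub>R norm (fst x)"
      using ne by (simp add: cis_conv_exp scaleR_conv_of_real field_simps)
    then have eq: "x = trace ?t" by (rule unit_frontier_point(2)[OF n(2,1)])
    have "a 0 \<le> ?t" "?t \<le> a L" using Arg2pi_ge_0[of "fst x"] Arg2pi_lt_2pi[of "fst x"] a0 aL by auto
    then obtain s where s: "0 \<le> s" "s \<le> L" "a s = ?t" using IVT'[of a 0 ?t L] A.a_cont A.L_pos by auto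
    show "x \<in> (\<lambda>s. trace (a s)) ` {0..L}"
    proof (rule image_eqI)
      show "x = trace (a s)" unfolding s(3) by (rule eq)
    qed (use s in simp)
  qed (auto simp: trace_in_frontier trace_unit)
  show ?inj
  proof (rule linorder_inj_onI)
    fix s t assume st: "s < t" "s \<in> {0..<L}" "t \<in> {0..<L}"
    have "a s < a t" using A.a_less[of s t] st by auto
    moreover have "a t < a L" using A.a_less[of t L] st by auto
    moreover have "a 0 \<le> a s" using A.a_less[of 0 s] st by (cases "s = 0") auto
    ultimately show "trace (a s) \<noteq> trace (a t)" using a0 aL by (intro trace_arc_injective) auto
  qed auto
  show ?closed by (rule trace_cis) (simp add: a0 aL)
  show ?cont by (rule continuous_on_compose2[OF trace_cont A.a_cont]) auto
  show "curve_length (\<lambda>s. trace (a s)) s t = ennreal (t - s)" if "0 \<le> s" "s \<le> t" "t \<le> L"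
  proof -
    have "curve_length (\<lambda>s. trace (a s)) s t = curve_length trace (a s) (a t)"
      using that A.a_less by (intro curve_length_reparam continuous_on_subset[OF A.a_cont]) auto
    then show ?thesis using A.length_between[OF that] by simp
  qed
qed

lemma (in isometric_cones) arc_length_param_image:
  assumes r: "arc_length_param K1 L r" "continuous_on {0..L} r"
    and unit: "\<And>s t. 0 \<le> s \<Longrightarrow> s \<le> t \<Longrightarrow> t \<le> L \<Longrightarrow> curve_length r s t = ennreal (t - s)"
  shows "arc_length_param K2 L (\<lambda>s. \<phi> (r s))"
proof -
  have im: "r ` {0..L} = K1 \<inter> sphere 0 1" using r(1) by (simp add: arc_length_param_def)
  have rK: "r s \<in> K1" if "s \<in> {0..L}" for s using im that by auto
  have "\<phi> ` (K1 \<inter> sphere 0 1) = K2 \<inter> sphere 0 1"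
  proof (intro equalityI subsetI)
    fix y assume y: "y \<in> K2 \<inter> sphere 0 1"
    then obtain x where x: "x \<in> K1" "\<phi> x = y" using \<phi>_onto by blast
    then have "norm x = 1" using norm_\<phi>[OF x(1)] y by simp
    then show "y \<in> \<phi> ` (K1 \<inter> sphere 0 1)" using x by auto
  qed (auto simp: \<phi>_in norm_\<phi>)
  then have "(\<lambda>s. \<phi> (r s)) ` {0..L} = K2 \<inter> sphere 0 1" unfolding im[symmetric] by (simp add: image_image)
  moreover have "inj_on (\<lambda>s. \<phi> (r s)) {0..<L}"
  proof (rule inj_onI)
    fix s t assume st: "s \<in> {0..<L}" "t \<in> {0..<L}" "\<phi> (r s) = \<phi> (r t)"
    then have "r s = r t" using \<phi>_inj rK[of s] rK[of t] by (auto dest: inj_onD)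
    then show "s = t" using r(1) st unfolding arc_length_param_def by (auto dest: inj_onD)
  qed
  moreover have "curve_length (\<lambda>s. \<phi> (r s)) 0 s = ennreal s" if "s \<in> {0..L}" for s
  proof -
    have "continuous_on {0..s} r" using that by (intro continuous_on_subset[OF r(2)]) auto
    moreover have "r ` {0..s} \<subseteq> K1" using rK that by (auto intro!: rK)
    ultimately have "curve_length (\<lambda>s. \<phi> (r s)) 0 s = ennreal (s - 0)"
      using that by (intro \<phi>_curve_length unit) auto
    then show ?thesis by simp
  qed
  ultimately show ?thesis using r(1) by (simp add: arc_length_param_def)
qed

text \<open>Let \<open>w\<close> be the preimage of \<open>- \<phi> x\<close>. The segment from \<open>x\<close> to \<open>w\<close> lies in the cone because the cone
contains the line of \<open>x\<close>, so \<open>\<phi>\<close> does not increase its length. As \<open>\<phi> x\<close> and \<open>\<phi> w\<close> have distance 2, so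
do the unit vectors \<open>x\<close> and \<open>w\<close>, and \<open>w = - x\<close>.\<close>
lemma (in isometric_cones) opposite_rays_line:
  assumes T1: "solid_cone T1" "K1 = frontier T1" and T2: "solid_cone T2" "K2 = frontier T2"
    and x: "x \<in> K1" "norm x = 1" "- x \<in> T1" "- \<phi> x \<in> T2"
  shows "maps_line_to_line v1 F1 f"
proof -
  interpret A: solid_cone T1 by fact
  interpret B: solid_cone T2 by fact
  have xT: "x \<in> T1" "\<phi> x \<in> T2" using x(1) \<phi>_in[OF x(1)] by (auto simp: T1(2) T2(2) A.frontier_T B.frontier_T)
  have mx: "- x \<in> K1" using A.opposite_in_frontier(2)[OF xT(1) x(3)] T1(2) by simp
  have "- \<phi> x \<in> K2" using B.opposite_in_frontier(2)[OF xT(2) x(4)] T2(2) by simp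
  then obtain w where w: "w \<in> K1" "\<phi> w = - \<phi> x" by (rule \<phi>_onto)
  have nw: "norm w = 1" using norm_\<phi>[OF w(1)] norm_\<phi>[OF x(1)] w(2) x(2) by simp
  have "closed_segment x w \<subseteq> K1" using A.segment_in_frontier[OF xT(1) x(3)] w(1) T1(2) by blast
  then have "dist (\<phi> x) (\<phi> w) \<le> dist x w" by (rule \<phi>_contracts_segment[OF x(1) w(1)])
  moreover have "dist (\<phi> x) (\<phi> w) = 2"
  proof -
    have "\<phi> x - \<phi> w = 2 *\<^sub>R \<phi> x" unfolding w(2) by (simp add: scaleR_2)
    then show ?thesis using norm_\<phi>[OF x(1)] x(2) by (simp add: dist_norm)
  qed
  ultimately have "2\<^sup>2 \<le> (norm (x - w))\<^sup>2" by (intro power_mono) (auto simp: dist_norm)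
  moreover have "(norm (x - w))\<^sup>2 + (norm (x + w))\<^sup>2 = 2 * (norm x)\<^sup>2 + 2 * (norm w)\<^sup>2"
    by (simp add: power2_norm_eq_inner algebra_simps inner_commute)
  moreover have four: "2\<^sup>2 = (4::real)" by simp
  ultimately have "(norm (x + w))\<^sup>2 \<le> 0" unfolding x(2) nw power_one four by linarith
  then have "x + w = 0" by simp
  then have "w = - x" by (simp add: add_eq_0_iff)
  then have mphi: "\<phi> (- x) = - \<phi> x" using w(2) by simp
  have scale: "t *\<^sub>R x \<in> K1 \<and> \<phi> (t *\<^sub>R x) = t *\<^sub>R \<phi> x" for t
  proof (cases "0 \<le> t")
    case True
    then show ?thesis using cone1[OF x(1)] \<phi>_scale[OF x(1)] by blast
  next
    case False
    then show ?thesis using cone1[OF mx, of "- t"] \<phi>_scale[OF mx, of "- t"] mphi by simp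
  qed
  have "f ` range (\<lambda>t. v1 + t *\<^sub>R x) = range (\<lambda>t. f v1 + t *\<^sub>R \<phi> x)"
    using scale by (simp add: image_image f_eq f_v1)
  moreover have "range (\<lambda>t. v1 + t *\<^sub>R x) \<subseteq> F1" using scale by auto
  moreover have "x \<noteq> 0" "\<phi> x \<noteq> 0" using x(2) norm_\<phi>[OF x(1)] by auto
  ultimately show ?thesis unfolding maps_line_to_line_def by blast
qed

lemma exists_upward_coordinates:
  fixes T :: "(real^3) set"
  assumes "solid_cone T"
  obtains J :: "complex \<times> real \<Rightarrow> real^3" where
    "euclidean_iso J" "upward_cone (inv J ` T)" "\<And>x. x \<in> T \<Longrightarrow> snd (inv J x) = 0 \<Longrightarrow> - x \<in> T"
proof -
  interpret solid_cone T by fact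
  obtain e where e: "norm e = 1" "e \<in> interior T" "\<And>x. x \<in> T \<Longrightarrow> 0 \<le> e \<bullet> x" "\<And>x. x \<in> T \<Longrightarrow> e \<bullet> x = 0 \<Longrightarrow> - x \<in> T"
    using exists_central_axis by blast
  obtain J :: "complex \<times> real \<Rightarrow> real^3" where J: "euclidean_iso J" "J (0, 1) = e"
    using exists_coordinates[OF e(1)] .
  show ?thesis
  proof
    show "upward_cone (inv J ` T)" using e(2,3) by (intro upward_cone_coordinates) (auto simp: J)
    show "- x \<in> T" if x: "x \<in> T" "snd (inv J x) = 0" for x
    proof (rule e(4)[OF x(1)])
      have "J (0, 1) \<bullet> J (inv J x) = (0, 1) \<bullet> inv J x" using J(1) unfolding euclidean_iso_def by blast
      moreover have "J (inv J x) = x" using J(1) by (simp add: euclidean_iso_def bij_is_surj surj_f_inv_f)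
      ultimately show "e \<bullet> x = 0" using x(2) J(2) by (cases "inv J x") simp
    qed
  qed (rule J(1))
qed

lemma arc_length_param_isometry:
  fixes J :: "real^3 \<Rightarrow> real^3"
  assumes J: "euclidean_iso J" and r: "arc_length_param K L r"
  shows "arc_length_param (J ` K) L (\<lambda>s. J (r s))"
proof -
  have inj: "inj J" using J by (simp add: euclidean_iso_def bij_is_inj)
  have "(\<lambda>s. J (r s)) ` {0..L} = J ` (K \<inter> sphere 0 1)"
    using r by (simp add: arc_length_param_def image_image[symmetric])
  also have "\<dots> = J ` K \<inter> sphere 0 1" using euclidean_iso_norm[OF J] by auto
  finally show ?thesis
    using r inj unfolding arc_length_param_def
    by (auto simp: curve_length_isometry[OF euclidean_iso_dist[OF J]] inj_on_def)
qed

theorem theorem4: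
  fixes F1 F2 :: "(real^3) set" and v1 v2 :: "real^3" and f :: "real^3 \<Rightarrow> real^3"
  assumes "convex_cone_surface v1 F1"
    and "convex_cone_surface v2 F2"
    and "cone_isometry v1 F1 v2 F2 f"
    and "\<not> maps_line_to_line v1 F1 f"
  shows "\<exists>g :: real^3 \<Rightarrow> real^3. (\<forall>x y. dist (g x) (g y) = dist x y) \<and> g v2 = 0 \<and>
    (\<exists>C. isometric_combination ((\<lambda>x. x - v1) ` F1) (g ` F2) (\<lambda>x. g (f (x + v1))) C \<and>
      strictly_convex_cone_surface 0 C)"
proof -
  obtain T1 where T1: "solid_cone T1" and F1: "F1 = (\<lambda>x. v1 + x) ` frontier T1"
    using convex_cone_surface_solid[OF assms(1)] .
  obtain T2 where T2: "solid_cone T2" and F2: "F2 = (\<lambda>x. v2 + x) ` frontier T2"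
    using convex_cone_surface_solid[OF assms(2)] .
  interpret A: solid_cone T1 by (rule T1)
  interpret B: solid_cone T2 by (rule T2)
  interpret isometric_cones "frontier T1" "frontier T2" v1 v2 f
    using assms(3) by unfold_locales (auto simp: F1 F2 A.scale_frontier B.scale_frontier)
  obtain J1 :: "complex \<times> real \<Rightarrow> real^3" where J1: "euclidean_iso J1" and up1: "upward_cone (inv J1 ` T1)"
    and opp1: "\<And>x. x \<in> T1 \<Longrightarrow> snd (inv J1 x) = 0 \<Longrightarrow> - x \<in> T1"
    using exists_upward_coordinates[OF T1] by metis
  obtain J2 :: "complex \<times> real \<Rightarrow> real^3" where J2: "euclidean_iso J2" and up2: "upward_cone (inv J2 ` T2)"
    and opp2: "\<And>x. x \<in> T2 \<Longrightarrow> snd (inv J2 x) = 0 \<Longrightarrow> - x \<in> T2"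
    using exists_upward_coordinates[OF T2] by metis
  have I1: "euclidean_iso (inv J1)" and I2: "euclidean_iso (inv J2)"
    using J1 J2 by (simp_all add: euclidean_iso_inv)
  have J1_inv: "J1 (inv J1 x) = x" "inv J1 (J1 y) = y" for x y
    using J1 by (auto simp: euclidean_iso_def bij_def surj_f_inv_f)
  have J2_inv: "J2 (inv J2 x) = x" "inv J2 (J2 y) = y" for x y
    using J2 by (auto simp: euclidean_iso_def bij_def surj_f_inv_f)
  interpret U: upward_cone "inv J1 ` T1" by (rule up1)
  obtain L a where az: "arc_length_azimuth U.circle_height U.circle_slope U.bound L a" and a0: "a 0 = 0"
    using U.exists_arc_length_azimuth by blast
  interpret az: arc_length_azimuth U.circle_height U.circle_slope U.bound L a by (rule az)
  note sec = U.section_of_azimuth[OF az a0]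
  define r1 where "r1 = (\<lambda>s. J1 (U.trace (a s)))"
  have len1: "curve_length r1 s t = ennreal (t - s)" if "0 \<le> s" "s \<le> t" "t \<le> L" for s t
    unfolding r1_def curve_length_isometry[OF euclidean_iso_dist[OF J1]] by (rule sec(5)[OF that])
  have J1_cont: "continuous_on UNIV J1"
    using J1 by (intro linear_continuous_on) (simp add: euclidean_iso_def linear_linear)
  have cont1: "continuous_on {0..L} r1"
    unfolding r1_def by (rule continuous_on_compose2[OF J1_cont sec(4)]) auto
  have param1: "arc_length_param (frontier T1) L r1"
  proof -
    have "r1 ` {0..L} = J1 ` (inv J1 ` frontier T1 \<inter> sphere 0 1)"
      unfolding r1_def sec(1)[unfolded frontier_euclidean_iso[OF I1], symmetric] image_image ..
    also have "\<dots> = frontier T1 \<inter> sphere 0 1"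
    proof (intro equalityI subsetI)
      fix x assume "x \<in> frontier T1 \<inter> sphere 0 1"
      then have "inv J1 x \<in> inv J1 ` frontier T1 \<inter> sphere 0 1" by (simp add: euclidean_iso_norm[OF I1])
      then have "J1 (inv J1 x) \<in> J1 ` (inv J1 ` frontier T1 \<inter> sphere 0 1)" by (rule imageI)
      then show "x \<in> J1 ` (inv J1 ` frontier T1 \<inter> sphere 0 1)" unfolding J1_inv .
    qed (auto simp: J1_inv euclidean_iso_norm[OF J1] euclidean_iso_norm[OF I1])
    finally have im: "r1 ` {0..L} = frontier T1 \<inter> sphere 0 1" .
    have "inj_on r1 {0..<L}"
      unfolding r1_def
    proof (rule inj_onI)
      fix s t assume st: "s \<in> {0..<L}" "t \<in> {0..<L}" "J1 (U.trace (a s)) = J1 (U.trace (a t))"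
      have "U.trace (a s) = U.trace (a t)" using arg_cong[OF st(3), of "inv J1"] unfolding J1_inv .
      then show "s = t" using inj_onD[OF sec(2)] st(1,2) by blast
    qed
    then show ?thesis using im len1[of 0] sec(3) az.L_pos by (auto simp: arc_length_param_def r1_def)
  qed
  have r1_in: "r1 s \<in> frontier T1" "norm (r1 s) = 1" if "s \<in> {0..L}" for s
  proof -
    have "r1 s \<in> frontier T1 \<inter> sphere 0 1" using param1 that unfolding arc_length_param_def by blast
    then show "r1 s \<in> frontier T1" "norm (r1 s) = 1" by auto
  qed
  define r2 where "r2 = (\<lambda>s. \<phi> (r1 s))"
  have param2: "arc_length_param (frontier T2) L r2"
    unfolding r2_def by (rule arc_length_param_image[OF param1 cont1 len1])
  have r2_in: "r2 s \<in> frontier T2" "norm (r2 s) = 1" if "s \<in> {0..L}" for s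
    unfolding r2_def using r1_in[OF that] by (simp_all add: \<phi>_in norm_\<phi>)
  have sec2: "unit_section (inv J2 ` T2) L (\<lambda>s. inv J2 (r2 s))"
  proof (intro unit_section.intro up2 unit_section_axioms.intro)
    show "0 < L" by (rule az.L_pos)
    show "inv J2 (r2 s) \<in> frontier (inv J2 ` T2) \<and> norm (inv J2 (r2 s)) = 1" if "s \<in> {0..L}" for s
      using r2_in[OF that] by (simp add: frontier_euclidean_iso[OF I2] euclidean_iso_norm[OF I2])
    show "inv J2 (r2 L) = inv J2 (r2 0)" using param2 by (simp add: arc_length_param_def)
    show "inj_on (\<lambda>s. inv J2 (r2 s)) {0..<L}"
    proof (rule inj_onI)
      fix s t assume st: "s \<in> {0..<L}" "t \<in> {0..<L}" "inv J2 (r2 s) = inv J2 (r2 t)"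
      have "r2 s = r2 t" using arg_cong[OF st(3), of J2] unfolding J2_inv .
      moreover have "inj_on r2 {0..<L}" using param2 by (simp add: arc_length_param_def)
      ultimately show "s = t" using st by (auto dest: inj_onD)
    qed
    show "curve_length (\<lambda>s. inv J2 (r2 s)) 0 s = ennreal s" if "s \<in> {0..L}" for s
      using param2 that by (simp add: arc_length_param_def curve_length_isometry[OF euclidean_iso_dist[OF I2]])
  qed
  have "\<not> (snd (U.trace (a s)) = 0 \<and> snd (inv J2 (r2 s)) = 0)" if s: "s \<in> {0..L}" for s
  proof
    assume z: "snd (U.trace (a s)) = 0 \<and> snd (inv J2 (r2 s)) = 0"
    have "r1 s \<in> T1" "r2 s \<in> T2" using r1_in(1)[OF s] r2_in(1)[OF s] by (auto simp: A.frontier_T B.frontier_T)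
    moreover have "snd (inv J1 (r1 s)) = 0" using z by (simp add: r1_def J1_inv)
    ultimately have "- r1 s \<in> T1" "- r2 s \<in> T2" using opp1 opp2 z by auto
    then have "maps_line_to_line v1 ((\<lambda>x. v1 + x) ` frontier T1) f"
      using r1_in[OF s] by (intro opposite_rays_line[OF T1 refl T2 refl]) (auto simp: r2_def)
    then show False using assms(4) F1 by simp
  qed
  from exists_balancing_isometry[OF az sec2 this] obtain R where
    R: "euclidean_iso R" and convex: "strictly_convex_cone_surface 0
      (cone_over L (\<lambda>s. J1 (U.trace (a s)) + J1 (R (inv J2 (r2 s)))))"
    using J1 by blast
(* from the second cone to its coordinates, balance, and to the axis of the first cone *)
  define Q where "Q = (\<lambda>x. J1 (R (inv J2 x)))"
  have Q: "euclidean_iso Q" unfolding Q_def by (rule euclidean_iso_compose[OF J1 euclidean_iso_compose[OF R I2]])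
  have Q_scale: "Q (c *\<^sub>R x) = c *\<^sub>R Q x" for c x
    using Q by (simp add: euclidean_iso_def linear_scale)
  have F1_shift: "(\<lambda>x. x - v1) ` F1 = frontier T1" by (simp add: F1 image_image)
  have F2_shift: "(\<lambda>x. Q (x - v2)) ` F2 = Q ` frontier T2" by (simp add: F2 image_image)
  have "isometric_combination (frontier T1) (Q ` frontier T2) (\<lambda>x. Q (f (x + v1) - v2))
      (cone_over L (\<lambda>s. r1 s + Q (r2 s)))"
    unfolding isometric_combination_def
  proof (intro exI conjI allI impI ballI)
    show "Q (f (t *\<^sub>R r1 s + v1) - v2) = t *\<^sub>R Q (r2 s)" if "0 \<le> t" "s \<in> {0..L}" for t s
    proof -
      have "f (t *\<^sub>R r1 s + v1) = v2 + \<phi> (t *\<^sub>R r1 s)" by (simp add: add.commute flip: f_eq)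
      then show ?thesis using \<phi>_scale[OF r1_in(1)[OF that(2)] that(1)] by (simp add: Q_scale r2_def)
    qed
  qed (use param1 arc_length_param_isometry[OF Q param2] in auto)
  moreover have "strictly_convex_cone_surface 0 (cone_over L (\<lambda>s. r1 s + Q (r2 s)))"
    using convex by (simp only: Q_def r1_def)
  moreover have "dist (Q (x - v2)) (Q (y - v2)) = dist x y" for x y
    unfolding euclidean_iso_dist[OF Q] by (simp add: dist_norm)
  moreover have "Q (v2 - v2) = 0" using Q_scale[of 0 0] by simp
  ultimately show ?thesis
    unfolding F1_shift[symmetric] F2_shift[symmetric] by (intro exI[of _ "\<lambda>x. Q (x - v2)"]) blast
qed

end
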